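(* Let $H=(V,E)$ be a unique-path network with link capacities $c_{uv}>0$ and arrival rates $\lambda_u\ge0$. Under the Oldest-Useful discipline the network has maximum stability region; that is, it is stable if and only if $$\sum_{u\in S}\lambda_u<\sum_{(u,v)\in E:\ u\in S,\ v\notin S}c_{uv}\qquad\text{for every } S\subset V,\ S\ne V,\ \text{with } \sum_{u\in S}\lambda_u>0 .$$
   Context: Network model. $H=(V,E)$ is a finite directed graph. At each node $u\in V$ new packets are created (arrive exogenously) according to a Poisson process of rate $\lambda_u\ge0$; $u$ is the source of these packets. For each link $(u,v)\in E$ there is a Poisson process of rate $c_{uv}>0$ of communication epochs; at each such epoch node $u$ may instantly transmit a copy of one packet to node $v$ (keeping its own copy). All these Poisson processes are mutually independent. A packet leaves the network as soon as it is available at all nodes of $V$. A packet is useful on link $(u,v)$ at a given time if it is available at $u$ but not at $v$ (it need not have source $u$). A network is unique-path if for any two distinct nodes $u,v$ the graph $H$ has at most one directed path from $u$ to $v$ not visiting any node more than once. Oldest-Useful discipline: at each communication epoch of link $(u,v)$, the oldest (earliest exogenously arrived) packet among those currently useful on $(u,v)$ is transmitted; if there is none, nothing happens. State and stability. The packets present are labelled $1,\dots,k$ in order of exogenous arrival (1 is the oldest), labels being decremented when an older packet leaves; the state $X(t)$ records, for each present packet, its source and the set of nodes at which it is available. $X(\cdot)$ is a continuous-time Markov chain on the countable set of states reachable from the empty state. The network is stable if $X(\cdot)$ is positive recurrent (equivalently, has a stationary distribution). The displayed cut condition is necessary for stability under any discipline, so a discipline under which it is also sufficient achieves the maximum stability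 region. *)

theory Defs
  imports "HOL-Probability.Probability" "Graph_Theory.Graph_Theory"
begin

definition unique_path :: "'v pair_pre_digraph \<Rightarrow> bool" where
  "unique_path G \<longleftrightarrow> (\<forall>u v p q. u \<noteq> v \<longrightarrow>
     pre_digraph.apath (with_proj G) u p v \<longrightarrow> pre_digraph.apath (with_proj G) u q v \<longrightarrow> p = q)"

text \<open>The packets present, oldest first; each is given by its source and the set of nodes at
  which it is available. The label of a packet is its position in the list (counted from 1).\<close>

type_synonym 'v state = "('v \<times> 'v set) list"

primrec send_oldest_useful :: "'v \<times> 'v \<Rightarrow> 'v state \<Rightarrow> 'v state" where
  "send_oldest_useful e [] = []"
| "send_oldest_useful e (p # ps) =
     (if fst e \<in> snd p \<and> snd e \<notin> snd p then (fst p, insert (snd e) (snd p)) # ps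
      else p # send_oldest_useful e ps)"

definition depart :: "'v pair_pre_digraph \<Rightarrow> 'v state \<Rightarrow> 'v state" where
  "depart G x = filter (\<lambda>p. snd p \<noteq> pverts G) x"

datatype 'v clock = Arrival 'v | Link "'v \<times> 'v"

primrec clock_rate :: "('v \<Rightarrow> real) \<Rightarrow> ('v \<times> 'v \<Rightarrow> real) \<Rightarrow> 'v clock \<Rightarrow> real" where
  "clock_rate arr c (Arrival u) = arr u"
| "clock_rate arr c (Link e) = c e"

text \<open>A Poisson process of rate 0 has no epochs, so nodes without arrivals carry no clock.\<close>

definition clocks :: "'v pair_pre_digraph \<Rightarrow> ('v \<Rightarrow> real) \<Rightarrow> 'v clock set" where
  "clocks G arr = Arrival ` {u \<in> pverts G. arr u > 0} \<union> Link ` parcs G"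

definition transition :: "'v pair_pre_digraph \<Rightarrow> 'v clock \<Rightarrow> 'v state \<Rightarrow> 'v state" where
  "transition G a x = depart G
     (case a of Arrival u \<Rightarrow> x @ [(u, {u})] | Link e \<Rightarrow> send_oldest_useful e x)"

text \<open>A Poisson process is given by its sequence of gaps between successive epochs (the 0th gap
  being the time until the first epoch), which are independent exponential variables.\<close>

definition poisson_gaps :: "real \<Rightarrow> (nat \<Rightarrow> real) measure" where
  "poisson_gaps r = (\<Pi>\<^sub>M n\<in>UNIV. density lborel (exponential_density r))"

definition clock_space ::
  "'v pair_pre_digraph \<Rightarrow> ('v \<Rightarrow> real) \<Rightarrow> ('v \<times> 'v \<Rightarrow> real) \<Rightarrow> ('v clock \<Rightarrow> nat \<Rightarrow> real) measure" where
  "clock_space G arr c = (\<Pi>\<^sub>M a\<in>clocks G arr. poisson_gaps (clock_rate arr c a))"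

definition epoch :: "('v clock \<Rightarrow> nat \<Rightarrow> real) \<Rightarrow> 'v clock \<times> nat \<Rightarrow> real" where
  "epoch \<omega> = (\<lambda>(a, n). \<Sum>i\<le>n. \<omega> a i)"

text \<open>The state at time t of the network started in x: the epochs in [0,t] act on x in
  chronological order. Almost surely there are only finitely many of them and no two coincide;
  on the remaining null set the value is irrelevant.\<close>

definition network_state :: "'v pair_pre_digraph \<Rightarrow> ('v \<Rightarrow> real) \<Rightarrow> 'v state \<Rightarrow> real
    \<Rightarrow> ('v clock \<Rightarrow> nat \<Rightarrow> real) \<Rightarrow> 'v state" where
  "network_state G arr x t \<omega> = fold (\<lambda>(a, n). transition G a)
     (sorted_key_list_of_set (epoch \<omega>) {(a, n). a \<in> clocks G arr \<and> epoch \<omega> (a, n) \<le> t}) x"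

inductive_set reachable :: "'v pair_pre_digraph \<Rightarrow> ('v \<Rightarrow> real) \<Rightarrow> 'v state set"
  for G arr where
  empty: "[] \<in> reachable G arr"
| step: "x \<in> reachable G arr \<Longrightarrow> a \<in> clocks G arr \<Longrightarrow> transition G a x \<in> reachable G arr"

text \<open>The first time at which the process is back in x after having left it (infinite if there
  is none).\<close>

definition return_time :: "'v pair_pre_digraph \<Rightarrow> ('v \<Rightarrow> real) \<Rightarrow> 'v state
    \<Rightarrow> ('v clock \<Rightarrow> nat \<Rightarrow> real) \<Rightarrow> ennreal" where
  "return_time G arr x \<omega> =
     (INF t \<in> {t. \<exists>s. 0 \<le> s \<and> s < t \<and> network_state G arr x s \<omega> \<noteq> x \<and> network_state G arr x t \<omega> = x}. ennreal t)"

text \<open>As usual in continuous time, an absorbing state counts as positive recurrent.\<close>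

definition positive_recurrent ::
  "'v pair_pre_digraph \<Rightarrow> ('v \<Rightarrow> real) \<Rightarrow> ('v \<times> 'v \<Rightarrow> real) \<Rightarrow> 'v state \<Rightarrow> bool" where
  "positive_recurrent G arr c x \<longleftrightarrow>
     (AE \<omega> in clock_space G arr c. \<forall>t\<ge>0. network_state G arr x t \<omega> = x) \<or>
     (\<integral>\<^sup>+ \<omega>. return_time G arr x \<omega> \<partial>clock_space G arr c) < \<infinity>"

definition stable_network ::
  "'v pair_pre_digraph \<Rightarrow> ('v \<Rightarrow> real) \<Rightarrow> ('v \<times> 'v \<Rightarrow> real) \<Rightarrow> bool" where
  "stable_network G arr c \<longleftrightarrow> (\<forall>x \<in> reachable G arr. positive_recurrent G arr c x)"

end

theory Submission
  imports Defs
begin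

text \<open>A packet can be useful on a link (u, v) only if its source reaches u without passing v. In a
  unique-path network the cut condition therefore bounds the total arrival rate of the sources whose
  packets use (u, v) by the capacity of (u, v).

  Older packets have priority, so the packets that have arrived up to some event are not delayed by
  later ones. Hence, as in a fluid model of longest-in-system scheduling, a link that is subcritical
  clears a backlog of age D in time r D with r < 1, and over the hops of a broadcast tree the largest
  age contracts. Starting from K packets, after O(K) events at most K / 2 packets are left on average,
  which is a Foster drift condition for the embedded jump chain. Conversely, if the cut condition
  fails for S, the number of packets confined to S dominates a walk with bounded steps and no negative
  drift, whose expected hitting time of 0 is infinite.

  The epochs of the clocks are reduced to the jump chain by the strong Markov property at the first
  epoch.\<close>

section \<open>Words of independent letters\<close>

text \<open>The fluid argument is run word by word: it is deterministic on every word whose letter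
  counts stay close to their means on all intervals. The remaining words may leave O(K) packets, so
  their probability has to be O(1/K) for their contribution to stay bounded. A union bound over the
  O(K) prefixes costs a factor of order K, which is why fourth moments are used.

  Ages have to be compared across departures, which renumber the packets. The words therefore act on
  lists from which nothing is removed, and complete packets are deleted only at the end; they are
  useful on no link, so this changes nothing.

  The drift only bounds the time to reach a finite set of states. Recurrence of each reachable state
  then needs paths through the empty state, and a flag added to the state keeps the initial stay
  from counting as a return. In the converse, equality in the cut condition gives a walk of mean 0,
  for which the expected hitting time is still infinite; it diverges like the harmonic
  series.\<close>

locale letters =
  fixes A :: "'a set" and p :: "'a \<Rightarrow> real"
  assumes finite_A: "finite A"
    and p_nonneg: "\<And>a. a \<in> A \<Longrightarrow> 0 \<le> p a"
    and p_sum: "(\<Sum>a\<in>A. p a) = 1"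
begin

text \<open>The expectation over words of \<open>n\<close> independent letters with law
  \<open>p\<close>, as a finite recursion, so that the jump chain can be studied without measure
  theory.\<close>

primrec mean :: "nat \<Rightarrow> ('a list \<Rightarrow> real) \<Rightarrow> real" where
  "mean 0 f = f []"
| "mean (Suc n) f = (\<Sum>a\<in>A. p a * mean n (\<lambda>w. f (a # w)))"

lemma mean_mono:
  "(\<And>w. set w \<subseteq> A \<Longrightarrow> length w = n \<Longrightarrow> f w \<le> g w) \<Longrightarrow> mean n f \<le> mean n g"
proof (induction n arbitrary: f g)
  case (Suc n)
  then show ?case
    by (auto intro!: sum_mono mult_left_mono p_nonneg)
qed simp

lemma mean_add: "mean n (\<lambda>w. f w + g w) = mean n f + mean n g"
  by (induction n arbitrary: f g) (simp_all add: distrib_left sum.distrib)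

lemma mean_cmult: "mean n (\<lambda>w. c * f w) = c * mean n f"
  by (induction n arbitrary: f) (simp_all add: sum_distrib_left mult.left_commute)

lemma mean_const: "mean n (\<lambda>w. c) = c"
  by (induction n) (simp_all add: p_sum flip: sum_distrib_right)

lemma mean_sum: "finite I \<Longrightarrow> mean n (\<lambda>w. \<Sum>i\<in>I. f i w) = (\<Sum>i\<in>I. mean n (f i))"
  by (induction I rule: finite_induct) (simp_all add: mean_const mean_add)

lemma mean_take: "n \<le> N \<Longrightarrow> mean N (\<lambda>w. f (take n w)) = mean n f"
proof (induction n arbitrary: f N)
  case 0
  then show ?case by (simp add: mean_const)
next
  case (Suc n)
  then obtain N' where "N = Suc N'" "n \<le> N'" by (metis Suc_le_D Suc_le_mono)
  then show ?case by (simp add: Suc.IH[OF \<open>n \<le> N'\<close>, of "\<lambda>w. f (_ # w)"])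
qed

lemma mean_nonneg: "(\<And>w. set w \<subseteq> A \<Longrightarrow> length w = n \<Longrightarrow> 0 \<le> f w) \<Longrightarrow> 0 \<le> mean n f"
  using mean_mono[of n "\<lambda>_. 0" f] by (simp add: mean_const)

lemma mean_point:
  assumes "set v \<subseteq> A" and "\<And>w. set w \<subseteq> A \<Longrightarrow> 0 \<le> f w"
  shows "prod_list (map p v) * f v \<le> mean (length v) f"
  using assms
proof (induction v arbitrary: f)
  case (Cons a v)
  have "p a * (prod_list (map p v) * f (a # v)) \<le> p a * mean (length v) (\<lambda>w. f (a # w))"
    using Cons by (intro mult_left_mono Cons.IH p_nonneg) auto
  also have "\<dots> \<le> (\<Sum>b\<in>A. p b * mean (length v) (\<lambda>w. f (b # w)))"
    using Cons.prems
    by (intro member_le_sum[of a A "\<lambda>b. p b * mean (length v) (\<lambda>w. f (b # w))"] mult_nonneg_nonneg p_nonneg mean_nonneg finite_A) auto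
  finally show ?case by (simp add: mult.assoc)
qed simp

definition dev :: "'a set \<Rightarrow> 'a list \<Rightarrow> real" where
  "dev L w = real (length (filter (\<lambda>a. a \<in> L) w)) - (\<Sum>a\<in>A \<inter> L. p a) * real (length w)"

lemma prob_le_1: "(\<Sum>a\<in>A \<inter> L. p a) \<le> 1" "0 \<le> (\<Sum>a\<in>A \<inter> L. p a)"
proof -
  have "(\<Sum>a\<in>A \<inter> L. p a) \<le> (\<Sum>a\<in>A. p a)"
    using p_nonneg finite_A by (intro sum_mono2) auto
  then show "(\<Sum>a\<in>A \<inter> L. p a) \<le> 1" by (simp add: p_sum)
  show "0 \<le> (\<Sum>a\<in>A \<inter> L. p a)"
    using p_nonneg by (intro sum_nonneg) auto
qed

text \<open>The one-letter deviation has mean 0 and absolute value at most 1, whence the recursion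
  for the fourth moment.\<close>

lemma dev_moments:
  "mean n (dev L) = 0" "mean n (\<lambda>w. dev L w ^ 2) \<le> real n" "mean n (\<lambda>w. dev L w ^ 4) \<le> 3 * real n ^ 2"
proof -
  define q where "q = (\<Sum>a\<in>A \<inter> L. p a)"
  define x where "x a = (if a \<in> L then 1 - q else - q)" for a
  have q: "0 \<le> q" "q \<le> 1" using prob_le_1[of L] by (auto simp: q_def)
  have dev_Cons: "dev L (a # w) = dev L w + x a" for a w
    by (auto simp: dev_def x_def q_def algebra_simps)
  have mean: "(\<Sum>a\<in>A. p a * x a) = 0"
  proof -
    have "(\<Sum>a\<in>A. p a * x a) = (\<Sum>a\<in>A. (if a \<in> L then p a else 0) - q * p a)"
      by (intro sum.cong) (auto simp: x_def algebra_simps)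
    also have "\<dots> = q - q * 1"
      unfolding sum_subtractf sum_distrib_left[symmetric] p_sum
      by (simp add: q_def sum.If_cases finite_A)
    finally show ?thesis by simp
  qed
  have x1: "\<bar>x a\<bar> \<le> 1" for a using q by (auto simp: x_def)
  have x2: "x a ^ 2 \<le> 1" for a using x1[of a] by (simp add: abs_square_le_1)
  have x4: "x a ^ 4 \<le> 1" for a
    using power_mono[OF x1[of a], of 4] by simp
  have m2: "(\<Sum>a\<in>A. p a * x a ^ 2) \<le> 1"
    using sum_mono[of A "\<lambda>a. p a * x a ^ 2" p] p_nonneg x2 by (simp add: p_sum mult_left_le)
  have m4: "(\<Sum>a\<in>A. p a * x a ^ 4) \<le> 1"
    using sum_mono[of A "\<lambda>a. p a * x a ^ 4" p] p_nonneg x4 by (simp add: p_sum mult_left_le)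
  have m2': "0 \<le> (\<Sum>a\<in>A. p a * x a ^ 2)"
    using p_nonneg by (intro sum_nonneg) auto
  show e1: "mean n (dev L) = 0" for n
  proof (induction n)
    case (Suc n)
    then show ?case
      by (simp add: dev_Cons mean_add mean_const distrib_left sum.distrib mean flip: sum_distrib_right)
  qed (simp add: dev_def)
  show e2: "mean n (\<lambda>w. dev L w ^ 2) \<le> real n" for n
  proof (induction n)
    case (Suc n)
    have "mean (Suc n) (\<lambda>w. dev L w ^ 2)
        = (\<Sum>a\<in>A. p a * mean n (\<lambda>w. dev L w ^ 2 + ((2 * x a) * dev L w + x a ^ 2)))"
      by (simp add: dev_Cons power2_sum algebra_simps)
    also have "\<dots> = (\<Sum>a\<in>A. p a * (mean n (\<lambda>w. dev L w ^ 2) + x a ^ 2))"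
      by (simp add: mean_add mean_cmult mean_const e1 power2_eq_square)
    also have "\<dots> = mean n (\<lambda>w. dev L w ^ 2) + (\<Sum>a\<in>A. p a * x a ^ 2)"
      by (simp add: distrib_left sum.distrib p_sum flip: sum_distrib_right)
    finally show ?case using Suc m2 by simp
  qed (simp add: dev_def)
  have expand4: "(u + v) ^ 4 = u ^ 4 + (4 * v * u ^ 3 + (6 * v\<^sup>2 * u\<^sup>2 + (4 * v ^ 3 * u + v ^ 4)))" for u v :: real
    by (simp add: power4_eq_xxxx power3_eq_cube power2_eq_square algebra_simps)
  show "mean n (\<lambda>w. dev L w ^ 4) \<le> 3 * real n ^ 2"
  proof (induction n)
    case (Suc n)
    have "mean (Suc n) (\<lambda>w. dev L w ^ 4)
        = (\<Sum>a\<in>A. p a * mean n (\<lambda>w. dev L w ^ 4 + ((4 * x a) * dev L w ^ 3 + ((6 * x a ^ 2) * dev L w ^ 2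
            + ((4 * x a ^ 3) * dev L w + x a ^ 4)))))"
      by (simp add: dev_Cons expand4)
    also have "\<dots> = (\<Sum>a\<in>A. p a * (mean n (\<lambda>w. dev L w ^ 4) + 4 * x a * mean n (\<lambda>w. dev L w ^ 3)
        + 6 * x a ^ 2 * mean n (\<lambda>w. dev L w ^ 2) + x a ^ 4))"
      by (simp only: mean_add mean_cmult mean_const e1) (simp add: algebra_simps)
    also have "\<dots> = mean n (\<lambda>w. dev L w ^ 4) * (\<Sum>a\<in>A. p a) + 4 * mean n (\<lambda>w. dev L w ^ 3) * (\<Sum>a\<in>A. p a * x a)
        + 6 * mean n (\<lambda>w. dev L w ^ 2) * (\<Sum>a\<in>A. p a * x a ^ 2) + (\<Sum>a\<in>A. p a * x a ^ 4)"
      unfolding sum_distrib_left sum.distrib[symmetric] by (intro sum.cong) (auto simp: algebra_simps)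
    \<comment> \<open>The third moment is multiplied by the mean of \<open>x\<close>, which is 0, so
      it needs no bound. What remains is \<open>3 * n^2 + 6 * n + 1\<close>, just below
      \<open>3 * (n + 1)^2\<close>.\<close>
    also have "\<dots> \<le> 3 * real n ^ 2 * 1 + 0 + 6 * real n * 1 + 1"
      using Suc m2 m4 e2[of n] m2'
      by (intro add_mono mult_mono) (auto simp: p_sum mean intro!: mean_nonneg)
    also have "\<dots> \<le> 3 * real (Suc n) ^ 2"
      by (simp add: power2_eq_square algebra_simps)
    finally show ?case .
  qed (simp add: dev_def)
qed

definition off_mean :: "'a set set \<Rightarrow> real \<Rightarrow> 'a list \<Rightarrow> bool" where
  "off_mean F d w \<longleftrightarrow> (\<exists>L\<in>F. \<exists>n\<le>length w. d < \<bar>dev L (take n w)\<bar>)"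

text \<open>Markov's inequality for fourth powers, with a union bound over \<open>F\<close> and over
  all prefixes. For \<open>d\<close> proportional to \<open>N\<close> the bound has order
  \<open>1 / N\<close>; second moments would only give order 1.\<close>

lemma mean_off_mean:
  assumes "finite F" and "0 < d"
  shows "mean N (\<lambda>w. of_bool (off_mean F d w)) \<le> real (card F) * (real N + 1) * (3 * real N ^ 2) / d ^ 4"
proof -
  have "mean N (\<lambda>w. of_bool (off_mean F d w)) \<le> mean N (\<lambda>w. \<Sum>L\<in>F. \<Sum>n\<le>N. (1 / d ^ 4) * dev L (take n w) ^ 4)"
  proof (rule mean_mono)
    fix w :: "'a list" assume w: "length w = N"
    show "of_bool (off_mean F d w) \<le> (\<Sum>L\<in>F. \<Sum>n\<le>N. (1 / d ^ 4) * dev L (take n w) ^ 4)"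
    proof (cases "off_mean F d w")
      case True
      then obtain L n where L: "L \<in> F" "n \<le> N" "d < \<bar>dev L (take n w)\<bar>"
        using w by (auto simp: off_mean_def)
      have "d ^ 4 \<le> \<bar>dev L (take n w)\<bar> ^ 4"
        using L assms by (intro power_mono) auto
      then have "1 \<le> (1 / d ^ 4) * dev L (take n w) ^ 4"
        using assms by (simp add: field_simps)
      also have "\<dots> \<le> (\<Sum>n\<le>N. (1 / d ^ 4) * dev L (take n w) ^ 4)"
        using L by (intro member_le_sum[of n "{..N}" "\<lambda>n. (1 / d ^ 4) * dev L (take n w) ^ 4"]) auto
      also have "\<dots> \<le> (\<Sum>L\<in>F. \<Sum>n\<le>N. (1 / d ^ 4) * dev L (take n w) ^ 4)"
        using L assms by (intro member_le_sum[of L F "\<lambda>L. \<Sum>n\<le>N. (1 / d ^ 4) * dev L (take n w) ^ 4"]) (auto intro!: sum_nonneg)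
      finally show ?thesis using True by simp
    qed (auto intro!: sum_nonneg)
  qed
  also have "\<dots> = (\<Sum>L\<in>F. \<Sum>n\<le>N. (1 / d ^ 4) * mean n (\<lambda>w. dev L w ^ 4))"
    unfolding mean_sum[OF assms(1)] mean_sum[OF finite_atMost] mean_cmult
    by (intro sum.cong refl) (simp add: mean_take[where f = "\<lambda>w. dev _ w ^ 4"])
  also have "\<dots> \<le> (\<Sum>L\<in>F. \<Sum>n\<le>N. (1 / d ^ 4) * (3 * real N ^ 2))"
    using assms by (intro sum_mono mult_left_mono order_trans[OF dev_moments(3)]) (auto intro!: power_mono)
  also have "\<dots> = real (card F) * (real N + 1) * (3 * real N ^ 2) / d ^ 4"
    by (simp add: algebra_simps)
  finally show ?thesis .
qed

end

section \<open>Truncated hitting times of a chain driven by independent letters\<close>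

locale letter_chain = letters A p for A :: "'a set" and p +
  fixes F :: "'a \<Rightarrow> 's \<Rightarrow> 's"
begin

text \<open>The expected number of steps until B is entered, cut off after n steps.\<close>

primrec hit :: "'s set \<Rightarrow> nat \<Rightarrow> 's \<Rightarrow> real" where
  "hit B 0 x = 0"
| "hit B (Suc n) x = (if x \<in> B then 0 else 1 + (\<Sum>a\<in>A. p a * hit B n (F a x)))"

lemma hit_nonneg: "0 \<le> hit B n x"
  by (induction n arbitrary: x) (auto intro!: add_nonneg_nonneg sum_nonneg mult_nonneg_nonneg p_nonneg)

lemma hit_in [simp]: "x \<in> B \<Longrightarrow> hit B n x = 0"
  by (cases n) auto

lemma hit_Suc_mono: "hit B n x \<le> hit B (Suc n) x"
proof (induction n arbitrary: x)
  case 0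
  show ?case using hit_nonneg[of B "Suc 0" x] by (simp only: hit.simps(1))
next
  case (Suc n)
  show ?case
    using Suc by (subst (1 2) hit.simps(2)) (auto intro!: sum_mono mult_left_mono p_nonneg simp del: hit.simps)
qed

lemma hit_mono: "m \<le> n \<Longrightarrow> hit B m x \<le> hit B n x"
  by (rule lift_Suc_mono_le[of "\<lambda>n. hit B n x", OF hit_Suc_mono])

text \<open>The Markov property over \<open>m\<close> steps. It is only an inequality because the
  right side ignores visits to \<open>B\<close> during these steps; for \<open>m > n\<close> the
  truncated subtraction leaves horizon 0.\<close>

lemma hit_le_Ex: "hit B n x \<le> real m + mean m (\<lambda>w. hit B (n - m) (fold F w x))"
proof (induction m arbitrary: n x)
  case (Suc m)
  show ?case
  proof (cases n)
    case 0
    then show ?thesis by (simp add: mean_const)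
  next
    case (Suc n')
    have "hit B n x \<le> 1 + (\<Sum>a\<in>A. p a * hit B n' (F a x))"
      using Suc hit_nonneg by (auto intro!: add_nonneg_nonneg sum_nonneg mult_nonneg_nonneg p_nonneg)
    also have "\<dots> \<le> 1 + (\<Sum>a\<in>A. p a * (real m + mean m (\<lambda>w. hit B (n' - m) (fold F w (F a x)))))"
      by (intro add_left_mono sum_mono mult_left_mono Suc.IH p_nonneg)
    also have "\<dots> = real (Suc m) + mean (Suc m) (\<lambda>w. hit B (n - Suc m) (fold F w x))"
      using Suc by (simp add: distrib_left sum.distrib p_sum flip: sum_distrib_right)
    finally show ?thesis .
  qed
qed simp

text \<open>Markov property at the entrance into \<open>B\<close>: the time to \<open>Z\<close> is
  at most the time to \<open>B\<close> plus \<open>U\<close>. The bound \<open>U\<close> may depend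
  on the horizon \<open>n\<close>, so the lemma applies before any uniform bound is known.\<close>

lemma hit_through:
  assumes "\<And>y. y \<in> B \<Longrightarrow> y \<in> R \<Longrightarrow> hit Z n y \<le> U"
    and "0 \<le> U" and "x \<in> R" and closed: "\<And>a y. a \<in> A \<Longrightarrow> y \<in> R \<Longrightarrow> F a y \<in> R"
  shows "hit Z n x \<le> hit B n x + U"
  using assms(1,3)
proof (induction n arbitrary: x)
  case 0
  then show ?case using \<open>0 \<le> U\<close> by simp
next
  case (Suc n)
  show ?case
  proof (cases "x \<in> Z \<or> x \<in> B")
    case True
    then show ?thesis
      using Suc.prems \<open>0 \<le> U\<close> hit_nonneg[of B "Suc n" x] by (auto simp del: hit.simps)
  next
    case False
    have IH: "hit Z n (F a x) \<le> hit B n (F a x) + U" if "a \<in> A" for a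
    proof (rule Suc.IH)
      fix y assume "y \<in> B" "y \<in> R"
      then show "hit Z n y \<le> U" using Suc.prems(1)[of y] hit_Suc_mono[of Z n y] by (simp del: hit.simps)
    qed (use closed Suc.prems that in auto)
    have "hit Z (Suc n) x \<le> 1 + (\<Sum>a\<in>A. p a * (hit B n (F a x) + U))"
      using False IH by (auto intro!: sum_mono mult_left_mono p_nonneg)
    also have "\<dots> = hit B (Suc n) x + U"
      using False by (simp add: distrib_left sum.distrib p_sum flip: sum_distrib_right)
    finally show ?thesis .
  qed
qed

lemma fold_closed:
  assumes closed: "\<And>a y. a \<in> A \<Longrightarrow> y \<in> R \<Longrightarrow> F a y \<in> R" and "set w \<subseteq> A" "x \<in> R"
  shows "fold F w x \<in> R"
  using assms(2,3) by (induction w arbitrary: x) (auto simp: closed)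

text \<open>Foster's criterion with a horizon that depends on the state: \<open>V\<close> halves on
  average within \<open>C * V\<close> steps, so the expected durations form a geometric series with
  sum \<open>2 * C * V\<close>.\<close>

lemma hit_drift:
  fixes V :: "'s \<Rightarrow> real" and N :: "'s \<Rightarrow> nat"
  assumes closed: "\<And>a y. a \<in> A \<Longrightarrow> y \<in> R \<Longrightarrow> F a y \<in> R"
    and V: "\<And>y. y \<in> R \<Longrightarrow> 0 \<le> V y"
    and N: "\<And>y. y \<in> R \<Longrightarrow> y \<notin> B \<Longrightarrow> 0 < N y \<and> real (N y) \<le> C * V y"
    and drift: "\<And>y. y \<in> R \<Longrightarrow> y \<notin> B \<Longrightarrow> mean (N y) (\<lambda>w. V (fold F w y)) \<le> V y / 2"
    and "0 \<le> C" and "x \<in> R"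
  shows "hit B n x \<le> 2 * C * V x"
  using \<open>x \<in> R\<close>
proof (induction n arbitrary: x rule: less_induct)
  case (less n)
  show ?case
  proof (cases "x \<in> B \<or> n = 0")
    case True
    then show ?thesis using V[OF less.prems] \<open>0 \<le> C\<close> by auto
  next
    case False
    have "hit B n x \<le> real (N x) + mean (N x) (\<lambda>w. hit B (n - N x) (fold F w x))"
      by (rule hit_le_Ex)
    also have "\<dots> \<le> C * V x + mean (N x) (\<lambda>w. 2 * C * V (fold F w x))"
      using less False N[of x] by (intro add_mono mean_mono less.IH fold_closed[OF closed]) auto
    also have "\<dots> \<le> C * V x + 2 * C * (V x / 2)"
      unfolding mean_cmult using drift[of x] less.prems False \<open>0 \<le> C\<close> by (intro add_mono mult_left_mono) auto
    finally show ?thesis by simp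
  qed
qed

text \<open>Let \<open>U n\<close> be the worst truncated time to \<open>Z\<close> from the finite
  set. From the state attaining it, the fixed word \<open>\<pi> y\<close> leads into
  \<open>Z\<close> with probability at least \<open>\<delta> y\<close>, and any other word costs at
  most a return to \<open>B\<close> plus \<open>U n\<close>. Hence
  \<open>U n \<le> b' y + (1 - \<delta> y) * U n\<close>, which can be solved for \<open>U n\<close>
  because truncation keeps it finite.\<close>

lemma hit_finite_bound:
  assumes closed: "\<And>a y. a \<in> A \<Longrightarrow> y \<in> R \<Longrightarrow> F a y \<in> R"
    and fin: "finite (B \<inter> R)"
    and p_pos: "\<And>a. a \<in> A \<Longrightarrow> 0 < p a"
    and B: "\<And>y. y \<in> R \<Longrightarrow> \<exists>b. \<forall>n. hit B n y \<le> b"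
    and path: "\<And>y. y \<in> B \<Longrightarrow> y \<in> R \<Longrightarrow> \<exists>w. set w \<subseteq> A \<and> fold F w y \<in> Z"
    and "x \<in> R"
  shows "\<exists>b. \<forall>n. hit Z n x \<le> b"
proof -
  obtain b where b: "\<And>y n. y \<in> R \<Longrightarrow> hit B n y \<le> b y"
    using B by metis
  obtain \<pi> where \<pi>: "\<And>y. y \<in> B \<Longrightarrow> y \<in> R \<Longrightarrow> set (\<pi> y) \<subseteq> A \<and> fold F (\<pi> y) y \<in> Z"
    using path by metis
  define \<delta> where "\<delta> y = prod_list (map p (\<pi> y))" for y
  define b' where "b' y = real (length (\<pi> y)) + mean (length (\<pi> y)) (\<lambda>w. b (fold F w y))" for y
  have pos: "0 < prod_list (map p w)" if "set w \<subseteq> A" for w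
    using that by (induction w) (auto simp: p_pos)
  have \<delta>: "0 < \<delta> y" if "y \<in> B \<inter> R" for y
    using pos \<pi> that by (simp add: \<delta>_def)
  define U where "U n = Max (insert 0 ((\<lambda>y. hit Z n y) ` (B \<inter> R)))" for n
  have U0: "0 \<le> U n" for n
    using fin by (simp add: U_def)
  have U: "hit Z n y \<le> U n" if "y \<in> B" "y \<in> R" for n y
    using fin that by (auto simp: U_def intro!: Max_ge)
  have thr: "hit Z n y \<le> b y + U n" if "y \<in> R" for n y
    using hit_through[where B = B and R = R and Z = Z and n = n and U = "U n" and x = y, OF U U0 that closed] b[OF that, of n] by simp
  have step: "\<delta> y * U n \<le> b' y" if "y \<in> B \<inter> R" "U n = hit Z n y" for y n
  proof -
    have y: "y \<in> R" and w: "set (\<pi> y) \<subseteq> A" "fold F (\<pi> y) y \<in> Z"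
      using \<pi> that by auto
    let ?l = "length (\<pi> y)"
    have "hit Z n y \<le> real ?l + mean ?l (\<lambda>w. hit Z (n - ?l) (fold F w y))"
      by (rule hit_le_Ex)
    also have "\<dots> \<le> real ?l + mean ?l (\<lambda>w. b (fold F w y) + U n + (- U n) * of_bool (w = \<pi> y))"
    proof (intro add_left_mono mean_mono)
      fix w assume v: "set w \<subseteq> A" "length w = ?l"
      have R: "fold F w y \<in> R" using fold_closed[OF closed v(1) y] .
      have "hit Z (n - ?l) (fold F w y) \<le> hit Z n (fold F w y)"
        by (intro hit_mono) simp
      then have "hit Z (n - ?l) (fold F w y) \<le> b (fold F w y) + U n" using thr[OF R, of n] by simp
      moreover have "0 \<le> b (fold F w y)" using b[OF R, of 0] by simp
      ultimately show "hit Z (n - ?l) (fold F w y) \<le> b (fold F w y) + U n + (- U n) * of_bool (w = \<pi> y)"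
        using w by (cases "w = \<pi> y") auto
    qed
    also have "\<dots> = b' y + U n - U n * mean ?l (\<lambda>w. of_bool (w = \<pi> y))"
      unfolding mean_add mean_cmult mean_const b'_def by simp
    also have "\<dots> \<le> b' y + U n - U n * \<delta> y"
      using mean_point[of "\<pi> y" "\<lambda>w. of_bool (w = \<pi> y)"] w U0
      by (intro diff_left_mono mult_left_mono) (auto simp: \<delta>_def)
    finally show ?thesis using that by (simp add: mult.commute)
  qed
  define c where "c = (\<Sum>y\<in>B \<inter> R. \<bar>b' y\<bar> / \<delta> y)"
  have "U n \<le> c" for n
  proof -
    have "U n \<in> insert 0 ((\<lambda>y. hit Z n y) ` (B \<inter> R))"
      unfolding U_def using fin by (intro Max_in) auto
    then consider "U n = 0" | y where "y \<in> B \<inter> R" "U n = hit Z n y" by auto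
    then show ?thesis
    proof cases
      case 1
      then show ?thesis using \<delta> by (auto simp: c_def less_imp_le intro!: sum_nonneg divide_nonneg_nonneg)
    next
      case 2
      have "U n \<le> \<bar>b' y\<bar> / \<delta> y"
        using step[OF 2] \<delta>[OF 2(1)] by (simp add: field_simps)
      also have "\<dots> \<le> c"
        unfolding c_def using 2 fin \<delta> by (intro member_le_sum) (auto simp: less_imp_le)
      finally show ?thesis .
    qed
  qed
  then have "hit Z n x \<le> b x + c" for n
    using thr[OF \<open>x \<in> R\<close>, of n] by (meson add_left_mono order_trans)
  then show ?thesis by blast
qed

end

section \<open>Integer walks with bounded steps and no negative drift\<close>

locale biased_walk = letter_chain A p "\<lambda>a d. d + (g a :: int)" for A :: "'a set" and p and g +
  assumes bounded: "\<And>a. a \<in> A \<Longrightarrow> \<bar>g a\<bar> \<le> 1"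
    and drift: "0 \<le> (\<Sum>a\<in>A. p a * real_of_int (g a))"
begin

text \<open>By optional stopping, the stopped walk after \<open>m\<close> steps has mean at least
  \<open>d\<close> and never exceeds \<open>d + m\<close>, so it is still positive with probability
  at least \<open>d / (d + m)\<close>. The sum over \<open>m\<close> bounds the expected hitting
  time from below.\<close>

lemma hit_ge: "0 \<le> d \<Longrightarrow> (\<Sum>m<n. real_of_int d / (real_of_int d + real m)) \<le> hit {..0} n d"
proof (induction n arbitrary: d)
  case (Suc n)
  show ?case
  proof (cases "d = 0")
    case False
    then have d: "1 \<le> d" using Suc.prems by simp
    \<comment> \<open>Since \<open>g a \<le> 1\<close>, the denominator may be raised to
      \<open>d + m + 1\<close>, the same for all letters. The bound is then linear in
      \<open>g a\<close>, so that averaging only needs the mean step.\<close>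
    have *: "(\<Sum>m<n. (real_of_int d + g a) / (real_of_int d + real m + 1)) \<le> hit {..0} n (d + g a)" if "a \<in> A" for a
    proof -
      have le: "0 \<le> d + g a" "g a \<le> 1" using bounded[OF that] d by auto
      have "(\<Sum>m<n. (real_of_int d + g a) / (real_of_int d + real m + 1))
          \<le> (\<Sum>m<n. real_of_int (d + g a) / (real_of_int (d + g a) + real m))"
      proof (intro sum_mono)
        fix m
        show "(real_of_int d + g a) / (real_of_int d + real m + 1) \<le> real_of_int (d + g a) / (real_of_int (d + g a) + real m)"
          using le by (cases "d + g a = 0") (auto simp flip: of_int_add intro!: divide_left_mono mult_pos_pos)
      qed
      also have "\<dots> \<le> hit {..0} n (d + g a)" by (rule Suc.IH[OF le(1)])
      finally show ?thesis .
    qed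
    have "(\<Sum>m<Suc n. real_of_int d / (real_of_int d + real m)) = 1 + (\<Sum>m<n. real_of_int d / (real_of_int d + real m + 1))"
      using d by (subst sum.lessThan_Suc_shift) (simp add: algebra_simps)
    also have "\<dots> \<le> 1 + (\<Sum>m<n. (real_of_int d + (\<Sum>a\<in>A. p a * real_of_int (g a))) / (real_of_int d + real m + 1))"
      using drift d by (intro add_left_mono sum_mono divide_right_mono) auto
    also have "(\<Sum>m<n. (real_of_int d + (\<Sum>a\<in>A. p a * real_of_int (g a))) / (real_of_int d + real m + 1))
        = (\<Sum>m<n. \<Sum>a\<in>A. p a * ((real_of_int d + g a) / (real_of_int d + real m + 1)))"
    proof (intro sum.cong refl)
      fix m
      have "real_of_int d + (\<Sum>a\<in>A. p a * real_of_int (g a)) = (\<Sum>a\<in>A. p a * (real_of_int d + g a))"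
        by (simp add: distrib_left sum.distrib p_sum flip: sum_distrib_right)
      then show "(real_of_int d + (\<Sum>a\<in>A. p a * real_of_int (g a))) / (real_of_int d + real m + 1)
          = (\<Sum>a\<in>A. p a * ((real_of_int d + g a) / (real_of_int d + real m + 1)))"
        by (simp add: sum_divide_distrib)
    qed
    also have "\<dots> = (\<Sum>a\<in>A. p a * (\<Sum>m<n. (real_of_int d + g a) / (real_of_int d + real m + 1)))"
      by (subst sum.swap) (simp add: sum_distrib_left)
    also have "\<dots> \<le> (\<Sum>a\<in>A. p a * hit {..0} n (d + g a))"
      by (intro sum_mono mult_left_mono * p_nonneg)
    finally show ?thesis using d by simp
  qed simp
qed simp

text \<open>For a start in 1 the lower bound is a partial sum of the harmonic series.\<close>

lemma hit_unbounded: "\<exists>n. b < hit {..0} n 1"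
proof -
  obtain n where "b < (\<Sum>m<n. inverse (real (Suc m)))"
  proof -
    have "\<not> summable (\<lambda>m. inverse (real (Suc m)))"
      using not_summable_harmonic[where 'a = real] by (subst summable_Suc_iff[of "\<lambda>n. inverse (real n)"]) simp
    then show ?thesis
      using that bounded_imp_summable[where a = "\<lambda>m. inverse (real (Suc m))" and B = b]
      by (metis (no_types, lifting) inverse_nonnegative_iff_nonnegative lessThan_Suc_atMost not_le of_nat_0_le_iff)
  qed
  also have "\<dots> = (\<Sum>m<n. real_of_int 1 / (real_of_int 1 + real m))"
    by (simp add: field_simps)
  also have "\<dots> \<le> hit {..0} n 1" by (rule hit_ge) simp
  finally show ?thesis by blast
qed

end

section \<open>Link loads\<close>

text \<open>These are the sources whose packets may use \<open>e\<close>: \<open>s\<close> differs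
  from the head and no arc of the restricted relation enters the head, so the whole path to the tail
  avoids it.\<close>

definition feeders :: "'v rel \<Rightarrow> 'v \<times> 'v \<Rightarrow> 'v set" where
  "feeders R e = {s. s \<noteq> snd e \<and> (s, fst e) \<in> {(a, b) \<in> R. b \<noteq> snd e}\<^sup>*}"

lemma (in pair_wf_digraph) end_in_awalk_verts: "awalk u q v \<Longrightarrow> v \<in> set (pawalk_verts u q)"
  by (induction q arbitrary: u) (auto simp: awalk_Cons_iff awalk_Nil_iff)

text \<open>Loop removal that stays inside \<open>W\<close>: if the new first node already lies on
  the simple path, the part of the path from there on is taken. Later \<open>W\<close> is the
  complement of the head of a link or of its feeders.\<close>

lemma (in pair_wf_digraph) rtrancl_apath:
  assumes "(x, y) \<in> Q\<^sup>*" and "Q \<subseteq> parcs G \<inter> W \<times> W" and "x \<in> W \<inter> pverts G"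
  shows "\<exists>q. apath x q y \<and> set (pawalk_verts x q) \<subseteq> W"
  using assms
proof (induction rule: converse_rtrancl_induct)
  case base
  then show ?case
    by (intro exI[of _ "[]"]) (auto simp: apath_Nil_iff)
next
  case (step x z)
  then have z: "z \<in> W \<inter> pverts G" and e: "(x, z) \<in> parcs G" using in_arcsD2 by blast+
  then obtain q where q: "apath z q y" "set (pawalk_verts z q) \<subseteq> W" using step by blast
  show ?case
  proof (cases "x \<in> set (pawalk_verts z q)")
    case False
    then have "apath x ((x, z) # q) y" using q(1) e by (simp add: apath_Cons_iff)
    then show ?thesis using q(2) step.prems by (intro exI[of _ "(x, z) # q"]) auto
  next
    case True
    then obtain q1 q2 where q12: "q = q1 @ q2" "awalk z q1 x"
      using q(1) awalk_decomp[OF awalkI_apath] by blast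
    then have l: "last (pawalk_verts z q1) = x" by auto
    have "apath x q2 y" using iffD1[OF apath_append_iff, OF q(1)[unfolded q12(1)]] by (simp only: l)
    moreover have "set (pawalk_verts x q2) \<subseteq> set (pawalk_verts z q)"
      using awalk_verts_append2[of z q1 q2 y] awalkI_apath[OF q(1)] l q12 by auto
    ultimately show ?thesis using q(2) by blast
  qed
qed

lemma feeders_subset:
  assumes "pair_fin_digraph G" "e \<in> parcs G"
  shows "feeders (parcs G) e \<subseteq> pverts G"
proof
  interpret pair_fin_digraph G by fact
  fix s assume "s \<in> feeders (parcs G) e"
  then have "(s, fst e) \<in> {(a, b) \<in> parcs G. b \<noteq> snd e}\<^sup>*" by (simp add: feeders_def)
  then show "s \<in> pverts G"
    by (cases rule: converse_rtranclE) (use assms arc_fst_in_verts in_arcsD1 in auto)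
qed

lemma feeders_edge:
  assumes "(w, z) \<in> R" "z \<in> feeders R e" "w \<noteq> snd e"
  shows "w \<in> feeders R e"
  using assms by (auto simp: feeders_def intro: converse_rtrancl_into_rtrancl)

text \<open>Adding to the feeders of a link all nodes that cannot reach its head gives a set that is
  left only through that link, since any other exit would give a second path to the head.\<close>

lemma link_load:
  fixes G :: "'v pair_pre_digraph"
  assumes G: "pair_fin_digraph G" and up: "unique_path G" and e: "e \<in> parcs G"
    and c: "\<And>e. e \<in> parcs G \<Longrightarrow> c e > 0"
    and arr: "\<And>u. u \<in> pverts G \<Longrightarrow> arr u \<ge> 0"
    and cut: "\<And>S. S \<subset> pverts G \<Longrightarrow> (\<Sum>u\<in>S. arr u) > 0 \<Longrightarrow>
       (\<Sum>u\<in>S. arr u) < (\<Sum>(u, v) | (u, v) \<in> parcs G \<and> u \<in> S \<and> v \<notin> S. c (u, v))"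
  shows "(\<Sum>s\<in>feeders (parcs G) e. arr s) < (c e :: real)"
proof -
  interpret pair_fin_digraph G by fact
  let ?R = "parcs G"
  obtain u v where uv: "e = (u, v)" by (cases e)
  have uvV: "u \<in> pverts G" "v \<in> pverts G" using e uv in_arcsD1 in_arcsD2 by auto
  let ?F = "feeders ?R e"
  define S where "S = ?F \<union> {z \<in> pverts G. (z, v) \<notin> ?R\<^sup>*}"
  have FV: "?F \<subseteq> pverts G" by (rule feeders_subset[OF G e])
  have vF: "v \<notin> ?F" by (simp add: feeders_def uv)
  have S: "S \<subset> pverts G" using FV vF uvV unfolding S_def by auto
  have fin: "finite S" using S by (meson finite_subset psubset_imp_subset pair_finite_verts)
  \<comment> \<open>Two simple paths lead from \<open>w\<close> to \<open>v\<close>: one reaches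
    \<open>u\<close> without meeting \<open>v\<close> and then uses \<open>e\<close>; the other
    begins with \<open>(w, z)\<close> and meets no feeder afterwards. They coincide. As
    \<open>u\<close> is a feeder, it cannot occur after the first arc, so this arc is
    \<open>e\<close> itself.\<close>
  have exit_edge: "(w, z) = (u, v)" if wz: "(w, z) \<in> ?R" "w \<in> S" "z \<notin> S" for w z
  proof -
    have zV: "z \<in> pverts G" and wV: "w \<in> pverts G" using wz in_arcsD1 in_arcsD2 by auto
    have zF: "z \<notin> ?F" and zv: "(z, v) \<in> ?R\<^sup>*" using wz zV by (auto simp: S_def)
    then have "(w, v) \<in> ?R\<^sup>*" using wz by (meson converse_rtrancl_into_rtrancl)
    then have wF: "w \<in> ?F" using wz by (auto simp: S_def)
    then have wv: "w \<noteq> v" using vF by auto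
    have "(w, u) \<in> {(a, b) \<in> ?R. b \<noteq> v}\<^sup>*" using wF by (simp add: feeders_def uv)
    then have "(w, u) \<in> (?R \<inter> (- {v}) \<times> (- {v}))\<^sup>* "
      using wv
    proof (induction rule: converse_rtrancl_induct)
      case (step a b)
      then have "(a, b) \<in> ?R \<inter> (- {v}) \<times> (- {v})" by auto
      then show ?case using step by (auto intro: converse_rtrancl_into_rtrancl)
    qed simp
    then obtain q where q: "apath w q u" "v \<notin> set (pawalk_verts w q)"
      using rtrancl_apath[of w u "?R \<inter> (- {v}) \<times> (- {v})" "- {v}"] wV wv by blast
    have uF: "u \<in> ?F"
    proof -
      have "u \<in> set (pawalk_verts w q)"
        by (rule end_in_awalk_verts[OF awalkI_apath[OF q(1)]])
      then show ?thesis using q(2) by (auto simp: feeders_def uv)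
    qed
    have qe: "apath w (q @ [e]) v"
    proof -
      have l: "last (pawalk_verts w q) = u" using q(1) by (auto dest: awalkI_apath)
      have "u \<in> set (pawalk_verts w q)"
        by (rule end_in_awalk_verts[OF awalkI_apath[OF q(1)]])
      then have "u \<noteq> v" using q(2) by auto
      then have "apath u [e] v" "tl (pawalk_verts u [e]) = [v]"
        using e uvV by (simp_all add: uv apath_Cons_iff apath_Nil_iff)
      then show ?thesis
        using q(1,2) by (subst apath_append_iff) (simp only: l, simp)
    qed
    \<comment> \<open>By \<open>feeders_edge\<close>, an arc from a non-feeder other than
      \<open>v\<close> never enters the feeders, so avoiding them is inherited along the
      path.\<close>
    have "(z, v) \<in> (?R \<inter> (- ?F) \<times> (- ?F))\<^sup>*"
      using zv zF
    proof (induction rule: converse_rtrancl_induct)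
      case (step a b)
      show ?case
      proof (cases "a = v")
        case False
        then have "b \<notin> ?F" using step feeders_edge[of a b ?R e] by (auto simp: uv)
        then have "(a, b) \<in> ?R \<inter> (- ?F) \<times> (- ?F)" using step by auto
        then show ?thesis using step \<open>b \<notin> ?F\<close> by (meson converse_rtrancl_into_rtrancl)
      qed simp
    qed simp
    then obtain q' where q': "apath z q' v" "set (pawalk_verts z q') \<subseteq> - ?F"
      using rtrancl_apath[of z v "?R \<inter> (- ?F) \<times> (- ?F)" "- ?F"] zV zF by blast
    have "apath w ((w, z) # q') v"
      using q' wF wz by (auto simp: apath_Cons_iff)
    then have eq: "q @ [e] = (w, z) # q'"
      using up qe wv unfolding unique_path_def by blast
    show ?thesis
    proof (cases q)
      case Nil
      then show ?thesis using eq uv by simp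
    next
      case (Cons a q'')
      then have "q' = q'' @ [e]" using eq by simp
      then have "u \<in> set (pawalk_verts z q')"
        using set_awalk_verts[OF awalkI_apath[OF q'(1)]] uv by auto
      moreover have "u \<in> ?F" using uF .
      ultimately show ?thesis using q' by auto
    qed
  qed
  have "(\<Sum>(w, z) | (w, z) \<in> ?R \<and> w \<in> S \<and> z \<notin> S. c (w, z)) \<le> (\<Sum>(w, z)\<in>{(u, v)}. c (w, z))"
    using exit_edge c e uv by (intro sum_mono2) (auto simp: less_imp_le)
  then have le: "(\<Sum>(w, z) | (w, z) \<in> ?R \<and> w \<in> S \<and> z \<notin> S. c (w, z)) \<le> c e" by (simp add: uv)
  have "(\<Sum>s\<in>?F. arr s) \<le> (\<Sum>s\<in>S. arr s)"
    using fin S arr by (intro sum_mono2) (auto simp: S_def)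
  \<comment> \<open>If nothing arrives in \<open>S\<close>, the cut condition is silent and
    positivity of \<open>c e\<close> takes its place.\<close>
  then show ?thesis
    using cut[OF S] le c[OF e] by linarith
qed

text \<open>No link leaves the set of nodes reachable from \<open>u\<close>. If \<open>v\<close>
  were missing from it, it would be a cut of capacity 0 with positive arrival rate.\<close>

lemma sources_reach:
  assumes G: "pair_fin_digraph G"
    and arr: "\<And>u. u \<in> pverts G \<Longrightarrow> arr u \<ge> (0::real)"
    and cut: "\<And>S. S \<subset> pverts G \<Longrightarrow> (\<Sum>u\<in>S. arr u) > 0 \<Longrightarrow>
       (\<Sum>u\<in>S. arr u) < (\<Sum>(u, v) | (u, v) \<in> parcs G \<and> u \<in> S \<and> v \<notin> S. c (u, v))"
    and u: "u \<in> pverts G" "arr u > 0" and v: "v \<in> pverts G"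
  shows "(u, v) \<in> (parcs G)\<^sup>*"
proof (rule ccontr)
  interpret pair_fin_digraph G by fact
  define S where "S = {z \<in> pverts G. (u, z) \<in> (parcs G)\<^sup>*}"
  assume "(u, v) \<notin> (parcs G)\<^sup>*"
  then have S: "S \<subset> pverts G" using v by (auto simp: S_def)
  have "arr u \<le> (\<Sum>s\<in>S. arr s)"
    using u arr by (intro member_le_sum) (auto simp: S_def)
  then have "(\<Sum>s\<in>S. arr s) < (\<Sum>(a, b) | (a, b) \<in> parcs G \<and> a \<in> S \<and> b \<notin> S. c (a, b))"
    using cut[OF S] u by simp
  moreover have "{(a, b). (a, b) \<in> parcs G \<and> a \<in> S \<and> b \<notin> S} = {}"
    using in_arcsD2 by (auto simp: S_def)
  ultimately show False using \<open>arr u \<le> _\<close> u by simp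
qed

section \<open>Priority of older packets\<close>

definition useful :: "'v \<times> 'v \<Rightarrow> 'v \<times> 'v set \<Rightarrow> bool" where
  "useful e p \<longleftrightarrow> fst e \<in> snd p \<and> snd e \<notin> snd p"

text \<open>Future demand on \<open>e\<close>, counted even while the packet is still on its way to
  the tail. Unlike usefulness it can only be lost under service, never gained.\<close>

definition needs :: "'v rel \<Rightarrow> 'v \<times> 'v \<Rightarrow> 'v \<times> 'v set \<Rightarrow> bool" where
  "needs R e p \<longleftrightarrow> fst p \<in> feeders R e \<and> snd e \<notin> snd p"

definition wf_packet :: "'v pair_pre_digraph \<Rightarrow> 'v \<times> 'v set \<Rightarrow> bool" where
  "wf_packet G p \<longleftrightarrow> fst p \<in> snd p \<and> snd p \<subseteq> pverts G \<and>
     (\<forall>y\<in>snd p. (fst p, y) \<in> (parcs G \<inter> snd p \<times> snd p)\<^sup>*)"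

text \<open>The copies have spread from the source along links between holders. The head is not a
  holder, so the path to the tail avoids it.\<close>

lemma useful_needs:
  assumes "wf_packet G p" "useful e p"
  shows "needs (parcs G) e p"
proof -
  have "(fst p, fst e) \<in> (parcs G \<inter> snd p \<times> snd p)\<^sup>*"
    using assms by (auto simp: wf_packet_def useful_def)
  moreover have "(parcs G \<inter> snd p \<times> snd p)\<^sup>* \<subseteq> {(a, b) \<in> parcs G. b \<noteq> snd e}\<^sup>*"
    using assms by (intro rtrancl_mono) (auto simp: useful_def)
  ultimately show ?thesis
    using assms by (auto simp: needs_def feeders_def useful_def wf_packet_def)
qed

lemma send_Cons: "send_oldest_useful e (p # ps) =
   (if useful e p then (fst p, insert (snd e) (snd p)) # ps else p # send_oldest_useful e ps)"
  by (simp add: useful_def)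

declare send_oldest_useful.simps(2) [simp del]
declare send_Cons [simp]

lemma length_send [simp]: "length (send_oldest_useful e xs) = length xs"
  by (induction xs) auto

lemma map_fst_send [simp]: "map fst (send_oldest_useful e xs) = map fst xs"
  by (induction xs) auto

lemma snd_send_mono: "i < length xs \<Longrightarrow> snd (xs ! i) \<subseteq> snd (send_oldest_useful e xs ! i)"
  by (induction xs arbitrary: i) (auto simp: nth_Cons split: nat.splits)

lemma take_send: "take j (send_oldest_useful e xs) = send_oldest_useful e (take j xs)"
  by (induction xs arbitrary: j) (auto simp: take_Cons split: nat.splits)

lemma wf_packet_insert:
  assumes "wf_packet G p" "useful e p" "e \<in> parcs G" "pair_fin_digraph G"
  shows "wf_packet G (fst p, insert (snd e) (snd p))"
proof -
  interpret pair_fin_digraph G by fact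
  let ?X = "insert (snd e) (snd p)"
  have sub: "(parcs G \<inter> snd p \<times> snd p)\<^sup>* \<subseteq> (parcs G \<inter> ?X \<times> ?X)\<^sup>*"
    by (intro rtrancl_mono) auto
  have old: "(fst p, y) \<in> (parcs G \<inter> ?X \<times> ?X)\<^sup>*" if "y \<in> snd p" for y
    by (rule subsetD[OF sub]) (use assms that in \<open>simp add: wf_packet_def\<close>)
  then have "(fst p, fst e) \<in> (parcs G \<inter> ?X \<times> ?X)\<^sup>*"
    using assms by (simp add: useful_def)
  moreover have "(fst e, snd e) \<in> parcs G \<inter> ?X \<times> ?X"
    using assms by (cases e) (auto simp: useful_def)
  ultimately have new: "(fst p, snd e) \<in> (parcs G \<inter> ?X \<times> ?X)\<^sup>*"
    by (rule rtrancl_into_rtrancl)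
  have "fst p \<in> ?X" "?X \<subseteq> pverts G"
    using assms arc_snd_in_verts by (auto simp: wf_packet_def)
  then show ?thesis
    unfolding wf_packet_def fst_conv snd_conv using old new by blast
qed

lemma wf_send:
  assumes "pair_fin_digraph G" "e \<in> parcs G" "\<forall>p\<in>set xs. wf_packet G p"
  shows "\<forall>p\<in>set (send_oldest_useful e xs). wf_packet G p"
  using assms by (induction xs) (auto simp: wf_packet_insert)

definition backlog :: "'v rel \<Rightarrow> 'v \<times> 'v \<Rightarrow> 'v state \<Rightarrow> nat" where
  "backlog R e xs = length (filter (needs R e) xs)"

lemma backlog_send_le: "backlog R e' (send_oldest_useful e xs) \<le> backlog R e' xs"
  by (induction xs) (auto simp: backlog_def needs_def)

text \<open>Work conservation: if anything is useful, something is sent, and whichever packet is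
  chosen was counted in the backlog.\<close>

lemma backlog_send_less:
  assumes "\<forall>p\<in>set xs. wf_packet G p" "\<exists>p\<in>set xs. useful e p"
  shows "Suc (backlog (parcs G) e (send_oldest_useful e xs)) \<le> backlog (parcs G) e xs"
  using assms
proof (induction xs)
  case (Cons p xs)
  show ?case
  proof (cases "useful e p")
    case True
    then have "needs (parcs G) e p" using Cons.prems by (auto intro: useful_needs)
    then show ?thesis using True by (simp add: backlog_def needs_def)
  next
    case False
    then show ?thesis using Cons by (auto simp: backlog_def)
  qed
qed simp

text \<open>Neither \<open>serve\<close> nor \<open>evolve\<close> removes packets, so a packet
  keeps its position and can be followed over time. \<open>serve\<close> also ignores arrivals and
  describes what a fixed group of older packets experiences.\<close>

primrec serve :: "'v clock \<Rightarrow> 'v state \<Rightarrow> 'v state" where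
  "serve (Arrival u) xs = xs"
| "serve (Link e) xs = send_oldest_useful e xs"

primrec evolve :: "'v clock \<Rightarrow> 'v state \<Rightarrow> 'v state" where
  "evolve (Arrival u) xs = xs @ [(u, {u})]"
| "evolve (Link e) xs = send_oldest_useful e xs"

lemma transition_evolve: "transition G a x = depart G (evolve a x)"
  by (cases a) (auto simp: transition_def)

lemma length_serve [simp]: "length (serve a xs) = length xs"
  by (cases a) auto

lemma length_fold_serve [simp]: "length (fold serve w xs) = length xs"
  by (induction w arbitrary: xs) auto

lemma map_fst_fold_serve [simp]: "map fst (fold serve w xs) = map fst xs"
proof (induction w arbitrary: xs)
  case (Cons a w)
  then show ?case by (cases a) auto
qed simp

lemma snd_fold_serve_mono: "i < length xs \<Longrightarrow> snd (xs ! i) \<subseteq> snd (fold serve w xs ! i)"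
proof (induction w arbitrary: xs)
  case (Cons a w)
  have "snd (xs ! i) \<subseteq> snd (serve a xs ! i)"
    using Cons.prems by (cases a) (auto dest: snd_send_mono)
  also have "\<dots> \<subseteq> snd (fold serve w (serve a xs) ! i)" using Cons by simp
  finally show ?case by simp
qed simp

lemma length_evolve: "length xs \<le> length (evolve a xs)" "length (evolve a xs) \<le> Suc (length xs)"
  by (cases a; simp)+

lemma length_fold_evolve_ge: "length xs \<le> length (fold evolve w xs)"
proof (induction w arbitrary: xs)
  case (Cons a w)
  show ?case using Cons.IH[of "evolve a xs"] length_evolve(1)[of xs a] by simp
qed simp

lemma length_fold_evolve_le: "length (fold evolve w xs) \<le> length xs + length w"
proof (induction w arbitrary: xs)
  case (Cons a w)
  show ?case using Cons.IH[of "evolve a xs"] length_evolve(2)[of a xs] by simp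
qed simp

text \<open>Later arrivals do not influence older packets.\<close>

lemma take_fold_evolve:
  "j \<le> length xs \<Longrightarrow> take j (fold evolve w xs) = fold serve w (take j xs)"
proof (induction w arbitrary: xs)
  case (Cons a w)
  have "take j (evolve a xs) = serve a (take j xs)"
    using Cons.prems by (cases a) (auto simp: take_send)
  then show ?case
    using Cons.IH[of "evolve a xs"] Cons.prems length_evolve(1)[of xs a] by simp
qed simp

definition net_clocks :: "'v pair_pre_digraph \<Rightarrow> 'v clock set" where
  "net_clocks G = Arrival ` pverts G \<union> Link ` parcs G"

lemma wf_packet_new: "u \<in> pverts G \<Longrightarrow> wf_packet G (u, {u})"
  by (simp add: wf_packet_def)

lemma wf_evolve:
  assumes "pair_fin_digraph G" "a \<in> net_clocks G" "\<forall>p\<in>set xs. wf_packet G p"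
  shows "\<forall>p\<in>set (evolve a xs). wf_packet G p"
proof (cases a)
  case (Arrival u)
  then show ?thesis using assms wf_packet_new[of u G] by (auto simp: net_clocks_def)
next
  case (Link e)
  then have "e \<in> parcs G" using assms by (auto simp: net_clocks_def)
  then show ?thesis unfolding Link evolve.simps by (rule wf_send[OF assms(1) _ assms(3)])
qed

lemma wf_fold_evolve:
  assumes "pair_fin_digraph G" "set w \<subseteq> net_clocks G" "\<forall>p\<in>set xs. wf_packet G p"
  shows "\<forall>p\<in>set (fold evolve w xs). wf_packet G p"
  using assms(2,3)
proof (induction w arbitrary: xs)
  case (Cons a w)
  have "\<forall>p\<in>set (fold evolve w (evolve a xs)). wf_packet G p"
    by (intro Cons.IH wf_evolve[OF assms(1)]) (use Cons.prems in auto)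
  then show ?case by simp
qed simp

lemma wf_serve:
  assumes "pair_fin_digraph G" "a \<in> net_clocks G" "\<forall>p\<in>set xs. wf_packet G p"
  shows "\<forall>p\<in>set (serve a xs). wf_packet G p"
proof (cases a)
  case (Arrival u)
  then show ?thesis using assms by simp
next
  case (Link e)
  then have "e \<in> parcs G" using assms by (auto simp: net_clocks_def)
  then show ?thesis unfolding Link serve.simps by (rule wf_send[OF assms(1) _ assms(3)])
qed

lemma wf_fold_serve:
  assumes "pair_fin_digraph G" "set w \<subseteq> net_clocks G" "\<forall>p\<in>set xs. wf_packet G p"
  shows "\<forall>p\<in>set (fold serve w xs). wf_packet G p"
  using assms(2,3)
proof (induction w arbitrary: xs)
  case (Cons a w)
  have "\<forall>p\<in>set (fold serve w (serve a xs)). wf_packet G p"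
    by (intro Cons.IH wf_serve[OF assms(1)]) (use Cons.prems in auto)
  then show ?case by simp
qed simp

text \<open>While packet \<open>i\<close> waits at the tail for the head, the link is never idle:
  each of its epochs serves some packet counted in the backlog, and without arrivals the backlog
  never grows.\<close>

lemma backlog_fold_serve:
  assumes "pair_fin_digraph G" "set w \<subseteq> net_clocks G" "\<forall>p\<in>set xs. wf_packet G p"
    and "i < length xs" "fst e \<in> snd (xs ! i)" "snd e \<notin> snd (fold serve w xs ! i)"
  shows "backlog (parcs G) e (fold serve w xs) + length (filter (\<lambda>a. a \<in> {Link e}) w) \<le> backlog (parcs G) e xs"
  using assms(2-)
proof (induction w arbitrary: xs)
  case (Cons a w)
  have a: "a \<in> net_clocks G" using Cons.prems by simp
  have "snd (xs ! i) \<subseteq> snd (serve a xs ! i)"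
    using snd_fold_serve_mono[of i xs "[a]"] Cons.prems by simp
  then have IH: "backlog (parcs G) e (fold serve w (serve a xs)) + length (filter (\<lambda>a. a \<in> {Link e}) w)
      \<le> backlog (parcs G) e (serve a xs)"
    using Cons.prems wf_serve[OF assms(1) a] by (intro Cons.IH) auto
  have "snd e \<notin> snd (xs ! i)"
    using snd_fold_serve_mono[of i xs "a # w"] Cons.prems by auto
  then have "\<exists>p\<in>set xs. useful e p"
    using Cons.prems by (intro bexI[of _ "xs ! i"]) (auto simp: useful_def)
  then have "Suc (backlog (parcs G) e (send_oldest_useful e xs)) \<le> backlog (parcs G) e xs"
    using Cons.prems by (intro backlog_send_less) auto
  moreover have "backlog (parcs G) e (serve a xs) \<le> backlog (parcs G) e xs"
    by (cases a) (simp_all add: backlog_send_le)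
  ultimately show ?case using IH by auto
qed simp

definition hop_complete :: "'v rel \<Rightarrow> nat \<Rightarrow> 'v state \<Rightarrow> bool" where
  "hop_complete R h xs \<longleftrightarrow> (\<forall>p\<in>set xs. \<forall>k\<le>h. \<forall>v. (fst p, v) \<in> R ^^ k \<longrightarrow> v \<in> snd p)"

lemma hop_complete_nth:
  "hop_complete R h xs \<longleftrightarrow> (\<forall>i<length xs. \<forall>k\<le>h. \<forall>v. (fst (xs ! i), v) \<in> R ^^ k \<longrightarrow> v \<in> snd (xs ! i))"
  by (simp add: hop_complete_def all_set_conv_all_nth)

lemma hop_complete_0: "\<forall>p\<in>set xs. wf_packet G p \<Longrightarrow> hop_complete (parcs G) 0 xs"
  by (auto simp: hop_complete_def wf_packet_def)

lemma hop_complete_fold_serve: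
  assumes "hop_complete R h xs"
  shows "hop_complete R h (fold serve w xs)"
proof -
  have "v \<in> snd (fold serve w xs ! i)"
    if "i < length xs" "k \<le> h" "(fst (fold serve w xs ! i), v) \<in> R ^^ k" for i k v
  proof -
    have "fst (fold serve w xs ! i) = fst (xs ! i)"
      using that map_fst_fold_serve[of w xs] by (metis length_fold_serve nth_map)
    then have "v \<in> snd (xs ! i)" using assms that unfolding hop_complete_nth by metis
    then show ?thesis using snd_fold_serve_mono[OF that(1)] by auto
  qed
  then show ?thesis by (simp add: hop_complete_nth)
qed

text \<open>A packet still missing one hop further has waited at the tail of some link throughout
  \<open>w\<close>. By \<open>backlog_fold_serve\<close> the many epochs of this link exhaust its
  backlog, yet the packet itself would still belong to it.\<close>

lemma hop_complete_Suc_fold_serve: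
  assumes G: "pair_fin_digraph G" and w: "set w \<subseteq> net_clocks G" and xs: "\<forall>p\<in>set xs. wf_packet G p"
    and h: "hop_complete (parcs G) h xs"
    and cnt: "\<And>e. e \<in> parcs G \<Longrightarrow> backlog (parcs G) e xs \<le> length (filter (\<lambda>a. a \<in> {Link e}) w)"
  shows "hop_complete (parcs G) (Suc h) (fold serve w xs)"
proof -
  have fst_eq: "fst (fold serve w xs ! i) = fst (xs ! i)" if "i < length xs" for i
    using that map_fst_fold_serve[of w xs] by (metis length_fold_serve nth_map)
  have wf: "\<forall>p\<in>set (fold serve w xs). wf_packet G p"
    by (rule wf_fold_serve[OF G w xs])
  have new: "v \<in> snd (fold serve w xs ! i)" if i: "i < length xs" "(fst (xs ! i), v) \<in> parcs G ^^ Suc h" for i v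
  proof (rule ccontr)
    assume v: "v \<notin> snd (fold serve w xs ! i)"
    obtain u where u: "(fst (xs ! i), u) \<in> parcs G ^^ h" "(u, v) \<in> parcs G" using i by auto
    have ui: "u \<in> snd (xs ! i)" using h u i unfolding hop_complete_nth by blast
    then have "backlog (parcs G) (u, v) (fold serve w xs) + length (filter (\<lambda>a. a \<in> {Link (u, v)}) w)
        \<le> backlog (parcs G) (u, v) xs"
      using i v by (intro backlog_fold_serve[OF G w xs]) auto
    then have "backlog (parcs G) (u, v) (fold serve w xs) = 0" using cnt[OF u(2)] by simp
    moreover have "useful (u, v) (fold serve w xs ! i)"
      using v ui snd_fold_serve_mono[OF i(1), of w] by (auto simp: useful_def)
    then have "needs (parcs G) (u, v) (fold serve w xs ! i)"
      using wf i by (intro useful_needs[of G]) auto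
    ultimately show False
      using i by (auto simp: backlog_def filter_empty_conv)
  qed
  have old: "hop_complete (parcs G) h (fold serve w xs)" by (rule hop_complete_fold_serve[OF h])
  have "v \<in> snd (fold serve w xs ! i)"
    if "i < length xs" "k \<le> Suc h" "(fst (fold serve w xs ! i), v) \<in> parcs G ^^ k" for i k v
  proof (cases "k = Suc h")
    case True
    then show ?thesis using new[of i v] that fst_eq by metis
  next
    case False
    then have "k \<le> h" using that by simp
    then show ?thesis using old that unfolding hop_complete_nth by simp
  qed
  then show ?thesis by (simp add: hop_complete_nth)
qed

text \<open>\<open>card R\<close> hops already cover everything that can be reached, and the head of
  a link is reachable from each of its feeders.\<close>

lemma hop_complete_not_needs:
  assumes "finite R" "hop_complete R (card R) xs" "e \<in> R" "p \<in> set xs"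
  shows "\<not> needs R e p"
proof
  assume n: "needs R e p"
  have "{(a, b) \<in> R. b \<noteq> snd e}\<^sup>* \<subseteq> R\<^sup>*" by (intro rtrancl_mono) auto
  then have "(fst p, fst e) \<in> R\<^sup>*" using n by (auto simp: needs_def feeders_def)
  then have "(fst p, snd e) \<in> R\<^sup>*" using assms by (metis prod.collapse rtrancl.rtrancl_into_rtrancl)
  then obtain k where "k \<le> card R" "(fst p, snd e) \<in> R ^^ k"
    using rtrancl_finite_eq_relpow[OF assms(1)] by auto
  then show False using assms n by (auto simp: hop_complete_def needs_def)
qed

lemma hop_complete_departs:
  assumes "finite (parcs G)" "hop_complete (parcs G) (card (parcs G)) xs" "\<forall>p\<in>set xs. wf_packet G p"
    and "\<And>p v. p \<in> set xs \<Longrightarrow> v \<in> pverts G \<Longrightarrow> (fst p, v) \<in> (parcs G)\<^sup>*"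
  shows "depart G xs = []"
proof -
  have "snd p = pverts G" if p: "p \<in> set xs" for p
  proof
    show "snd p \<subseteq> pverts G" using assms p by (auto simp: wf_packet_def)
    show "pverts G \<subseteq> snd p"
    proof
      fix v assume "v \<in> pverts G"
      then obtain k where "k \<le> card (parcs G)" "(fst p, v) \<in> parcs G ^^ k"
        using assms(4)[OF p] rtrancl_finite_eq_relpow[OF assms(1)] by auto
      then show "v \<in> snd p" using assms(2) p by (auto simp: hop_complete_def)
    qed
  qed
  then show ?thesis by (auto simp: depart_def filter_empty_conv)
qed

text \<open>A packet held at all nodes lacks no head, so the search for the oldest useful packet
  skips it whether or not it has been removed.\<close>

lemma depart_send:
  assumes "snd e \<in> pverts G"
  shows "depart G (send_oldest_useful e (depart G x)) = depart G (send_oldest_useful e x)"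
  using assms by (induction x) (auto simp: depart_def useful_def)

lemma depart_idem [simp]: "depart G (depart G x) = depart G x"
  by (simp add: depart_def)

lemma depart_append [simp]: "depart G (x @ y) = depart G x @ depart G y"
  by (simp add: depart_def)

lemma transition_depart:
  assumes "pair_fin_digraph G" "a \<in> net_clocks G"
  shows "transition G a (depart G x) = depart G (evolve a x)"
proof -
  interpret pair_fin_digraph G by fact
  show ?thesis
  proof (cases a)
    case (Link e)
    then have "snd e \<in> pverts G" using assms Link by (intro arc_snd_in_verts) (auto simp: net_clocks_def)
    then show ?thesis using Link by (simp add: transition_evolve depart_send)
  qed (simp add: transition_evolve)
qed

text \<open>All departures may be postponed to the end of the word, which reduces the chain to
  \<open>evolve\<close>.\<close>

lemma fold_transition:
  assumes "pair_fin_digraph G" "set w \<subseteq> net_clocks G"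
  shows "fold (transition G) w (depart G x) = depart G (fold evolve w x)"
  using assms(2) by (induction w arbitrary: x) (auto simp: transition_depart[OF assms(1)])

definition from_sources :: "'v set \<Rightarrow> 'v state \<Rightarrow> nat" where
  "from_sources S xs = length (filter (\<lambda>p. fst p \<in> S) xs)"

lemma from_sources_map: "from_sources S xs = length (filter (\<lambda>s. s \<in> S) (map fst xs))"
  by (simp add: from_sources_def filter_map o_def)

lemma from_sources_fold_serve: "from_sources S (fold serve w xs) = from_sources S xs"
  by (simp only: from_sources_map map_fst_fold_serve)

lemma from_sources_fold_evolve:
  "from_sources S (fold evolve w xs) = from_sources S xs + length (filter (\<lambda>a. a \<in> Arrival ` S) w)"
proof (induction w arbitrary: xs)
  case (Cons a w)
  have "from_sources S (evolve a xs) = from_sources S xs + (if a \<in> Arrival ` S then 1 else 0)"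
    by (cases a) (auto simp: from_sources_map)
  then show ?case using Cons.IH[of "evolve a xs"] by simp
qed simp

lemma backlog_le_from_sources: "backlog R e xs \<le> from_sources (feeders R e) xs"
  by (induction xs) (auto simp: backlog_def from_sources_def needs_def)

section \<open>Ages of packets\<close>

definition letters_in :: "'a set \<Rightarrow> 'a list \<Rightarrow> nat" where
  "letters_in L w = length (filter (\<lambda>a. a \<in> L) w)"

text \<open>Number the events of a word by 0, 1, ... and let the K initial packets arrive before event 0.
  If link e is served at rate pc e per event and fed at rate at most r * pc e, then all packets
  that arrived up to event s have left by event f s = \<beta> + \<alpha> s, where r < \<alpha> < 1: the slope of f lets
  the delay f s - s shrink to the size of the statistical error. The packets that have arrived up to
  event s are available within h hops of their sources by event f s - D h; in the induction on h the
  backlog at a link consists of packets that arrived after the latest event s' with f s' \<le> f s - D h.\<close>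

lemma fluid_bound:
  fixes G :: "'v pair_pre_digraph" and w :: "'v clock list" and x :: "'v state"
    and d K cmin r \<alpha> \<beta> :: real and pc pr :: "'v \<times> 'v \<Rightarrow> real"
  defines "J s \<equiv> length (fold evolve (take s w) x)"
    and "H \<equiv> card (parcs G)" and "\<gamma> \<equiv> 1 - r / \<alpha>" and "\<eta> \<equiv> (2 + 2 * d) / cmin"
  assumes G: "pair_fin_digraph G" and w: "set w \<subseteq> net_clocks G" and x: "\<forall>p\<in>set x. wf_packet G p"
    and K: "real (length x) \<le> K"
    and served: "\<And>e i j. e \<in> parcs G \<Longrightarrow> i \<le> j \<Longrightarrow> j \<le> length w \<Longrightarrow>
        pc e * (real j - real i) - d \<le> real (letters_in {Link e} (take j w)) - real (letters_in {Link e} (take i w))"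
    and fed: "\<And>e i j. e \<in> parcs G \<Longrightarrow> i \<le> j \<Longrightarrow> j \<le> length w \<Longrightarrow>
        real (letters_in (Arrival ` feeders (parcs G) e) (take j w))
          - real (letters_in (Arrival ` feeders (parcs G) e) (take i w)) \<le> pr e * (real j - real i) + d"
    and rates: "\<And>e. e \<in> parcs G \<Longrightarrow> 0 \<le> pr e \<and> pr e \<le> r * pc e \<and> pr e \<le> 1 \<and> pc e \<le> 1 \<and> cmin \<le> pc e"
    and const: "0 < cmin" "cmin \<le> 1" "0 \<le> d" "0 < r" "r < \<alpha>" "\<alpha> < 1" "0 \<le> \<beta>"
    and start: "real H * (\<eta> + K / cmin) < \<gamma> ^ H * (\<alpha> * \<beta>)"
    and stop: "real H * \<eta> < \<gamma> ^ H * (\<beta> - (1 - \<alpha>) * real s0)"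
    and s: "s \<le> s0" "\<beta> + \<alpha> * real s \<le> real n" "n \<le> length w"
  shows "hop_complete (parcs G) H (take (J s) (fold evolve (take n w) x))"
  using s
proof (induction s arbitrary: n rule: less_induct)
  case (less s)
  interpret pair_fin_digraph G by fact
  have K0: "0 \<le> K" using K by linarith
  have \<gamma>: "0 < \<gamma>" "\<gamma> < 1" using const by (auto simp: \<gamma>_def)
  have \<eta>: "2 \<le> \<eta>"
    using const by (simp add: \<eta>_def le_divide_eq)
  define Y where "Y n = fold evolve (take n w) x" for n
  define f where "f = \<beta> + \<alpha> * real s"
  \<comment> \<open>The delay \<open>f - s\<close> that is granted to the packets arrived up to
    event \<open>s\<close>.\<close>
  define g where "g = \<beta> - (1 - \<alpha>) * real s"
  \<comment> \<open>The error allowed per hop. Only for \<open>s < \<beta>\<close> can the initial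
    \<open>K\<close> packets still count in a backlog, at the cost of \<open>K / cmin\<close>
    further events.\<close>
  define \<eta>s where "\<eta>s = \<eta> + (if real s < \<beta> then K / cmin else 0)"
  \<comment> \<open>The part of the delay left after \<open>h\<close> hops: each hop uses a fraction
    \<open>1 - \<gamma>\<close> of what is left and the error \<open>\<eta>s\<close>.\<close>
  define D where "D h = \<gamma> ^ h * g - real h * \<eta>s" for h
  have \<eta>s: "2 \<le> \<eta>s" using \<eta> K0 const by (simp add: \<eta>s_def add_increasing2)
  \<comment> \<open>The delay \<open>g\<close> decreases in \<open>s\<close>. Below
    \<open>\<beta>\<close> it is at least \<open>\<alpha> * \<beta>\<close>, which
    \<open>start\<close> compares with the larger error; from there up to \<open>s0\<close> it is at
    least its value at \<open>s0\<close>, which \<open>stop\<close> compares with the smaller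
    one.\<close>
  have H\<eta>: "real H * \<eta>s < \<gamma> ^ H * g"
  proof (cases "real s < \<beta>")
    case True
    have "(1 - \<alpha>) * real s \<le> (1 - \<alpha>) * \<beta>" using True const by (intro mult_left_mono) auto
    then have "\<alpha> * \<beta> \<le> g" by (simp add: g_def algebra_simps)
    then have "\<gamma> ^ H * (\<alpha> * \<beta>) \<le> \<gamma> ^ H * g" using \<gamma> by (intro mult_left_mono) auto
    then show ?thesis using start True by (simp add: \<eta>s_def)
  next
    case False
    have "(1 - \<alpha>) * real s \<le> (1 - \<alpha>) * real s0" using less.prems const by (intro mult_left_mono) auto
    then have "\<gamma> ^ H * (\<beta> - (1 - \<alpha>) * real s0) \<le> \<gamma> ^ H * g" using \<gamma> by (intro mult_left_mono) (auto simp: g_def)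
    then show ?thesis using stop False by (simp add: \<eta>s_def)
  qed
  have "0 \<le> real H * \<eta>s" using \<eta>s by (intro mult_nonneg_nonneg) auto
  then have "0 < \<gamma> ^ H * g" using H\<eta> by linarith
  then have g: "0 < g" using \<gamma> by (simp add: zero_less_mult_iff)
  have D_pos: "0 < D h" if "h \<le> H" for h
  proof -
    have "real h * \<eta>s \<le> real H * \<eta>s" using that \<eta>s by (intro mult_right_mono) auto
    also have "\<dots> < \<gamma> ^ H * g" by fact
    also have "\<dots> \<le> \<gamma> ^ h * g" using that g \<gamma> by (intro mult_right_mono power_decreasing) auto
    finally show ?thesis by (simp add: D_def)
  qed
  have D_le: "D h \<le> g" for h
  proof -
    have "\<gamma> ^ h * g \<le> 1 * g" using \<gamma> g by (intro mult_right_mono power_le_one) auto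
    moreover have "0 \<le> real h * \<eta>s" using \<eta>s by (intro mult_nonneg_nonneg) auto
    ultimately show ?thesis unfolding D_def by linarith
  qed
  have fg: "f - g = real s" by (simp add: f_def g_def algebra_simps)
  have D_Suc: "D (Suc h) \<le> \<gamma> * D h - \<eta>s" for h
  proof -
    have "\<gamma> * (real h * \<eta>s) \<le> 1 * (real h * \<eta>s)" using \<gamma> \<eta>s by (intro mult_right_mono) auto
    then show ?thesis by (simp add: D_def algebra_simps)
  qed
  have wfY: "\<forall>p\<in>set (Y n). wf_packet G p" for n
    unfolding Y_def using w by (intro wf_fold_evolve[OF G _ x]) (auto dest: in_set_takeD)
  have wf_take: "\<forall>p\<in>set (take j (Y n)). wf_packet G p" for j n
    using wfY by (auto dest: in_set_takeD)
  have Y_step: "Y n = fold evolve (drop m (take n w)) (Y m)" if "m \<le> n" for m n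
  proof -
    have "take n w = take m w @ drop m (take n w)"
      using that by (metis append_take_drop_id min.absorb1 take_take)
    then show ?thesis unfolding Y_def by (metis comp_apply fold_append)
  qed
  have J_mono: "J i \<le> J j" if "i \<le> j" for i j
    by (simp only: J_def Y_def[symmetric] Y_step[OF that] length_fold_evolve_ge)
  have take_Y: "take (J i) (Y n) = fold serve (drop m (take n w)) (take (J i) (Y m))" if "i \<le> m" "m \<le> n" for i m n
    unfolding Y_step[OF that(2)] using J_mono[OF that(1)]
    by (intro take_fold_evolve) (simp add: J_def Y_def)
  have src: "from_sources S (take (J i) (Y n)) = from_sources S x + letters_in (Arrival ` S) (take i w)"
    if "i \<le> n" for i n S
  proof -
    have "from_sources S (take (J i) (Y n)) = from_sources S (take (J i) (Y i))"
      unfolding take_Y[OF order_refl that] by (rule from_sources_fold_serve)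
    also have "take (J i) (Y i) = Y i" by (simp add: J_def Y_def)
    finally show ?thesis by (simp add: Y_def from_sources_fold_evolve letters_in_def)
  qed
  have "hop_complete (parcs G) h (take (J s) (Y n))" if "h \<le> H" "n \<le> length w" "f - D h \<le> real n" for h n
    using that
  proof (induction h arbitrary: n)
    case 0
    show ?case by (intro hop_complete_0 wf_take)
  next
    case (Suc h)
    define t where "t = f - D h"
    have Dh: "0 < D h" using D_pos Suc.prems by simp
    have t: "real s \<le> t" "t < f" using D_le[of h] fg Dh by (auto simp: t_def)
    \<comment> \<open>Rounding up to an event costs at most one event, for which
      \<open>\<eta>s\<close> leaves room.\<close>
    define m where "m = nat \<lceil>t\<rceil>"
    have m: "t \<le> real m" "real m < t + 1"
      using t unfolding m_def by linarith+
    have n: "t + (1 - \<gamma>) * D h + \<eta>s \<le> real n"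
      using Suc.prems D_Suc[of h] by (simp add: t_def algebra_simps)
    have "0 \<le> (1 - \<gamma>) * D h" using Dh \<gamma> by simp
    then have "real m < real n" using n m \<eta>s by linarith
    then have mn: "m \<le> n" by simp
    have sm: "s \<le> m" using m t by linarith
    have mw: "m \<le> length w" using mn Suc.prems by simp
    have comp_m: "hop_complete (parcs G) h (take (J s) (Y m))"
      using Suc.prems m mw by (intro Suc.IH) (auto simp: t_def)
    show ?case
      unfolding take_Y[OF sm mn]
    proof (rule hop_complete_Suc_fold_serve[OF G _ wf_take comp_m])
      show "set (drop m (take n w)) \<subseteq> net_clocks G" using w by (auto dest: in_set_dropD in_set_takeD)
      fix e assume e: "e \<in> parcs G"
      note re = rates[OF e]
      \<comment> \<open>The origin of \<open>\<gamma>\<close>: the backlog arrived during about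
        \<open>D h / \<alpha>\<close> events at rate at most \<open>r * pc e\<close>, and service at
        rate \<open>pc e\<close> clears it in \<open>r / \<alpha> = 1 - \<gamma>\<close> times
        \<open>D h\<close> events.\<close>
      have r1: "pr e * (D h / \<alpha>) \<le> pc e * ((1 - \<gamma>) * D h)"
      proof -
        have "pr e * (D h / \<alpha>) \<le> (r * pc e) * (D h / \<alpha>)" using re Dh const by (intro mult_right_mono) auto
        then show ?thesis by (simp add: \<gamma>_def mult_ac)
      qed
      have B: "real (backlog (parcs G) e (take (J s) (Y m)))
          \<le> pr e * (D h / \<alpha>) + 1 + d + (if real s < \<beta> then K else 0)"
      \<comment> \<open>Before \<open>\<beta>\<close>, the value of \<open>f\<close> at 0, the
        induction clears no group of packets, so everything that arrived up to \<open>s\<close> is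
        counted, including the initial packets.\<close>
      proof (cases "t < \<beta>")
        case True
        then have sb: "real s < \<beta>" using t by simp
        have "real (backlog (parcs G) e (take (J s) (Y m)))
            \<le> real (from_sources (feeders (parcs G) e) (take (J s) (Y m)))"
          using backlog_le_from_sources by (simp only: of_nat_le_iff)
        also have "\<dots> = real (from_sources (feeders (parcs G) e) x)
            + real (letters_in (Arrival ` feeders (parcs G) e) (take s w))"
          unfolding src[OF sm] by simp
        also have "\<dots> \<le> K + (pr e * real s + d)"
        proof (intro add_mono)
          have "from_sources (feeders (parcs G) e) x \<le> length x" by (simp add: from_sources_def)
          then show "real (from_sources (feeders (parcs G) e) x) \<le> K" using K by linarith
          show "real (letters_in (Arrival ` feeders (parcs G) e) (take s w)) \<le> pr e * real s + d"
            using fed[OF e, of 0 s] sm mw by (simp add: letters_in_def)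
        qed
        also have "pr e * real s \<le> pr e * (D h / \<alpha>)"
        proof (intro mult_left_mono)
          have "\<alpha> * real s \<le> D h" using True by (simp add: t_def f_def)
          then show "real s \<le> D h / \<alpha>" using const by (simp add: le_divide_eq mult.commute)
        qed (use re in auto)
        finally show ?thesis using sb by simp
      next
        case False
        define s' where "s' = nat \<lfloor>(t - \<beta>) / \<alpha>\<rfloor>"
        have s': "real s' \<le> (t - \<beta>) / \<alpha>" "(t - \<beta>) / \<alpha> < real s' + 1"
          using False const unfolding s'_def by (auto simp: floor_less_iff divide_nonneg_pos)
        have le_t: "\<beta> + \<alpha> * real s' \<le> t" using s'(1) const by (simp add: le_divide_eq mult.commute)
        then have "\<alpha> * real s' < \<alpha> * real s" using t by (simp add: f_def)
        then have ss: "s' < s" using const by simp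
        have diff: "real s - real s' \<le> D h / \<alpha> + 1"
        proof -
          have "D h / \<alpha> = real s - (t - \<beta>) / \<alpha>" using const by (simp add: t_def f_def field_simps)
          then show ?thesis using s'(2) by linarith
        qed
        have "hop_complete (parcs G) H (take (J s') (fold evolve (take m w) x))"
          using ss less.prems le_t m mw by (intro less.IH) auto
        then have "hop_complete (parcs G) H (take (J s') (Y m))" by (simp add: Y_def)
        then have "\<not> needs (parcs G) e p" if "p \<in> set (take (J s') (Y m))" for p
          using hop_complete_not_needs[OF pair_finite_arcs _ e that] by (simp add: H_def)
        then have none: "filter (needs (parcs G) e) (take (J s') (Y m)) = []"
          by (simp add: filter_empty_conv)
        define zs where "zs = drop (J s') (take (J s) (Y m))"
        have split: "take (J s) (Y m) = take (J s') (Y m) @ zs"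
          using J_mono[of s' s] ss unfolding zs_def by (metis append_take_drop_id less_imp_le min.absorb1 take_take)
        have "backlog (parcs G) e (take (J s) (Y m)) = backlog (parcs G) e zs"
          unfolding split backlog_def by (simp add: none)
        also have "\<dots> \<le> from_sources (feeders (parcs G) e) zs" by (rule backlog_le_from_sources)
        finally have "real (backlog (parcs G) e (take (J s) (Y m))) \<le> real (from_sources (feeders (parcs G) e) zs)"
          by simp
        also have "from_sources (feeders (parcs G) e) (take (J s) (Y m))
            = from_sources (feeders (parcs G) e) (take (J s') (Y m)) + from_sources (feeders (parcs G) e) zs"
          unfolding split by (simp add: from_sources_def)
        then have "real (from_sources (feeders (parcs G) e) zs)
            = real (letters_in (Arrival ` feeders (parcs G) e) (take s w))
              - real (letters_in (Arrival ` feeders (parcs G) e) (take s' w))"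
          using src[OF sm] src[of s' m] ss sm by simp
        also have "\<dots> \<le> pr e * (real s - real s') + d"
          using ss sm mw by (intro fed[OF e]) auto
        also have "\<dots> \<le> pr e * (D h / \<alpha> + 1) + d"
          using diff re by (intro add_right_mono mult_left_mono) auto
        also have "\<dots> \<le> pr e * (D h / \<alpha>) + 1 + d + (if real s < \<beta> then K else 0)"
          using re K0 by (simp add: distrib_left)
        finally show ?thesis .
      qed
      \<comment> \<open>Here \<open>\<eta>\<close> pays for its numerator: 1 for rounding
        \<open>s'\<close>, 1 for rounding \<open>m\<close>, and \<open>d\<close> each for the
        fluctuations of arrivals and of service.\<close>
      have cm: "2 + 2 * d + (if real s < \<beta> then K else 0) \<le> pc e * \<eta>s"
      proof -
        have "2 + 2 * d + (if real s < \<beta> then K else 0) = cmin * \<eta>s"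
          using const by (simp add: \<eta>s_def \<eta>_def field_simps)
        also have "\<dots> \<le> pc e * \<eta>s" using re \<eta>s by (intro mult_right_mono) auto
        finally show ?thesis .
      qed
      have pc0: "0 \<le> pc e" "pc e \<le> 1" using re const by auto
      have "pc e * ((1 - \<gamma>) * D h) + pc e * \<eta>s - pc e \<le> pc e * (real n - real m)"
      proof -
        have "(1 - \<gamma>) * D h + \<eta>s - 1 \<le> real n - real m" using n m by linarith
        then have "pc e * ((1 - \<gamma>) * D h + \<eta>s - 1) \<le> pc e * (real n - real m)"
          using pc0 by (intro mult_left_mono)
        then show ?thesis by (simp add: algebra_simps)
      qed
      then have "real (backlog (parcs G) e (take (J s) (Y m))) \<le> pc e * (real n - real m) - d"
        using B r1 cm pc0 by linarith
      also have "\<dots> \<le> real (letters_in {Link e} (take n w)) - real (letters_in {Link e} (take m w))"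
        using mn Suc.prems by (intro served[OF e])
      also have "letters_in {Link e} (take n w)
          = letters_in {Link e} (take m w) + letters_in {Link e} (drop m (take n w))"
        using mn unfolding letters_in_def
        by (metis (no_types) append_take_drop_id filter_append length_append min.absorb1 take_take)
      finally show "backlog (parcs G) e (take (J s) (Y m)) \<le> length (filter (\<lambda>a. a \<in> {Link e}) (drop m (take n w)))"
        by (simp add: letters_in_def)
    qed
  qed
  from this[of H n] less.prems D_pos[of H] show ?case
    by (simp add: f_def Y_def)
qed

section \<open>The jump chain of the network\<close>

locale network =
  fixes G :: "'v pair_pre_digraph" and arr :: "'v \<Rightarrow> real" and c :: "'v \<times> 'v \<Rightarrow> real"
  assumes pair_fin: "pair_fin_digraph G"
    and c_pos: "\<And>e. e \<in> parcs G \<Longrightarrow> c e > 0"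
    and arr_nonneg: "\<And>u. u \<in> pverts G \<Longrightarrow> arr u \<ge> 0"
    and clocks_nonempty: "clocks G arr \<noteq> {}"
begin

abbreviation "A \<equiv> clocks G arr"
text \<open>The value 1 off the clocks is a dummy: the product of the gap measures is formed from a
  probability space at every index.\<close>

definition "rate a = (if a \<in> A then clock_rate arr c a else 1)"
definition "total_rate = (\<Sum>a\<in>A. rate a)"
definition "p a = rate a / total_rate"

lemma clocks_subset: "A \<subseteq> net_clocks G"
  by (auto simp: clocks_def net_clocks_def)

lemma finite_clocks: "finite A"
  using pair_fin by (auto simp: clocks_def pair_fin_digraph_def pair_fin_digraph_axioms_def)

lemma rate_pos: "0 < rate a"
  using c_pos by (auto simp: rate_def clocks_def)

lemma total_rate_pos: "0 < total_rate"
  unfolding total_rate_def by (intro sum_pos finite_clocks clocks_nonempty rate_pos)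

lemma p_pos: "0 < p a"
  using rate_pos total_rate_pos by (simp add: p_def)

sublocale letters A p
  using p_pos total_rate_pos
  by unfold_locales (auto simp: finite_clocks less_imp_le p_def total_rate_def simp flip: sum_divide_distrib)

lemma reachable_wf:
  "x \<in> reachable G arr \<Longrightarrow>
   depart G x = x \<and> (\<forall>q\<in>set x. wf_packet G q) \<and> (\<forall>q\<in>set x. fst q \<in> pverts G \<and> arr (fst q) > 0)"
proof (induction rule: reachable.induct)
  case empty
  then show ?case by (simp add: depart_def)
next
  case (step x a)
  have a: "a \<in> net_clocks G" using step clocks_subset by auto
  have "\<forall>q\<in>set (evolve a x). wf_packet G q" using step by (intro wf_evolve[OF pair_fin a]) auto
  moreover have "\<forall>s\<in>set (map fst (evolve a x)). s \<in> pverts G \<and> arr s > 0"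
    using step by (cases a) (auto simp: clocks_def)
  moreover have "set (depart G (evolve a x)) \<subseteq> set (evolve a x)" by (auto simp: depart_def)
  ultimately show ?case
    unfolding transition_evolve set_map by (intro conjI ballI depart_idem) (blast intro: imageI)+
qed

lemma reachable_from_empty: "x \<in> reachable G arr \<Longrightarrow> \<exists>w. set w \<subseteq> A \<and> fold (transition G) w [] = x"
proof (induction rule: reachable.induct)
  case empty
  show ?case by (intro exI[of _ "[]"]) simp
next
  case (step x a)
  then obtain w where "set w \<subseteq> A" "fold (transition G) w [] = x" by blast
  then show ?case using step by (intro exI[of _ "w @ [a]"]) simp
qed

lemma fold_transition_reachable:
  assumes "x \<in> reachable G arr" "set w \<subseteq> A"
  shows "fold (transition G) w x = depart G (fold evolve w x)"
  using fold_transition[OF pair_fin, of w x] reachable_wf[OF assms(1)] assms(2) clocks_subset by auto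

lemma finite_short:
  "finite {x \<in> reachable G arr. length x \<le> k}"
proof -
  interpret pair_fin_digraph G by (rule pair_fin)
  have "{x \<in> reachable G arr. length x \<le> k} \<subseteq> {x. set x \<subseteq> pverts G \<times> Pow (pverts G) \<and> length x \<le> k}"
    using reachable_wf by (force simp: wf_packet_def)
  then show ?thesis
    by (rule finite_subset) (intro finite_lists_length_le finite_cartesian_product, auto)
qed

end

section \<open>Drift of the number of packets under subcritical link loads\<close>

locale subcritical_network = network +
  assumes load: "\<And>e. e \<in> parcs G \<Longrightarrow> (\<Sum>s\<in>feeders (parcs G) e. arr s) < c e"
    and reach: "\<And>u v. u \<in> pverts G \<Longrightarrow> arr u > 0 \<Longrightarrow> v \<in> pverts G \<Longrightarrow> (u, v) \<in> (parcs G)\<^sup>*"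
begin

lemma departs:
  assumes "x \<in> reachable G arr" "set w \<subseteq> A" "hop_complete (parcs G) (card (parcs G)) (take j (fold evolve w x))"
  shows "depart G (take j (fold evolve w x)) = []"
proof (rule hop_complete_departs[OF _ assms(3)])
  interpret pair_fin_digraph G by (rule pair_fin)
  show "finite (parcs G)" by (rule pair_finite_arcs)
  have w: "set w \<subseteq> net_clocks G" using assms(2) clocks_subset by auto
  show "\<forall>q\<in>set (take j (fold evolve w x)). wf_packet G q"
    using wf_fold_evolve[OF pair_fin w, of x] reachable_wf[OF assms(1)] by (auto dest: in_set_takeD)
  have src: "\<forall>q\<in>set (fold evolve w x). fst q \<in> pverts G \<and> arr (fst q) > 0"
    if "\<forall>q\<in>set x. fst q \<in> pverts G \<and> arr (fst q) > 0" "set w \<subseteq> A" for w x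
    using that
  proof (induction w arbitrary: x)
    case (Cons a w)
    have "\<forall>s\<in>set (map fst (evolve a x)). s \<in> pverts G \<and> arr s > 0"
      using Cons.prems by (cases a) (auto simp: clocks_def)
    then have "\<forall>q\<in>set (evolve a x). fst q \<in> pverts G \<and> arr (fst q) > 0" by simp
    then have "\<forall>q\<in>set (fold evolve w (evolve a x)). fst q \<in> pverts G \<and> arr (fst q) > 0"
      by (intro Cons.IH) (use Cons.prems in auto)
    then show ?case by simp
  qed simp
  show "(fst q, v) \<in> (parcs G)\<^sup>*" if "q \<in> set (take j (fold evolve w x))" "v \<in> pverts G" for q v
    using src[of x w] reachable_wf[OF assms(1)] assms(2) that by (intro reach) (auto dest: in_set_takeD)
qed

text \<open>Without arrivals, a block in which every link rings at least \<open>length x\<close>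
  times advances all packets by one hop. Each letter has positive probability, so the empty state is
  accessible from everywhere.\<close>

lemma drain:
  assumes x: "x \<in> reachable G arr"
  shows "\<exists>w. set w \<subseteq> A \<and> fold (transition G) w x = []"
proof -
  interpret pair_fin_digraph G by (rule pair_fin)
  obtain es where es: "set es = parcs G" using finite_list[OF pair_finite_arcs] by blast
  define b where "b = concat (replicate (length x) (map Link es))"
  have b: "set b \<subseteq> Link ` parcs G" using es by (auto simp: b_def)
  have len_b: "length x \<le> length (filter (\<lambda>a. a \<in> {Link e}) b)" if "e \<in> parcs G" for e
  proof -
    have "1 \<le> length (filter (\<lambda>a. a \<in> {Link e}) (map Link es))"
      using that es by (auto simp: Suc_le_eq filter_empty_conv)
    then have "n \<le> length (filter (\<lambda>a. a \<in> {Link e}) (concat (replicate n (map Link es))))" for n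
      by (induction n) auto
    then show ?thesis by (simp add: b_def)
  qed
  have link_clock: "Link ` parcs G \<subseteq> A" by (auto simp: clocks_def)
  have "\<exists>w. set w \<subseteq> Link ` parcs G \<and> hop_complete (parcs G) h (fold serve w x)" for h
  proof (induction h)
    case 0
    show ?case using reachable_wf[OF x] by (intro exI[of _ "[]"]) (simp add: hop_complete_0)
  next
    case (Suc h)
    then obtain w where w: "set w \<subseteq> Link ` parcs G" "hop_complete (parcs G) h (fold serve w x)" by blast
    have "hop_complete (parcs G) (Suc h) (fold serve b (fold serve w x))"
    proof (rule hop_complete_Suc_fold_serve[OF pair_fin _ _ w(2)])
      show "set b \<subseteq> net_clocks G" using b by (auto simp: net_clocks_def)
      show "\<forall>q\<in>set (fold serve w x). wf_packet G q"
        using w reachable_wf[OF x] by (intro wf_fold_serve[OF pair_fin]) (auto simp: net_clocks_def)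
      fix e assume e: "e \<in> parcs G"
      have "backlog (parcs G) e (fold serve w x) \<le> length x"
        using length_filter_le[of "needs (parcs G) e" "fold serve w x"] by (simp add: backlog_def)
      then show "backlog (parcs G) e (fold serve w x) \<le> length (filter (\<lambda>a. a \<in> {Link e}) b)"
        using len_b[OF e] by linarith
    qed
    then show ?case using w b by (intro exI[of _ "w @ b"]) auto
  qed
  then obtain w where w: "set w \<subseteq> Link ` parcs G" "hop_complete (parcs G) (card (parcs G)) (fold serve w x)" by blast
  have "fold evolve w y = fold serve w y" for y
    using w(1) by (induction w arbitrary: y) auto
  then have eq: "fold evolve w x = take (length x) (fold evolve w x)" "fold evolve w x = fold serve w x" by simp_all
  have wA: "set w \<subseteq> A" using w link_clock by auto
  have "depart G (take (length x) (fold evolve w x)) = []"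
    by (intro departs x wA) (use w eq in simp)
  then have "fold (transition G) w x = []"
    using eq by (simp add: fold_transition_reachable[OF x wA])
  then show ?thesis using wA by blast
qed

lemma rate_ratio:
  obtains r cmin where "0 < r" "r < 1" "0 < cmin" "cmin \<le> 1"
    "\<And>e. e \<in> parcs G \<Longrightarrow> (\<Sum>a\<in>A \<inter> Arrival ` feeders (parcs G) e. p a) \<le> r * p (Link e)"
    "\<And>e. e \<in> parcs G \<Longrightarrow> cmin \<le> p (Link e)"
proof -
  interpret pair_fin_digraph G by (rule pair_fin)
  define q where "q e = (\<Sum>a\<in>A \<inter> Arrival ` feeders (parcs G) e. p a)" for e
  have q: "q e < p (Link e)" if e: "e \<in> parcs G" for e
  proof -
    let ?F = "feeders (parcs G) e"
    have F: "?F \<subseteq> pverts G" by (rule feeders_subset[OF pair_fin e])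
    have "A \<inter> Arrival ` ?F = Arrival ` {s \<in> ?F. arr s > 0}" using F by (auto simp: clocks_def)
    then have "q e = (\<Sum>s\<in>{s \<in> ?F. arr s > 0}. arr s / total_rate)"
      by (simp add: q_def sum.reindex inj_on_def p_def) (use F in \<open>auto simp: rate_def clocks_def intro!: sum.cong\<close>)
    also have "\<dots> = (\<Sum>s\<in>{s \<in> ?F. arr s > 0}. arr s) / total_rate" by (simp add: sum_divide_distrib)
    also have "(\<Sum>s\<in>{s \<in> ?F. arr s > 0}. arr s) \<le> (\<Sum>s\<in>?F. arr s)"
      using F arr_nonneg finite_subset[OF F pair_finite_verts] by (intro sum_mono2) auto
    also have "\<dots> < c e" by (rule load[OF e])
    finally show ?thesis using total_rate_pos e by (simp add: p_def rate_def clocks_def divide_strict_right_mono divide_right_mono)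
  qed
  \<comment> \<open>The inserted values 1/2 here and 1 below keep \<open>Max\<close> and
    \<open>Min\<close> meaningful without links, and they force \<open>0 < r\<close> and
    \<open>cmin \<le> 1\<close>.\<close>
  define r where "r = Max (insert (1/2) ((\<lambda>e. q e / p (Link e)) ` parcs G))"
  define cmin where "cmin = Min (insert 1 ((\<lambda>e. p (Link e)) ` parcs G))"
  have "r \<in> insert (1/2) ((\<lambda>e. q e / p (Link e)) ` parcs G)"
    unfolding r_def by (intro Max_in) auto
  then have "r < 1" using q p_pos by auto
  moreover have "1 / 2 \<le> r" unfolding r_def by (intro Max_ge) auto
  moreover have "cmin \<in> insert 1 ((\<lambda>e. p (Link e)) ` parcs G)"
    unfolding cmin_def by (intro Min_in) auto
  then have "0 < cmin" using p_pos by auto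
  moreover have "cmin \<le> 1" unfolding cmin_def by (intro Min_le) auto
  moreover have "q e \<le> r * p (Link e)" if e: "e \<in> parcs G" for e
  proof -
    have "q e / p (Link e) \<le> r" unfolding r_def using e by (intro Max_ge) auto
    then show ?thesis using p_pos[of "Link e"] by (simp add: divide_le_eq)
  qed
  moreover have "cmin \<le> p (Link e)" if "e \<in> parcs G" for e
    unfolding cmin_def using that by (intro Min_le) auto
  ultimately show ?thesis using that[of r cmin] by (auto simp: q_def)
qed

definition "watched = (\<lambda>e. {Link e}) ` parcs G \<union> (\<lambda>e. Arrival ` feeders (parcs G) e) ` parcs G"

lemma finite_watched: "finite watched"
proof -
  interpret pair_fin_digraph G by (rule pair_fin)
  show ?thesis by (simp add: watched_def)
qed

text \<open>The count on an interval is a difference of two prefix counts, hence the tolerance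
  \<open>d / 2\<close> for prefixes.\<close>

lemma typical_word:
  assumes typical: "\<not> off_mean watched (d / 2) w" and L: "L \<in> watched" and ij: "i \<le> j" "j \<le> length w"
  shows "\<bar>real (letters_in L (take j w)) - real (letters_in L (take i w)) - (\<Sum>a\<in>A \<inter> L. p a) * (real j - real i)\<bar> \<le> d"
proof -
  have "\<bar>dev L (take n w)\<bar> \<le> d / 2" if "n \<le> length w" for n
    using typical L that by (force simp: off_mean_def)
  from this[of i] this[of j] ij
  have *: "\<bar>dev L (take i w)\<bar> \<le> d / 2" "\<bar>dev L (take j w)\<bar> \<le> d / 2" by auto
  have "real (letters_in L (take j w)) - real (letters_in L (take i w)) - (\<Sum>a\<in>A \<inter> L. p a) * (real j - real i)
      = dev L (take j w) - dev L (take i w)"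
    using ij by (simp add: dev_def letters_in_def algebra_simps)
  then show ?thesis using * by linarith
qed

text \<open>With \<open>K\<close> packets at the start, on a typical word everything that arrived up
  to event \<open>s0\<close> has left by event \<open>N\<close>, and
  \<open>N - s0 \<le> K / 4\<close>. An atypical word leaves at most \<open>(1 + C) * K\<close>
  packets but has probability at most \<open>M / K\<close>, which contributes at most another
  \<open>K / 4\<close> once \<open>K\<close> is large.\<close>

lemma drift:
  obtains k C where "0 \<le> C" "\<And>x. x \<in> reachable G arr \<Longrightarrow> k < length x \<Longrightarrow>
    \<exists>N>0. real N \<le> C * real (length x) \<and>
      mean N (\<lambda>w. real (length (fold (transition G) w x))) \<le> real (length x) / 2"
proof -
  interpret pair_fin_digraph G by (rule pair_fin)
  obtain r cmin where r: "0 < r" "r < 1" and cmin: "0 < cmin" "cmin \<le> 1"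
    and load_r: "\<And>e. e \<in> parcs G \<Longrightarrow> (\<Sum>a\<in>A \<inter> Arrival ` feeders (parcs G) e. p a) \<le> r * p (Link e)"
    and cmin_le: "\<And>e. e \<in> parcs G \<Longrightarrow> cmin \<le> p (Link e)"
    using rate_ratio by metis
  define H where "H = card (parcs G)"
  define \<alpha> where "\<alpha> = (1 + r) / 2"
  have \<alpha>: "r < \<alpha>" "\<alpha> < 1" "0 < \<alpha>" using r by (auto simp: \<alpha>_def)
  define \<gamma> where "\<gamma> = 1 - r / \<alpha>"
  have \<gamma>: "0 < \<gamma>" using \<alpha> r by (simp add: \<gamma>_def)
  define \<theta> where "\<theta> = \<gamma> ^ H"
  have \<theta>: "0 < \<theta>" using \<gamma> by (simp add: \<theta>_def)
  \<comment> \<open>The fluctuations \<open>d = \<epsilon> * K\<close>, summed over \<open>H\<close>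
    hops, must stay below \<open>\<theta> * K / 8\<close>, which is what \<open>H\<close>
    contractions leave of a delay of \<open>K / 8\<close>.\<close>
  define \<epsilon> where "\<epsilon> = min 1 (\<theta> * cmin / (64 * (real H + 1)))"
  have \<epsilon>: "0 < \<epsilon>" "\<epsilon> \<le> 1" using \<theta> cmin by (auto simp: \<epsilon>_def)
  have \<epsilon>H: "real H * (2 * \<epsilon>) / cmin \<le> \<theta> / 32"
  proof -
    have "\<epsilon> \<le> \<theta> * cmin / (64 * (real H + 1))" by (simp add: \<epsilon>_def)
    then have "\<epsilon> * (64 * (real H + 1)) \<le> \<theta> * cmin" by (simp add: pos_le_divide_eq)
    then have "\<epsilon> * 64 * real H \<le> \<theta> * cmin" using \<epsilon> by (simp add: algebra_simps)
    then show ?thesis using cmin by (simp add: pos_divide_le_eq algebra_simps)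
  qed
  \<comment> \<open>This makes \<open>\<beta> = b * K\<close> large enough for \<open>start\<close>:
    the 5 comes from \<open>2 + 2 * d + K \<le> 5 * K\<close>, and the summand 1 makes the
    inequality strict.\<close>
  define b where "b = real H * 5 / (cmin * \<theta> * \<alpha>) + 1"
  have b: "1 \<le> b" using cmin \<theta> \<alpha> by (simp add: b_def)
  define C where "C = b / (1 - \<alpha>) + 1"
  have C: "1 \<le> C" using b \<alpha> by (simp add: C_def)
  \<comment> \<open>Chosen so that \<open>mean_off_mean\<close> bounds the probability of an
    atypical word by \<open>M / K\<close>; the factor 16 stems from the tolerance
    \<open>d / 2\<close>.\<close>
  define M where "M = real (card watched) * 6 * C ^ 3 * 16 / \<epsilon> ^ 4"
  have M: "0 \<le> M" using C \<epsilon> by (simp add: M_def)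
  define k where "k = nat \<lceil>max 32 (max (64 * real H / (cmin * \<theta>)) (4 * (1 + C) * M))\<rceil>"
  show thesis
  proof (rule that[of C k])
    show "0 \<le> C" using C by simp
    fix x assume x: "x \<in> reachable G arr" and kx: "k < length x"
    define K where "K = real (length x)"
    have "max 32 (max (64 * real H / (cmin * \<theta>)) (4 * (1 + C) * M)) \<le> real k"
      unfolding k_def by linarith
    then have K: "32 \<le> K" "64 * real H / (cmin * \<theta>) \<le> K" "4 * (1 + C) * M \<le> K"
      using kx by (auto simp: K_def)
    define d where "d = \<epsilon> * K"
    have d: "0 < d" "d \<le> K" using \<epsilon> K by (auto simp: d_def mult_le_cancel_right1)
    define \<beta> where "\<beta> = b * K"
    have \<beta>: "0 < \<beta>" "K \<le> \<beta>" using b K by (auto simp: \<beta>_def mult_le_cancel_right1)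
    define \<eta> where "\<eta> = (2 + 2 * d) / cmin"
    have start: "real H * (\<eta> + K / cmin) < \<theta> * (\<alpha> * \<beta>)"
    proof -
      have "real H * (\<eta> + K / cmin) = real H * (2 + 2 * d + K) / cmin"
        by (simp add: \<eta>_def add_divide_distrib distrib_left)
      also have "\<dots> \<le> real H * (5 * K) / cmin"
        using d K cmin by (intro divide_right_mono mult_left_mono) auto
      also have "\<dots> = \<theta> * (\<alpha> * ((b - 1) * K))"
        using cmin \<theta> \<alpha> by (simp add: b_def field_simps)
      also have "\<dots> < \<theta> * (\<alpha> * \<beta>)"
        using \<theta> \<alpha> K by (simp add: \<beta>_def)
      finally show ?thesis .
    qed
    have H\<eta>: "real H * \<eta> < \<theta> * (K / 8)"
    proof -
      have "real H * \<eta> = 2 * real H / cmin + (real H * (2 * \<epsilon>) / cmin) * K"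
        using cmin by (simp add: \<eta>_def d_def field_simps)
      also have "(real H * (2 * \<epsilon>) / cmin) * K \<le> \<theta> / 32 * K"
        using \<epsilon>H K by (intro mult_right_mono) auto
      also have "2 * real H / cmin \<le> \<theta> * K / 32"
        using K(2) cmin \<theta> by (simp add: field_simps)
      finally have "real H * \<eta> \<le> \<theta> * K / 32 + \<theta> / 32 * K" by simp
      also have "\<dots> = \<theta> * K / 16" by simp
      finally show ?thesis using mult_pos_pos[OF \<theta>, of K] K by linarith
    qed
    \<comment> \<open>The event at which the granted delay has shrunk to about \<open>K / 8\<close>,
      a level that \<open>stop\<close> still tolerates.\<close>
    define s0 where "s0 = nat \<lfloor>(\<beta> - K / 8) / (1 - \<alpha>)\<rfloor>"
    have "0 \<le> (\<beta> - K / 8) / (1 - \<alpha>)" using \<beta> \<alpha> K by simp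
    then have s0: "real s0 \<le> (\<beta> - K / 8) / (1 - \<alpha>)" "(\<beta> - K / 8) / (1 - \<alpha>) < real s0 + 1"
      unfolding s0_def by linarith+
    then have gap: "K / 8 \<le> \<beta> - (1 - \<alpha>) * real s0" "\<beta> - (1 - \<alpha>) * real s0 < K / 8 + 1"
      using \<alpha> by (auto simp: pos_le_divide_eq pos_divide_less_eq algebra_simps)
    have stop: "real H * \<eta> < \<theta> * (\<beta> - (1 - \<alpha>) * real s0)"
      using H\<eta> mult_left_mono[OF gap(1), of \<theta>] \<theta> by linarith
    define N where "N = nat \<lceil>\<beta> + \<alpha> * real s0\<rceil>"
    have fN: "\<beta> + \<alpha> * real s0 \<le> real N" "real N < \<beta> + \<alpha> * real s0 + 1"
      using \<beta> \<alpha> unfolding N_def by (auto intro!: add_nonneg_nonneg)  linarith+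
    have Ns: "real N - real s0 \<le> K / 4" "s0 \<le> N"
    proof -
      show "real N - real s0 \<le> K / 4" using fN gap K by (simp add: algebra_simps)
      have "real s0 \<le> real N" using fN gap K by (simp add: algebra_simps)
      then show "s0 \<le> N" by simp
    qed
    have NC: "real N \<le> C * K"
    proof -
      have "real s0 \<le> \<beta> / (1 - \<alpha>)"
        using s0(1) \<alpha> K by (elim order_trans) (simp add: divide_right_mono)
      then have "real N \<le> b * K / (1 - \<alpha>) + K / 4" using Ns by (simp add: \<beta>_def)
      then show ?thesis using K by (simp add: C_def algebra_simps)
    qed
    have N0: "0 < N" using fN \<beta> \<alpha> by (metis add_pos_nonneg less_le_trans less_imp_le mult_nonneg_nonneg of_nat_0_le_iff of_nat_0_less_iff)
    have long: "real (length (fold (transition G) w x)) \<le> K / 4 + (1 + C) * K * of_bool (off_mean watched (d / 2) w)"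
      if w: "set w \<subseteq> A" "length w = N" for w
    proof -
      have eq: "fold (transition G) w x = depart G (fold evolve w x)"
        by (rule fold_transition_reachable[OF x w(1)])
      show ?thesis
      proof (cases "off_mean watched (d / 2) w")
        case True
        have "length (fold (transition G) w x) \<le> length (fold evolve w x)"
          unfolding eq by (simp add: depart_def)
        also have "\<dots> \<le> length x + N" using length_fold_evolve_le[of w x] w by simp
        finally have "real (length (fold (transition G) w x)) \<le> K + real N" by (simp add: K_def)
        then show ?thesis using True NC K by (simp add: algebra_simps)
      next
        case False
        define j where "j = length (fold evolve (take s0 w) x)"
        have wn: "set w \<subseteq> net_clocks G" using w clocks_subset by auto
        have Lp: "(\<Sum>a\<in>A \<inter> {Link e}. p a) = p (Link e)" if "e \<in> parcs G" for e
        proof -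
          have "A \<inter> {Link e} = {Link e}" using that by (auto simp: clocks_def)
          then show ?thesis by simp
        qed
        have "hop_complete (parcs G) H (take j (fold evolve (take N w) x))"
          unfolding j_def H_def
        proof (rule fluid_bound[where pc = "\<lambda>e. p (Link e)" and pr = "\<lambda>e. \<Sum>a\<in>A \<inter> Arrival ` feeders (parcs G) e. p a"
              and K = K and d = d and cmin = cmin and r = r and \<alpha> = \<alpha> and \<beta> = \<beta> and ?s0.0 = s0 and s = s0 and n = N])
          show "p (Link e) * (real j - real i) - d \<le> real (letters_in {Link e} (take j w)) - real (letters_in {Link e} (take i w))"
            if "e \<in> parcs G" "i \<le> j" "j \<le> length w" for e i j
            using typical_word[OF False, of "{Link e}" i j] that Lp[OF that(1)] by (simp add: watched_def)
          show "real (letters_in (Arrival ` feeders (parcs G) e) (take j w))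
              - real (letters_in (Arrival ` feeders (parcs G) e) (take i w))
              \<le> (\<Sum>a\<in>A \<inter> Arrival ` feeders (parcs G) e. p a) * (real j - real i) + d"
            if "e \<in> parcs G" "i \<le> j" "j \<le> length w" for e i j
            using typical_word[OF False, of "Arrival ` feeders (parcs G) e" i j] that by (simp add: watched_def)
          show "0 \<le> (\<Sum>a\<in>A \<inter> Arrival ` feeders (parcs G) e. p a) \<and>
              (\<Sum>a\<in>A \<inter> Arrival ` feeders (parcs G) e. p a) \<le> r * p (Link e) \<and>
              (\<Sum>a\<in>A \<inter> Arrival ` feeders (parcs G) e. p a) \<le> 1 \<and> p (Link e) \<le> 1 \<and> cmin \<le> p (Link e)"
            if "e \<in> parcs G" for e
            using prob_le_1[of "Arrival ` feeders (parcs G) e"] prob_le_1[of "{Link e}"] Lp[OF that] load_r[OF that] cmin_le[OF that]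
            by simp
        qed (use pair_fin wn reachable_wf[OF x] start stop w fN cmin d r \<alpha> \<beta> in
              \<open>simp_all add: K_def H_def \<eta>_def \<theta>_def \<gamma>_def\<close>)
        then have "depart G (take j (fold evolve w x)) = []"
          using w by (intro departs[OF x w(1)]) (simp add: H_def)
        moreover have "fold evolve w x = take j (fold evolve w x) @ drop j (fold evolve w x)" by simp
        ultimately have "fold (transition G) w x = depart G (drop j (fold evolve w x))"
          unfolding eq by (metis append_Nil depart_append)
        then have "length (fold (transition G) w x) \<le> length (fold evolve w x) - j"
          by (simp add: depart_def) (metis length_drop length_filter_le)
        also have "fold evolve w x = fold evolve (drop s0 w) (fold evolve (take s0 w) x)"
          by (metis append_take_drop_id comp_apply fold_append)
        also have "length \<dots> - j \<le> N - s0"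
          using length_fold_evolve_le[of "drop s0 w" "fold evolve (take s0 w) x"] w by (simp add: j_def)
        finally have "real (length (fold (transition G) w x)) \<le> real N - real s0" using Ns by linarith
        then show ?thesis using Ns False by simp
      qed
    qed
    have "mean N (\<lambda>w. real (length (fold (transition G) w x)))
        \<le> mean N (\<lambda>w. K / 4 + (1 + C) * K * of_bool (off_mean watched (d / 2) w))"
      by (intro mean_mono long)
    also have "\<dots> = K / 4 + (1 + C) * K * mean N (\<lambda>w. of_bool (off_mean watched (d / 2) w))"
      unfolding mean_add mean_cmult mean_const ..
    also have "mean N (\<lambda>w. of_bool (off_mean watched (d / 2) w)) \<le> M / K"
    proof -
      have "mean N (\<lambda>w. of_bool (off_mean watched (d / 2) w))
          \<le> real (card watched) * (real N + 1) * (3 * real N ^ 2) / (d / 2) ^ 4"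
        using d by (intro mean_off_mean finite_watched) simp
      also have "\<dots> \<le> real (card watched) * (2 * (C * K)) * (3 * (C * K) ^ 2) / (d / 2) ^ 4"
      proof -
        have "1 \<le> C * K" using C K by (metis mult_mono' mult_1 order_trans zero_le_one one_le_numeral)
        then have "real N + 1 \<le> 2 * (C * K)" using NC by simp
        then show ?thesis using NC by (intro divide_right_mono mult_mono power_mono) auto
      qed
      also have "\<dots> = M / K"
        using K \<epsilon> by (simp add: M_def d_def power2_eq_square power3_eq_cube power4_eq_xxxx field_simps)
      finally show ?thesis .
    qed
    then have "(1 + C) * K * mean N (\<lambda>w. of_bool (off_mean watched (d / 2) w)) \<le> (1 + C) * K * (M / K)"
      using C K by (intro mult_left_mono) auto
    also have "(1 + C) * K * (M / K) = 4 * (1 + C) * M / 4" using K by simp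
    also have "\<dots> \<le> K / 4" using K(3) by simp
    finally show "\<exists>N>0. real N \<le> C * real (length x) \<and>
        mean N (\<lambda>w. real (length (fold (transition G) w x))) \<le> real (length x) / 2"
      using N0 NC by (intro exI[of _ N]) (simp add: K_def)
  qed
qed

end

section \<open>Poisson clocks\<close>

lemma sets_poisson_gaps [measurable_cong]: "sets (poisson_gaps r) = sets (\<Pi>\<^sub>M n\<in>UNIV. borel)"
  unfolding poisson_gaps_def by (intro sets_PiM_cong) auto

lemma space_poisson_gaps [simp]: "space (poisson_gaps r) = UNIV"
  by (simp add: poisson_gaps_def space_PiM PiE_def)

lemma measurable_update_0:
  "(\<lambda>\<eta>::nat \<Rightarrow> real. \<eta>(0 := \<eta> 0 - t)) \<in> (\<Pi>\<^sub>M n\<in>UNIV. borel) \<rightarrow>\<^sub>M (\<Pi>\<^sub>M n\<in>UNIV. borel)"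
proof -
  have "(\<lambda>\<eta> n. if n = 0 then \<eta> 0 - t else \<eta> n) \<in> (\<Pi>\<^sub>M n\<in>UNIV. borel) \<rightarrow>\<^sub>M (\<Pi>\<^sub>M n\<in>UNIV. borel :: real measure)"
    by (rule measurable_abs_UNIV) measurable
  also have "(\<lambda>\<eta> n. if n = 0 then \<eta> 0 - t else \<eta> n) = (\<lambda>\<eta>::nat \<Rightarrow> real. \<eta>(0 := \<eta> 0 - t))"
    by (simp add: fun_eq_iff)
  finally show ?thesis .
qed

context
  fixes r :: real
  assumes r: "0 < r"
begin

lemma prob_space_poisson_gaps: "prob_space (poisson_gaps r)"
  unfolding poisson_gaps_def
  by (intro prob_space_PiM prob_space_exponential_density r)

interpretation E: prob_space "density lborel (exponential_density r)"
  by (rule prob_space_exponential_density[OF r])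

interpretation sequence_space "density lborel (exponential_density r)"
  by unfold_locales

interpretation PG: prob_space "poisson_gaps r" by (rule prob_space_poisson_gaps)

lemma poisson_gaps_distr:
  "poisson_gaps r = distr (density lborel (exponential_density r) \<Otimes>\<^sub>M poisson_gaps r) (poisson_gaps r) (\<lambda>(s, \<eta>). case_nat s \<eta>)"
  using PiM_iter by (simp add: poisson_gaps_def)

lemma nn_integral_poisson_gaps:
  assumes [measurable]: "f \<in> borel_measurable (\<Pi>\<^sub>M n\<in>UNIV. borel)"
  shows "(\<integral>\<^sup>+\<eta>. f \<eta> \<partial>poisson_gaps r) = (\<integral>\<^sup>+s. \<integral>\<^sup>+\<eta>. f (case_nat s \<eta>) \<partial>poisson_gaps r \<partial>density lborel (exponential_density r))"
proof -
  have "(\<integral>\<^sup>+\<eta>. f \<eta> \<partial>poisson_gaps r)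
      = (\<integral>\<^sup>+x. f (case x of (s, \<eta>) \<Rightarrow> case_nat s \<eta>) \<partial>(density lborel (exponential_density r) \<Otimes>\<^sub>M poisson_gaps r))"
    by (subst poisson_gaps_distr, subst nn_integral_distr) (auto, measurable)
  also have "\<dots> = (\<integral>\<^sup>+s. \<integral>\<^sup>+\<eta>. f (case_nat s \<eta>) \<partial>poisson_gaps r \<partial>density lborel (exponential_density r))"
    by (subst PG.nn_integral_fst[symmetric]) (auto, measurable)
  finally show ?thesis .
qed

lemma nn_integral_poisson_gaps_rev:
  assumes [measurable]: "f \<in> borel_measurable (\<Pi>\<^sub>M n\<in>UNIV. borel)"
  shows "(\<integral>\<^sup>+\<eta>. f \<eta> \<partial>poisson_gaps r) = (\<integral>\<^sup>+\<eta>. \<integral>\<^sup>+s. f (case_nat s \<eta>) \<partial>density lborel (exponential_density r) \<partial>poisson_gaps r)"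
proof -
  interpret pair_sigma_finite "poisson_gaps r" "density lborel (exponential_density r)" ..
  show ?thesis
    unfolding nn_integral_poisson_gaps[OF assms]
    by (rule Fubini') measurable
qed

text \<open>Memorylessness in integral form: once the first gap is split off, the claim is a
  translation of the exponential density by \<open>t\<close>.\<close>

lemma nn_integral_gaps_memoryless:
  assumes [measurable]: "f \<in> borel_measurable (\<Pi>\<^sub>M n\<in>UNIV. borel)" and t: "0 \<le> t"
  shows "(\<integral>\<^sup>+\<eta>. indicator {t<..} (\<eta> 0) * f (\<eta>(0 := \<eta> 0 - t)) \<partial>poisson_gaps r)
    = ennreal (exp (- r * t)) * (\<integral>\<^sup>+\<eta>. f \<eta> \<partial>poisson_gaps r)"
proof -
  define g where "g s = (\<integral>\<^sup>+\<eta>. f (case_nat s \<eta>) \<partial>poisson_gaps r)" for s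
  have g [measurable]: "g \<in> borel_measurable borel" unfolding g_def by measurable
  have upd [measurable]: "(\<lambda>\<eta>::nat \<Rightarrow> real. \<eta>(0 := \<eta> 0 - t)) \<in> (\<Pi>\<^sub>M n\<in>UNIV. borel) \<rightarrow>\<^sub>M (\<Pi>\<^sub>M n\<in>UNIV. borel)"
    by (rule measurable_update_0)
  have case_upd: "(case_nat s \<eta>)(0 := s - t) = case_nat (s - t) \<eta>" for s and \<eta> :: "nat \<Rightarrow> real"
    by (auto simp: fun_eq_iff split: nat.split)
  have "(\<integral>\<^sup>+\<eta>. indicator {t<..} (\<eta> 0) * f (\<eta>(0 := \<eta> 0 - t)) \<partial>poisson_gaps r)
      = (\<integral>\<^sup>+s. \<integral>\<^sup>+\<eta>. indicator {t<..} s * f (case_nat (s - t) \<eta>) \<partial>poisson_gaps r \<partial>density lborel (exponential_density r))"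
    by (subst nn_integral_poisson_gaps) (measurable, simp add: case_upd)
  also have "\<dots> = (\<integral>\<^sup>+s. indicator {t<..} s * g (s - t) \<partial>density lborel (exponential_density r))"
    unfolding g_def by (intro nn_integral_cong nn_integral_cmult) measurable
  also have "\<dots> = (\<integral>\<^sup>+s. ennreal (exponential_density r s) * (indicator {t<..} s * g (s - t)) \<partial>lborel)"
    by (subst nn_integral_density) (auto simp: exponential_density_nonneg r)
  also have "\<dots> = (\<integral>\<^sup>+s. ennreal (exponential_density r (t + s)) * (indicator {t<..} (t + s) * g s) \<partial>lborel)"
    by (subst nn_integral_real_affine[where c = 1 and t = t]) auto
  also have "\<dots> = (\<integral>\<^sup>+s. ennreal (exp (- r * t)) * (ennreal (exponential_density r s) * g s) \<partial>lborel)"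
  proof (rule nn_integral_cong_AE)
    \<comment> \<open>At \<open>s = 0\<close> the two sides differ, because the indicator is strict
      while the density is positive there; one point is negligible.\<close>
    show "AE s in lborel. ennreal (exponential_density r (t + s)) * (indicator {t<..} (t + s) * g s)
        = ennreal (exp (- r * t)) * (ennreal (exponential_density r s) * g s)"
      using AE_lborel_singleton[of 0]
    proof eventually_elim
      case (elim s)
      show ?case
      proof (cases "0 < s")
        case True
        then have "exponential_density r (t + s) = exp (- r * t) * exponential_density r s"
          using t by (simp add: exponential_density_def algebra_simps flip: exp_add)
        then show ?thesis using True r by (simp add: ennreal_mult' exponential_density_nonneg mult_ac)
      next
        case False
        then show ?thesis using elim by (simp add: exponential_density_def)
      qed
    qed
  qed
  also have "\<dots> = ennreal (exp (- r * t)) * (\<integral>\<^sup>+s. ennreal (exponential_density r s) * g s \<partial>lborel)"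
    by (rule nn_integral_cmult) measurable
  also have "(\<integral>\<^sup>+s. ennreal (exponential_density r s) * g s \<partial>lborel) = (\<integral>\<^sup>+s. g s \<partial>density lborel (exponential_density r))"
    by (subst nn_integral_density) (auto simp: exponential_density_nonneg r)
  also have "\<dots> = (\<integral>\<^sup>+\<eta>. f \<eta> \<partial>poisson_gaps r)"
    unfolding g_def by (rule nn_integral_poisson_gaps[symmetric]) measurable
  finally show ?thesis .
qed

lemma AE_gaps_pos: "AE \<eta> in poisson_gaps r. \<forall>i. 0 < \<eta> i"
proof -
  have "AE s in lborel. 0 < ennreal (exponential_density r s) \<longrightarrow> 0 < s"
    using AE_lborel_singleton[of 0] by eventually_elim (auto simp: exponential_density_def)
  then have "AE s in density lborel (exponential_density r). 0 < s"
    by (subst AE_density) auto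
  then have "AE \<eta> in poisson_gaps r. 0 < \<eta> i" for i
    unfolding poisson_gaps_def by (intro AE_component) auto
  then show ?thesis by (simp add: AE_all_countable)
qed

lemma emeasure_first_gap_le: "emeasure (density lborel (exponential_density r)) {..t} < 1"
proof -
  let ?E = "density lborel (exponential_density r)"
  have "distributed ?E lborel (\<lambda>x. x) (exponential_density r)"
    by (simp add: distributed_def) (intro distr_id2, simp)
  then have "measure ?E {x \<in> space ?E. x \<le> max 0 t} = 1 - exp (- max 0 t * r)"
    by (intro E.exponential_distributedD_le) (auto simp: r)
  moreover have "measure ?E {..t} \<le> measure ?E {x \<in> space ?E. x \<le> max 0 t}"
    by (intro E.finite_measure_mono) auto
  moreover have "0 < exp (- max 0 t * r)" by simp
  ultimately have "measure ?E {..t} < 1" by linarith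
  then show ?thesis by (simp add: E.emeasure_eq_measure)
qed

text \<open>Splitting off the first gap shows that the probability that all gaps are at most
  \<open>k\<close> equals itself times a factor below 1, so it is 0. This rules out infinitely many
  epochs in bounded time.\<close>

lemma AE_gaps_unbounded: "AE \<eta> in poisson_gaps r. \<forall>k::nat. \<exists>i. real k < \<eta> i"
proof -
  have "AE \<eta> in poisson_gaps r. \<exists>i. real k < \<eta> i" for k :: nat
  proof -
    define N where "N = {\<eta> :: nat \<Rightarrow> real. \<forall>i. \<eta> i \<le> real k}"
    have N [measurable]: "N \<in> sets (\<Pi>\<^sub>M n\<in>UNIV. borel)"
    proof -
      have "{\<eta> \<in> space (\<Pi>\<^sub>M n\<in>UNIV. borel). \<forall>i::nat. \<eta> i \<le> real k} \<in> sets (\<Pi>\<^sub>M n\<in>UNIV. borel)" by measurable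
      then show ?thesis by (simp add: N_def space_PiM PiE_def)
    qed
    have ind: "indicator N (case_nat s \<eta>) = (indicator {..real k} s * indicator N \<eta> :: ennreal)" for s \<eta>
    proof -
      have "(\<forall>i. case_nat s \<eta> i \<le> real k) \<longleftrightarrow> s \<le> real k \<and> (\<forall>i. \<eta> i \<le> real k)"
        by (metis nat.exhaust old.nat.simps(4,5))
      then show ?thesis by (auto simp: N_def indicator_def)
    qed
    have "emeasure (poisson_gaps r) N = (\<integral>\<^sup>+\<eta>. indicator N \<eta> \<partial>poisson_gaps r)" by simp
    also have "\<dots> = (\<integral>\<^sup>+s. \<integral>\<^sup>+\<eta>. indicator {..real k} s * indicator N \<eta> \<partial>poisson_gaps r \<partial>density lborel (exponential_density r))"
      by (subst nn_integral_poisson_gaps) (measurable, simp add: ind)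
    also have "\<dots> = (\<integral>\<^sup>+s. emeasure (poisson_gaps r) N * indicator {..real k} s \<partial>density lborel (exponential_density r))"
      by (intro nn_integral_cong, subst nn_integral_cmult) (auto simp: mult.commute)
    also have "\<dots> = emeasure (poisson_gaps r) N * emeasure (density lborel (exponential_density r)) {..real k}"
      by (subst nn_integral_cmult) auto
    finally have eq: "emeasure (poisson_gaps r) N = emeasure (poisson_gaps r) N * emeasure (density lborel (exponential_density r)) {..real k}" .
    have "PG.prob N = PG.prob N * E.prob {..real k}"
      using eq by (simp add: PG.emeasure_eq_measure E.emeasure_eq_measure flip: ennreal_mult)
    moreover have "E.prob {..real k} < 1"
      using emeasure_first_gap_le[of "real k"] by (simp add: E.emeasure_eq_measure)
    ultimately have "PG.prob N = 0" by (metis less_irrefl mult_cancel_left2)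
    then have "emeasure (poisson_gaps r) N = 0" by (simp add: PG.emeasure_eq_measure)
    then show ?thesis
    proof (rule AE_I[rotated])
      show "{\<eta> \<in> space (poisson_gaps r). \<not> (\<exists>i. real k < \<eta> i)} \<subseteq> N" by (auto simp: N_def not_less)
      show "N \<in> sets (poisson_gaps r)" using N by (simp add: sets_poisson_gaps)
    qed
  qed
  then show ?thesis by (simp add: AE_all_countable)
qed

text \<open>Given all later gaps, the first gap would have to take one prescribed value, and its law
  has no atoms.\<close>

lemma nn_integral_epoch_eq: "(\<integral>\<^sup>+\<eta>. indicator {x} (\<Sum>i\<le>n. \<eta> i) \<partial>poisson_gaps r) = 0"
proof -
  have "(\<integral>\<^sup>+\<eta>. indicator {x} (\<Sum>i\<le>n. \<eta> i) \<partial>poisson_gaps r)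
      = (\<integral>\<^sup>+\<eta>. \<integral>\<^sup>+s. indicator {x} (\<Sum>i\<le>n. case_nat s \<eta> i) \<partial>density lborel (exponential_density r) \<partial>poisson_gaps r)"
    by (rule nn_integral_poisson_gaps_rev) measurable
  also have "\<dots> = (\<integral>\<^sup>+\<eta>. 0 \<partial>poisson_gaps r)"
  proof (intro nn_integral_cong)
    fix \<eta> :: "nat \<Rightarrow> real"
    have "(\<Sum>i\<le>n. case_nat s \<eta> i) = s + (\<Sum>i<n. \<eta> i)" for s
      by (subst sum.atMost_shift) simp
    then have "(\<integral>\<^sup>+s. indicator {x} (\<Sum>i\<le>n. case_nat s \<eta> i) \<partial>density lborel (exponential_density r))
        = (\<integral>\<^sup>+s. indicator {x - (\<Sum>i<n. \<eta> i)} s \<partial>density lborel (exponential_density r))"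
      by (intro nn_integral_cong) (auto simp: indicator_def)
    also have "\<dots> = emeasure (density lborel (exponential_density r)) {x - (\<Sum>i<n. \<eta> i)}"
      by (simp del: emeasure_density)
    also have "\<dots> = 0"
    proof -
      have "AE s in lborel. s \<noteq> x - (\<Sum>i<n. \<eta> i)" by (rule AE_lborel_singleton)
      then have "AE s in density lborel (exponential_density r). s \<noteq> x - (\<Sum>i<n. \<eta> i)"
        by (subst AE_density) (auto elim: eventually_mono)
      then show ?thesis by (subst (asm) AE_iff_measurable[OF _ refl]) (auto)
    qed
    finally show "(\<integral>\<^sup>+s. indicator {x} (\<Sum>i\<le>n. case_nat s \<eta> i) \<partial>density lborel (exponential_density r)) = 0" .
  qed
  finally show ?thesis by simp
qed

end

section \<open>Independent Poisson clocks and the restart at their first epoch\<close>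

locale poisson_clocks =
  fixes A :: "'v clock set" and rate :: "'v clock \<Rightarrow> real"
  assumes finite_A: "finite A" and nonempty_A: "A \<noteq> {}" and rate: "\<And>a. 0 < rate a"
begin

abbreviation "M \<equiv> \<Pi>\<^sub>M a\<in>A. poisson_gaps (rate a)"

sublocale product_prob_space "\<lambda>a. poisson_gaps (rate a)" A
  by (intro product_prob_spaceI prob_space_poisson_gaps rate)

lemma sets_M [measurable_cong]: "sets M = sets (\<Pi>\<^sub>M a\<in>A. \<Pi>\<^sub>M n\<in>UNIV. borel)"
  by (intro sets_PiM_cong sets_poisson_gaps) auto

lemma measurable_gap: "a \<in> A \<Longrightarrow> (\<lambda>\<omega>. \<omega> a i) \<in> borel_measurable M"
proof -
  assume a: "a \<in> A"
  have "(\<lambda>\<omega>. \<omega> a) \<in> M \<rightarrow>\<^sub>M (\<Pi>\<^sub>M n\<in>UNIV. borel)"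
    using measurable_component_singleton[OF a, of "\<lambda>a. poisson_gaps (rate a)"]
    by (simp cong: measurable_cong_sets add: sets_poisson_gaps)
  then show ?thesis
    using measurable_compose[OF _ measurable_component_singleton[of i UNIV "\<lambda>_. borel"]] by simp
qed

definition is_first :: "'v clock \<Rightarrow> ('v clock \<Rightarrow> nat \<Rightarrow> real) \<Rightarrow> bool" where
  "is_first a \<omega> \<longleftrightarrow> (\<forall>b\<in>A - {a}. \<omega> a 0 < \<omega> b 0)"

text \<open>The clocks as seen from the first epoch: the clock that rang drops its used gap, the
  others lose the time elapsed. The restriction to \<open>A\<close> keeps the result in the space of
  \<open>M\<close>.\<close>

definition shift :: "'v clock \<Rightarrow> ('v clock \<Rightarrow> nat \<Rightarrow> real) \<Rightarrow> 'v clock \<Rightarrow> nat \<Rightarrow> real" where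
  "shift a \<omega> = (\<lambda>b\<in>A. if b = a then (\<lambda>i. \<omega> a (Suc i)) else (\<omega> b)(0 := \<omega> b 0 - \<omega> a 0))"

lemma measurable_is_first: "a \<in> A \<Longrightarrow> {\<omega> \<in> space M. is_first a \<omega>} \<in> sets M"
  unfolding is_first_def using finite_A
  by (intro sets.sets_Collect_finite_All borel_measurable_less measurable_gap) auto

lemma measurable_indicator_first:
  assumes "a \<in> A"
  shows "(indicator {\<omega>. is_first a \<omega>} :: _ \<Rightarrow> ennreal) \<in> borel_measurable M"
proof (subst borel_measurable_indicator_iff)
  have "{\<omega>. is_first a \<omega>} \<inter> space M = {\<omega> \<in> space M. is_first a \<omega>}" by auto
  then show "{\<omega>. is_first a \<omega>} \<inter> space M \<in> sets M" using measurable_is_first[OF assms] by simp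
qed

lemma measurable_shift: "a \<in> A \<Longrightarrow> shift a \<in> M \<rightarrow>\<^sub>M M"
proof -
  assume a: "a \<in> A"
  have "(\<lambda>\<omega>. if b = a then (\<lambda>i. \<omega> a (Suc i)) else (\<omega> b)(0 := \<omega> b 0 - \<omega> a 0)) \<in> M \<rightarrow>\<^sub>M poisson_gaps (rate b)"
    if b: "b \<in> A" for b
  proof -
    have "(\<lambda>\<omega> n. if b = a then \<omega> a (Suc n) else if n = 0 then \<omega> b 0 - \<omega> a 0 else \<omega> b n) \<in> M \<rightarrow>\<^sub>M (\<Pi>\<^sub>M n\<in>UNIV. borel)"
    proof (rule measurable_abs_UNIV)
      fix n :: nat
      show "(\<lambda>\<omega>. if b = a then \<omega> a (Suc n) else if n = 0 then \<omega> b 0 - \<omega> a 0 else \<omega> b n) \<in> borel_measurable M"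
        using measurable_gap[OF a] measurable_gap[OF b]
        by (cases "b = a"; cases "n = 0") (simp_all add: borel_measurable_diff)
    qed
    also have "(\<lambda>\<omega> n. if b = a then \<omega> a (Suc n) else if n = 0 then \<omega> b 0 - \<omega> a 0 else \<omega> b n)
        = (\<lambda>\<omega>. if b = a then (\<lambda>i. \<omega> a (Suc i)) else (\<omega> b)(0 := \<omega> b 0 - \<omega> a 0))"
      by (auto simp: fun_eq_iff)
    finally show ?thesis by (simp cong: measurable_cong_sets add: sets_poisson_gaps)
  qed
  then show ?thesis unfolding shift_def by (rule measurable_restrict)
qed

definition "total_rate = (\<Sum>a\<in>A. rate a)"

lemma total_rate_pos: "0 < total_rate"
  unfolding total_rate_def using finite_A nonempty_A rate by (intro sum_pos) auto

text \<open>At the epoch of the first clock the other clocks are restarted, by memorylessness; which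
  clock it is does not depend on what happens afterwards.\<close>

lemma nn_integral_first_shift:
  assumes a: "a \<in> A" and f [measurable]: "f \<in> borel_measurable M"
  shows "(\<integral>\<^sup>+\<omega>. indicator {\<omega>. is_first a \<omega>} \<omega> * f (shift a \<omega>) \<partial>M) = ennreal (rate a / total_rate) * (\<integral>\<^sup>+\<omega>. f \<omega> \<partial>M)"
proof -
  define q where "q = rate a / total_rate"
  have q: "0 < q" using rate total_rate_pos by (simp add: q_def)
  \<comment> \<open>\<open>h\<close> is the density that conditions on \<open>a\<close> being first.
    It remains to see that the shifted clocks then have law \<open>M\<close> again, which is checked
    on boxes; \<open>1 / q\<close> proves to be the right normalisation when the last integral
    equals 1.\<close>
  define h where "h \<omega> = (ennreal (1 / q) * indicator {\<omega>. is_first a \<omega>} \<omega>)" for \<omega>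
  note measurable_indicator_first[OF a, measurable]
  have h [measurable]: "h \<in> borel_measurable M" unfolding h_def by measurable
  note measurable_shift[OF a, measurable]
  define A' where "A' = A - {a}"
  have A': "finite A'" "a \<notin> A'" "A = insert a A'" using a finite_A by (auto simp: A'_def)
  have eq: "distr (density M h) M (shift a) = M"
  proof (rule PiM_eqI)
    show "finite A" by (rule finite_A)
    fix X assume X: "\<And>b. b \<in> A \<Longrightarrow> X b \<in> sets (poisson_gaps (rate b))"
    have box [measurable]: "Pi\<^sub>E A X \<in> sets M" using X finite_A by (intro sets_PiM_I_finite) auto
    define F where "F b t \<eta> = (indicator {t<..} (\<eta> 0) * indicator (X b) (\<eta>(0 := \<eta> 0 - t)) :: ennreal)" for b t and \<eta> :: "nat \<Rightarrow> real"
    have F: "(\<integral>\<^sup>+\<eta>. F b t \<eta> \<partial>poisson_gaps (rate b)) = ennreal (exp (- rate b * t)) * emeasure (poisson_gaps (rate b)) (X b)"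
      if "b \<in> A" "0 \<le> t" for b t
      using nn_integral_gaps_memoryless[OF rate _ that(2), of "indicator (X b)" b] X[OF that(1)] unfolding F_def
      by (simp add: sets_poisson_gaps)
    have "emeasure (distr (density M h) M (shift a)) (Pi\<^sub>E A X)
        = (\<integral>\<^sup>+\<omega>. h \<omega> * indicator (Pi\<^sub>E A X) (shift a \<omega>) \<partial>M)"
      by (subst emeasure_distr, simp, simp, subst emeasure_density) (auto intro!: nn_integral_cong simp: indicator_def)
    also have "\<dots> = (\<integral>\<^sup>+\<eta>. \<integral>\<^sup>+x. h (x(a := \<eta>)) * indicator (Pi\<^sub>E A X) (shift a (x(a := \<eta>))) \<partial>PiM A' (\<lambda>b. poisson_gaps (rate b)) \<partial>poisson_gaps (rate a))"
      unfolding A'(3) using A'(1,2)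
      by (rule product_nn_integral_insert_rev) (simp flip: A'(3))
    also have "\<dots> = (\<integral>\<^sup>+\<eta>. \<integral>\<^sup>+x. ennreal (1 / q) * indicator (X a) (\<lambda>i. \<eta> (Suc i)) * (\<Prod>b\<in>A'. F b (\<eta> 0) (x b)) \<partial>PiM A' (\<lambda>b. poisson_gaps (rate b)) \<partial>poisson_gaps (rate a))"
    proof (intro nn_integral_cong)
      fix \<eta> :: "nat \<Rightarrow> real" and x
      have "(\<Prod>b\<in>A'. F b (\<eta> 0) (x b)) = (if \<forall>b\<in>A'. \<eta> 0 < x b 0 \<and> (x b)(0 := x b 0 - \<eta> 0) \<in> X b then 1 else 0)"
        using A'(1) by (auto simp: F_def indicator_def intro!: prod.neutral)
      moreover have "is_first a (x(a := \<eta>)) \<longleftrightarrow> (\<forall>b\<in>A'. \<eta> 0 < x b 0)"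
        unfolding is_first_def A'_def[symmetric] using A'(2) by auto
      moreover have "shift a (x(a := \<eta>)) \<in> Pi\<^sub>E A X \<longleftrightarrow> (\<lambda>i. \<eta> (Suc i)) \<in> X a \<and> (\<forall>b\<in>A'. (x b)(0 := x b 0 - \<eta> 0) \<in> X b)"
      proof -
        have "shift a (x(a := \<eta>)) \<in> Pi\<^sub>E A X \<longleftrightarrow>
            (\<forall>b\<in>A. (if b = a then (\<lambda>i. \<eta> (Suc i)) else (x b)(0 := x b 0 - \<eta> 0)) \<in> X b)"
          by (intro iffI; auto simp: shift_def PiE_iff)
        also have "\<dots> \<longleftrightarrow> (\<lambda>i. \<eta> (Suc i)) \<in> X a \<and> (\<forall>b\<in>A'. (x b)(0 := x b 0 - \<eta> 0) \<in> X b)"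
          using a unfolding A'_def by auto
        finally show ?thesis .
      qed
      ultimately show "h (x(a := \<eta>)) * indicator (Pi\<^sub>E A X) (shift a (x(a := \<eta>)))
          = ennreal (1 / q) * indicator (X a) (\<lambda>i. \<eta> (Suc i)) * (\<Prod>b\<in>A'. F b (\<eta> 0) (x b))"
        by (auto simp: h_def indicator_def)
    qed
    also have "\<dots> = (\<integral>\<^sup>+\<eta>. ennreal (1 / q) * indicator (X a) (\<lambda>i. \<eta> (Suc i)) * (\<Prod>b\<in>A'. ennreal (exp (- rate b * \<eta> 0)) * emeasure (poisson_gaps (rate b)) (X b)) \<partial>poisson_gaps (rate a))"
    proof (rule nn_integral_cong_AE)
      show "AE \<eta> in poisson_gaps (rate a).
        (\<integral>\<^sup>+x. ennreal (1 / q) * indicator (X a) (\<lambda>i. \<eta> (Suc i)) * (\<Prod>b\<in>A'. F b (\<eta> 0) (x b)) \<partial>PiM A' (\<lambda>b. poisson_gaps (rate b)))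
        = ennreal (1 / q) * indicator (X a) (\<lambda>i. \<eta> (Suc i)) * (\<Prod>b\<in>A'. ennreal (exp (- rate b * \<eta> 0)) * emeasure (poisson_gaps (rate b)) (X b))"
        using AE_gaps_pos[OF rate[of a]]
      proof eventually_elim
        case (elim \<eta>)
        have Fm: "F b (\<eta> 0) \<in> borel_measurable (poisson_gaps (rate b))" if "b \<in> A'" for b
        proof -
          have [measurable]: "X b \<in> sets (\<Pi>\<^sub>M n\<in>UNIV. borel)" using X that A' by (auto simp: sets_poisson_gaps)
          have [measurable]: "(\<lambda>\<zeta>::nat \<Rightarrow> real. \<zeta>(0 := \<zeta> 0 - \<eta> 0)) \<in> (\<Pi>\<^sub>M n\<in>UNIV. borel) \<rightarrow>\<^sub>M (\<Pi>\<^sub>M n\<in>UNIV. borel)"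
            by (rule measurable_update_0)
          show ?thesis unfolding F_def by measurable
        qed
        have "(\<integral>\<^sup>+x. (\<Prod>b\<in>A'. F b (\<eta> 0) (x b)) \<partial>PiM A' (\<lambda>b. poisson_gaps (rate b)))
            = (\<Prod>b\<in>A'. \<integral>\<^sup>+\<zeta>. F b (\<eta> 0) \<zeta> \<partial>poisson_gaps (rate b))"
          using A'(1) Fm by (rule product_nn_integral_prod)
        also have "\<dots> = (\<Prod>b\<in>A'. ennreal (exp (- rate b * \<eta> 0)) * emeasure (poisson_gaps (rate b)) (X b))"
          using elim A' by (intro prod.cong F refl) (auto simp: less_imp_le)
        finally have *: "(\<integral>\<^sup>+x. (\<Prod>b\<in>A'. F b (\<eta> 0) (x b)) \<partial>PiM A' (\<lambda>b. poisson_gaps (rate b)))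
            = (\<Prod>b\<in>A'. ennreal (exp (- rate b * \<eta> 0)) * emeasure (poisson_gaps (rate b)) (X b))" .
        show ?case
          unfolding *[symmetric]
          by (intro nn_integral_cmult borel_measurable_prod_ennreal measurable_compose[OF measurable_component_singleton] Fm)
      qed
    qed
    also have "\<dots> = (\<integral>\<^sup>+\<eta>. (ennreal (1 / q) * ennreal (exp (- (total_rate - rate a) * \<eta> 0)) * (\<Prod>b\<in>A'. emeasure (poisson_gaps (rate b)) (X b)))
        * indicator (X a) (\<lambda>i. \<eta> (Suc i)) \<partial>poisson_gaps (rate a))"
    proof (intro nn_integral_cong)
      fix \<eta> :: "nat \<Rightarrow> real"
      have "(\<Prod>b\<in>A'. ennreal (exp (- rate b * \<eta> 0))) = ennreal (exp (\<Sum>b\<in>A'. - rate b * \<eta> 0))"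
        using A'(1) by (simp add: prod_ennreal exp_sum)
      also have "(\<Sum>b\<in>A'. - rate b * \<eta> 0) = - (total_rate - rate a) * \<eta> 0"
      proof -
        have tr: "total_rate = rate a + (\<Sum>b\<in>A'. rate b)"
          unfolding total_rate_def A'_def using finite_A a by (rule sum.remove)
        have "(\<Sum>b\<in>A'. - rate b * \<eta> 0) = - (\<Sum>b\<in>A'. rate b) * \<eta> 0"
          by (simp only: sum_distrib_right[symmetric] sum_negf)
        then show ?thesis by (simp only: tr add_diff_cancel_left')
      qed
      finally show "ennreal (1 / q) * indicator (X a) (\<lambda>i. \<eta> (Suc i)) * (\<Prod>b\<in>A'. ennreal (exp (- rate b * \<eta> 0)) * emeasure (poisson_gaps (rate b)) (X b))
          = (ennreal (1 / q) * ennreal (exp (- (total_rate - rate a) * \<eta> 0)) * (\<Prod>b\<in>A'. emeasure (poisson_gaps (rate b)) (X b)))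
            * indicator (X a) (\<lambda>i. \<eta> (Suc i))"
        by (simp only: prod.distrib ac_simps)
    qed
    also have "\<dots> = (\<integral>\<^sup>+s. \<integral>\<^sup>+\<eta>. (ennreal (1 / q) * ennreal (exp (- (total_rate - rate a) * s)) * (\<Prod>b\<in>A'. emeasure (poisson_gaps (rate b)) (X b)))
        * indicator (X a) \<eta> \<partial>poisson_gaps (rate a) \<partial>density lborel (exponential_density (rate a)))"
    proof -
      let ?B = "\<Pi>\<^sub>M n\<in>(UNIV::nat set). (borel :: real measure)"
      have Xa: "X a \<in> sets ?B" using X[OF a] by (simp add: sets_poisson_gaps)
      have m0: "(\<lambda>\<eta>. \<eta> 0) \<in> borel_measurable ?B" by (rule measurable_component_singleton) simp
      have m1: "(\<lambda>\<eta>. ennreal (exp (- (total_rate - rate a) * \<eta> 0))) \<in> borel_measurable ?B"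
        by (rule measurable_compose[OF m0]) measurable
      have m2: "(\<lambda>\<eta>. \<lambda>i. \<eta> (Suc i)) \<in> ?B \<rightarrow>\<^sub>M ?B"
        by (rule measurable_abs_UNIV, rule measurable_component_singleton) simp
      have m3: "(\<lambda>\<eta>. indicator (X a) (\<lambda>i. \<eta> (Suc i)) :: ennreal) \<in> borel_measurable ?B"
        by (rule measurable_compose[OF m2 borel_measurable_indicator[OF Xa]])
      have "(\<lambda>\<eta>. (ennreal (1 / q) * ennreal (exp (- (total_rate - rate a) * \<eta> 0)) * (\<Prod>b\<in>A'. emeasure (poisson_gaps (rate b)) (X b)))
        * indicator (X a) (\<lambda>i. \<eta> (Suc i))) \<in> borel_measurable ?B"
        by (intro borel_measurable_times_ennreal m1 m3 borel_measurable_const)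
      from nn_integral_poisson_gaps[OF rate this, of a] show ?thesis
        unfolding nat.case .
    qed
    also have "\<dots> = (\<integral>\<^sup>+s. (ennreal (1 / q) * ennreal (exp (- (total_rate - rate a) * s))) * (\<Prod>b\<in>A. emeasure (poisson_gaps (rate b)) (X b))
        \<partial>density lborel (exponential_density (rate a)))"
    proof (intro nn_integral_cong)
      fix s :: real
      have P: "(\<Prod>b\<in>A. emeasure (poisson_gaps (rate b)) (X b))
          = emeasure (poisson_gaps (rate a)) (X a) * (\<Prod>b\<in>A'. emeasure (poisson_gaps (rate b)) (X b))"
        unfolding A'_def using finite_A a by (rule prod.remove)
      show "(\<integral>\<^sup>+\<eta>. (ennreal (1 / q) * ennreal (exp (- (total_rate - rate a) * s)) * (\<Prod>b\<in>A'. emeasure (poisson_gaps (rate b)) (X b)))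
          * indicator (X a) \<eta> \<partial>poisson_gaps (rate a))
        = (ennreal (1 / q) * ennreal (exp (- (total_rate - rate a) * s))) * (\<Prod>b\<in>A. emeasure (poisson_gaps (rate b)) (X b))"
        unfolding nn_integral_cmult_indicator[OF X[OF a]] P by (simp only: ac_simps)
    qed
    also have "\<dots> = (\<integral>\<^sup>+s. ennreal (1 / q) * ennreal (exp (- (total_rate - rate a) * s)) \<partial>density lborel (exponential_density (rate a)))
        * (\<Prod>b\<in>A. emeasure (poisson_gaps (rate b)) (X b))"
      by (rule nn_integral_multc) measurable
    also have "(\<integral>\<^sup>+s. ennreal (1 / q) * ennreal (exp (- (total_rate - rate a) * s)) \<partial>density lborel (exponential_density (rate a)))
        = (\<integral>\<^sup>+s. ennreal (exponential_density total_rate s) \<partial>lborel)"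
    proof (subst nn_integral_density)
      show "(\<integral>\<^sup>+s. ennreal (exponential_density (rate a) s) * (ennreal (1 / q) * ennreal (exp (- (total_rate - rate a) * s))) \<partial>lborel)
          = (\<integral>\<^sup>+s. ennreal (exponential_density total_rate s) \<partial>lborel)"
      proof (intro nn_integral_cong)
        fix s :: real
        \<comment> \<open>The density of the first gap of \<open>a\<close>, times the probability
          that no other clock has rung by time \<open>s\<close>, divided by \<open>q\<close>, is the
          exponential density of rate \<open>total_rate\<close>.\<close>
        have "exponential_density (rate a) s * (1 / q * exp (- (total_rate - rate a) * s)) = exponential_density total_rate s"
          using rate[of a] total_rate_pos
          by (cases "s < 0") (simp_all add: exponential_density_def q_def exp_add[symmetric] left_diff_distrib)
        then show "ennreal (exponential_density (rate a) s) * (ennreal (1 / q) * ennreal (exp (- (total_rate - rate a) * s))) = ennreal (exponential_density total_rate s)"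
          using rate[of a] q by (simp add: exponential_density_nonneg flip: ennreal_mult)
      qed
    qed auto
    also have "\<dots> = 1"
    proof -
      interpret E: prob_space "density lborel (exponential_density total_rate)"
        by (rule prob_space_exponential_density[OF total_rate_pos])
      show ?thesis using E.emeasure_space_1 by (simp add: emeasure_density)
    qed
    finally show "emeasure (distr (density M h) M (shift a)) (Pi\<^sub>E A X) = (\<Prod>b\<in>A. emeasure (poisson_gaps (rate b)) (X b))"
      by simp
  qed simp
  have "(\<integral>\<^sup>+\<omega>. f \<omega> \<partial>M) = (\<integral>\<^sup>+\<omega>. f \<omega> \<partial>distr (density M h) M (shift a))" by (simp only: eq)
  also have "\<dots> = (\<integral>\<^sup>+\<omega>. h \<omega> * f (shift a \<omega>) \<partial>M)"
    by (subst nn_integral_distr, simp, simp, subst nn_integral_density) auto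
  also have "\<dots> = ennreal (1 / q) * (\<integral>\<^sup>+\<omega>. indicator {\<omega>. is_first a \<omega>} \<omega> * f (shift a \<omega>) \<partial>M)"
    unfolding h_def mult.assoc by (rule nn_integral_cmult) measurable
  finally have "ennreal q * (\<integral>\<^sup>+\<omega>. f \<omega> \<partial>M)
      = (ennreal q * ennreal (1 / q)) * (\<integral>\<^sup>+\<omega>. indicator {\<omega>. is_first a \<omega>} \<omega> * f (shift a \<omega>) \<partial>M)"
    by (simp add: mult.assoc)
  also have "ennreal q * ennreal (1 / q) = 1" using q by (simp flip: ennreal_mult)
  finally show ?thesis by (simp add: q_def)
qed

text \<open>With all clocks but \<open>a\<close> fixed, an epoch of \<open>a\<close> would have to
  fall on a given point, which \<open>nn_integral_epoch_eq\<close> excludes.\<close>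

lemma AE_epochs_distinct:
  assumes a: "a \<in> A" and b: "b \<in> A" and "a \<noteq> b"
  shows "AE \<omega> in M. (\<Sum>i\<le>n. \<omega> a i) \<noteq> (\<Sum>i\<le>m. \<omega> b i)"
proof -
  define A' where "A' = A - {a}"
  have A': "finite A'" "a \<notin> A'" "insert a A' = A" using a finite_A by (auto simp: A'_def)
  have meas: "(\<lambda>\<omega>. indicator {(\<Sum>i\<le>m. \<omega> b i)} (\<Sum>i\<le>n. \<omega> a i) :: ennreal) \<in> borel_measurable M"
  proof -
    have "{\<omega> \<in> space M. (\<Sum>i\<le>n. \<omega> a i) = (\<Sum>i\<le>m. \<omega> b i)} \<in> sets M"
      by (intro borel_measurable_eq borel_measurable_sum measurable_gap a b)
    then have "(indicator {\<omega> \<in> space M. (\<Sum>i\<le>n. \<omega> a i) = (\<Sum>i\<le>m. \<omega> b i)} :: _ \<Rightarrow> ennreal) \<in> borel_measurable M"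
      by (rule borel_measurable_indicator)
    then show ?thesis
      by (rule measurable_cong[THEN iffD1, rotated]) (auto simp: indicator_def)
  qed
  have "(\<integral>\<^sup>+\<omega>. indicator {(\<Sum>i\<le>m. \<omega> b i)} (\<Sum>i\<le>n. \<omega> a i) \<partial>M)
      = (\<integral>\<^sup>+x. \<integral>\<^sup>+\<eta>. indicator {(\<Sum>i\<le>m. (x(a := \<eta>)) b i)} (\<Sum>i\<le>n. (x(a := \<eta>)) a i) \<partial>poisson_gaps (rate a) \<partial>PiM A' (\<lambda>a. poisson_gaps (rate a)))"
    using product_nn_integral_insert[OF A'(1,2), of "\<lambda>\<omega>. indicator {(\<Sum>i\<le>m. \<omega> b i)} (\<Sum>i\<le>n. \<omega> a i)"] meas
    by (simp add: A'(3))
  also have "\<dots> = 0"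
    using \<open>a \<noteq> b\<close> by (simp add: nn_integral_epoch_eq[OF rate])
  finally have "AE \<omega> in M. indicator {(\<Sum>i\<le>m. \<omega> b i)} (\<Sum>i\<le>n. \<omega> a i) = (0::ennreal)"
    using meas by (simp add: nn_integral_0_iff_AE)
  then show ?thesis by eventually_elim (auto simp: indicator_def split: if_splits)
qed

text \<open>The almost sure event on which finitely many epochs fall into bounded time and their
  order is strict, so that listing them in sorted order is meaningful.\<close>

definition regular :: "('v clock \<Rightarrow> nat \<Rightarrow> real) \<Rightarrow> bool" where
  "regular \<omega> \<longleftrightarrow> (\<forall>a\<in>A. \<forall>i. 0 < \<omega> a i) \<and> (\<forall>a\<in>A. \<forall>t. \<exists>n. t < (\<Sum>i\<le>n. \<omega> a i)) \<and>
     (\<forall>a\<in>A. \<forall>b\<in>A. a \<noteq> b \<longrightarrow> (\<forall>n m. (\<Sum>i\<le>n. \<omega> a i) \<noteq> (\<Sum>i\<le>m. \<omega> b i)))"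

lemma AE_regular: "AE \<omega> in M. regular \<omega>"
proof -
  have pos: "AE \<omega> in M. \<forall>a\<in>A. \<forall>i. 0 < \<omega> a i"
    using finite_A by (intro AE_finite_allI) (auto intro!: AE_component AE_gaps_pos rate)
  have unb: "AE \<omega> in M. \<forall>a\<in>A. \<forall>k::nat. \<exists>i. real k < \<omega> a i"
    using finite_A by (intro AE_finite_allI) (auto intro!: AE_component AE_gaps_unbounded rate)
  have dist: "AE \<omega> in M. \<forall>a\<in>A. \<forall>b\<in>A. \<forall>n m. a \<noteq> b \<longrightarrow> (\<Sum>i\<le>n. \<omega> a i) \<noteq> (\<Sum>i\<le>m. \<omega> b i)"
    using finite_A AE_epochs_distinct by (intro AE_finite_allI) (auto simp: AE_all_countable)
  show ?thesis
    using pos unb dist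
  proof eventually_elim
    case (elim \<omega>)
    have "\<exists>n. t < (\<Sum>i\<le>n. \<omega> a i)" if a: "a \<in> A" for a t
    proof -
      obtain k :: nat where k: "t < real k" using reals_Archimedean2 by blast
      obtain n where n: "real k < \<omega> a n" using elim a by blast
      have "\<omega> a n \<le> (\<Sum>i\<le>n. \<omega> a i)"
        using elim a by (intro member_le_sum) (auto simp: less_imp_le)
      then show ?thesis using k n by (intro exI[of _ n]) simp
    qed
    then show ?case using elim by (auto simp: regular_def)
  qed
qed

end

section \<open>Pathwise decomposition of the state at the first epoch\<close>

lemma (in linorder) sorted_key_list_of_set_eqI:
  assumes "inj_on f (set xs)" "sorted (map f xs)" "distinct xs"
  shows "sorted_key_list_of_set f (set xs) = xs"
proof -
  interpret folding_insort_key less_eq less "set xs" f by unfold_locales (rule assms)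
  show ?thesis by (rule idem_if_sorted_distinct) (use assms in auto)
qed

lemma (in linorder) sorted_key_list_of_set_props:
  assumes "inj_on f S" "finite S"
  shows "set (sorted_key_list_of_set f S) = S" "sorted_wrt less (map f (sorted_key_list_of_set f S))"
proof -
  interpret folding_insort_key less_eq less S f by unfold_locales (rule assms)
  show "set (sorted_key_list_of_set f S) = S" using assms(2) by simp
  show "sorted_wrt less (map f (sorted_key_list_of_set f S))" by simp
qed

context poisson_clocks begin

lemma regular_pos: "regular \<omega> \<Longrightarrow> a \<in> A \<Longrightarrow> 0 < \<omega> a i"
  by (simp add: regular_def)

lemma regular_unbounded: "regular \<omega> \<Longrightarrow> a \<in> A \<Longrightarrow> \<exists>n. t < epoch \<omega> (a, n)"
  by (simp add: regular_def epoch_def)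

lemma regular_distinct:
  "regular \<omega> \<Longrightarrow> a \<in> A \<Longrightarrow> b \<in> A \<Longrightarrow> a \<noteq> b \<Longrightarrow> epoch \<omega> (a, n) \<noteq> epoch \<omega> (b, m)"
  unfolding regular_def epoch_def prod.case by blast

lemma epoch_mono: "regular \<omega> \<Longrightarrow> a \<in> A \<Longrightarrow> n \<le> m \<Longrightarrow> epoch \<omega> (a, n) \<le> epoch \<omega> (a, m)"
  unfolding epoch_def by (auto simp: regular_def less_imp_le intro!: sum_mono2)

lemma epoch_strict_mono:
  assumes "regular \<omega>" "a \<in> A" "n < m"
  shows "epoch \<omega> (a, n) < epoch \<omega> (a, m)"
proof -
  have "epoch \<omega> (a, n) < epoch \<omega> (a, Suc n)" using assms by (simp add: epoch_def regular_def)
  also have "\<dots> \<le> epoch \<omega> (a, m)" using assms by (intro epoch_mono) auto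
  finally show ?thesis .
qed

lemma epoch_inj:
  assumes "regular \<omega>" "a \<in> A" "b \<in> A" "epoch \<omega> (a, n) = epoch \<omega> (b, m)"
  shows "a = b \<and> n = m"
proof -
  have "a = b" using assms regular_distinct by blast
  then show ?thesis
    using epoch_strict_mono[OF assms(1,2), of n m] epoch_strict_mono[OF assms(1,2), of m n] assms(4)
    by (metis less_irrefl linorder_neqE_nat)
qed

lemma ex_first:
  assumes "regular \<omega>"
  shows "\<exists>!a. a \<in> A \<and> is_first a \<omega>"
proof -
  have inj: "\<omega> a 0 \<noteq> \<omega> b 0" if "a \<in> A" "b \<in> A" "a \<noteq> b" for a b
    using epoch_inj[OF assms that(1,2), of 0 0] that by (auto simp: epoch_def)
  obtain a where a: "a \<in> A" "\<And>b. b \<in> A \<Longrightarrow> \<omega> a 0 \<le> \<omega> b 0"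
    using that[OF arg_min_if_finite(1)[OF finite_A nonempty_A, of "\<lambda>a. \<omega> a 0"]]
      arg_min_least[OF finite_A nonempty_A, of _ "\<lambda>a. \<omega> a 0"] by blast
  show ?thesis
  proof (rule ex1I[of _ a])
    show "a \<in> A \<and> is_first a \<omega>"
      unfolding is_first_def using a inj by (metis Diff_iff order_less_le singletonI)
    fix b assume b: "b \<in> A \<and> is_first b \<omega>"
    show "b = a"
    proof (rule ccontr)
      assume "b \<noteq> a"
      then have "\<omega> b 0 < \<omega> a 0" using b a(1) by (auto simp: is_first_def)
      then show False using a(2)[of b] b by simp
    qed
  qed
qed

text \<open>Turns the index of an epoch of the shifted clocks into its index among the original
  ones.\<close>

definition advance :: "'v clock \<Rightarrow> 'v clock \<times> nat \<Rightarrow> 'v clock \<times> nat" where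
  "advance a = (\<lambda>(b, n). (b, if b = a then Suc n else n))"

lemma epoch_shift:
  assumes "a \<in> A" "b \<in> A"
  shows "epoch (shift a \<omega>) (b, n) = epoch \<omega> (advance a (b, n)) - \<omega> a 0"
proof (cases "b = a")
  case True
  then show ?thesis using assms by (simp add: epoch_def shift_def advance_def sum.atMost_Suc_shift del: sum.atMost_Suc)
next
  case False
  then have "epoch (shift a \<omega>) (b, n) = (\<Sum>i\<le>n. \<omega> b i - (if i = 0 then \<omega> a 0 else 0))"
    using assms by (auto simp: epoch_def shift_def intro!: sum.cong)
  then show ?thesis using False by (simp add: sum_subtractf sum.delta epoch_def advance_def)
qed

lemma regular_shift:
  assumes \<omega>: "regular \<omega>" and a: "a \<in> A" "is_first a \<omega>"
  shows "regular (shift a \<omega>)"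
proof -
  have "0 < shift a \<omega> b i" if "b \<in> A" for b i
    using that assms by (auto simp: shift_def regular_def is_first_def)
  moreover have "\<exists>n. t < epoch (shift a \<omega>) (b, n)" if b: "b \<in> A" for b t
  proof -
    obtain n where "t + \<omega> a 0 < epoch \<omega> (b, n)"
      using regular_unbounded[OF \<omega> b] by blast
    also have "\<dots> \<le> epoch \<omega> (advance a (b, n))"
      using \<omega> b by (auto simp: advance_def intro!: epoch_mono)
    finally show ?thesis using a b by (intro exI[of _ n]) (simp add: epoch_shift)
  qed
  moreover have "epoch (shift a \<omega>) (b, n) \<noteq> epoch (shift a \<omega>) (b', m)" if "b \<in> A" "b' \<in> A" "b \<noteq> b'" for b b' n m
    using epoch_inj[OF \<omega> that(1,2)] that a by (auto simp: epoch_shift advance_def split: if_splits)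
  ultimately show ?thesis by (auto simp: regular_def epoch_def)
qed

definition state_at :: "('v clock \<Rightarrow> 's \<Rightarrow> 's) \<Rightarrow> 's \<Rightarrow> real \<Rightarrow> ('v clock \<Rightarrow> nat \<Rightarrow> real) \<Rightarrow> 's" where
  "state_at F x t \<omega> = fold (\<lambda>(a, n). F a)
     (sorted_key_list_of_set (epoch \<omega>) {(a, n). a \<in> A \<and> epoch \<omega> (a, n) \<le> t}) x"

lemma finite_epochs:
  assumes "regular \<omega>"
  shows "finite {(a, n). a \<in> A \<and> epoch \<omega> (a, n) \<le> t}"
proof -
  have "finite {n. epoch \<omega> (a, n) \<le> t}" if a: "a \<in> A" for a
  proof -
    obtain m where m: "t < epoch \<omega> (a, m)" using regular_unbounded[OF assms a] by blast
    have "{n. epoch \<omega> (a, n) \<le> t} \<subseteq> {..m}"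
    proof
      fix n assume "n \<in> {n. epoch \<omega> (a, n) \<le> t}"
      then show "n \<in> {..m}" using m epoch_mono[OF assms a, of m n] by (cases "n \<le> m") auto
    qed
    then show ?thesis by (rule finite_subset) simp
  qed
  then have "finite (Sigma A (\<lambda>a. {n. epoch \<omega> (a, n) \<le> t}))" using finite_A by (rule finite_SigmaI[rotated])
  moreover have "{(a, n). a \<in> A \<and> epoch \<omega> (a, n) \<le> t} = Sigma A (\<lambda>a. {n. epoch \<omega> (a, n) \<le> t})" by auto
  ultimately show ?thesis by simp
qed

lemma first_epoch_le:
  assumes "regular \<omega>" "is_first a \<omega>" "a \<in> A" "b \<in> A"
  shows "\<omega> a 0 \<le> epoch \<omega> (b, n)"
proof -
  have "\<omega> a 0 \<le> epoch \<omega> (b, 0)" using assms by (cases "a = b") (auto simp: is_first_def epoch_def less_imp_le)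
  also have "\<dots> \<le> epoch \<omega> (b, n)" using assms by (intro epoch_mono) auto
  finally show ?thesis .
qed

lemma state_at_before:
  assumes "regular \<omega>" "is_first a \<omega>" "a \<in> A" "t < \<omega> a 0"
  shows "state_at F x t \<omega> = x"
proof -
  have "{(b, n). b \<in> A \<and> epoch \<omega> (b, n) \<le> t} = {}"
  proof -
    have "\<not> epoch \<omega> (b, n) \<le> t" if "b \<in> A" for b n
      using first_epoch_le[OF assms(1-3) that, of n] assms(4) by linarith
    then show ?thesis by blast
  qed
  then show ?thesis using sorted_key_list_of_set_eqI[of "epoch \<omega>" "[]"]
    unfolding state_at_def by (simp only: list.set fold_simps inj_on_empty list.map sorted_wrt.simps distinct.simps)
qed

text \<open>The pathwise Markov property: the sorted list of epochs starts with
  \<open>(a, 0)\<close> and continues with the renumbered list of the shifted clocks, since all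
  their epochs are translated by the same amount and keep their order.\<close>

lemma state_at_after:
  assumes \<omega>: "regular \<omega>" and a: "is_first a \<omega>" "a \<in> A" and t: "\<omega> a 0 \<le> t"
  shows "state_at F x t \<omega> = state_at F (F a x) (t - \<omega> a 0) (shift a \<omega>)"
proof -
  let ?P = "{(b, n). b \<in> A \<and> epoch \<omega> (b, n) \<le> t}"
  let ?Q = "{(b, n). b \<in> A \<and> epoch (shift a \<omega>) (b, n) \<le> t - \<omega> a 0}"
  let ?l = "sorted_key_list_of_set (epoch (shift a \<omega>)) ?Q"
  have \<omega>': "regular (shift a \<omega>)" by (rule regular_shift[OF \<omega> a(2,1)])
  have injP: "inj_on (epoch \<omega>) (A \<times> UNIV)" using epoch_inj[OF \<omega>] unfolding inj_on_def by blast
  have injQ: "inj_on (epoch (shift a \<omega>)) (A \<times> UNIV)" using epoch_inj[OF \<omega>'] unfolding inj_on_def by blast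
  have finP: "finite ?P" "?P \<subseteq> A \<times> UNIV"
    by (rule finite_epochs[OF \<omega>]) blast
  have finQ: "finite ?Q" "?Q \<subseteq> A \<times> UNIV"
    by (rule finite_epochs[OF \<omega>']) blast
  note Q = sorted_key_list_of_set_props[OF inj_on_subset[OF injQ finQ(2)] finQ(1)]
  have setl: "set ?l = ?Q" by (rule Q(1))
  have ep: "epoch (shift a \<omega>) q = epoch \<omega> (advance a q) - \<omega> a 0" if q: "q \<in> ?Q" for q
  proof -
    obtain b n where "q = (b, n)" "b \<in> A" using q by blast
    then show ?thesis using epoch_shift[OF a(2)] by simp
  qed
  have keys: "map (epoch \<omega>) (map (advance a) ?l) = map ((+) (\<omega> a 0)) (map (epoch (shift a \<omega>)) ?l)"
    unfolding map_map o_def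
  proof (rule map_cong[OF refl])
    fix q assume "q \<in> set ?l"
    then have "q \<in> ?Q" unfolding setl .
    from ep[OF this] show "epoch \<omega> (advance a q) = \<omega> a 0 + epoch (shift a \<omega>) q" by linarith
  qed
  have "sorted_key_list_of_set (epoch \<omega>) ?P = (a, 0) # map (advance a) ?l"
  proof -
    have "sorted_wrt (<) (map (epoch (shift a \<omega>)) ?l)"
      by (rule Q(2))
    moreover have "sorted_wrt (<) (map ((+) k) ks)" if "sorted_wrt (<) ks" for k :: real and ks
      using that by (simp add: sorted_wrt_map)
    ultimately have tail: "sorted_wrt (<) (map (epoch \<omega>) (map (advance a) ?l))"
      unfolding keys by blast
    have head: "epoch \<omega> (a, 0) < epoch \<omega> q" if q: "q \<in> advance a ` ?Q" for q
    proof -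
      obtain q' where q': "q = advance a q'" "q' \<in> ?Q" using q by (rule imageE)
      then obtain b n where bn: "q = advance a (b, n)" "b \<in> A" by blast
      show ?thesis
      proof (cases "b = a")
        case True
        then show ?thesis using bn epoch_strict_mono[OF \<omega> a(2)] by (simp add: advance_def)
      next
        case False
        then have "epoch \<omega> (a, 0) < epoch \<omega> (b, 0)" using a bn by (simp add: is_first_def epoch_def)
        also have "\<dots> \<le> epoch \<omega> (b, n)" using bn by (intro epoch_mono[OF \<omega>]) auto
        finally show ?thesis using bn False by (simp add: advance_def)
      qed
    qed
    have "\<forall>k\<in>set (map (epoch \<omega>) (map (advance a) ?l)). epoch \<omega> (a, 0) < k"
      unfolding set_map setl using head by blast
    then have sorted: "sorted_wrt (<) (map (epoch \<omega>) ((a, 0) # map (advance a) ?l))"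
      using tail unfolding list.map sorted_wrt.simps by blast
    have "?P = insert (a, 0) (advance a ` ?Q)"
    proof (intro equalityI subsetI)
      fix q assume q: "q \<in> ?P"
      then obtain b n where bn: "q = (b, n)" "b \<in> A" "epoch \<omega> (b, n) \<le> t" by auto
      show "q \<in> insert (a, 0) (advance a ` ?Q)"
      proof (cases "q = (a, 0)")
        case False
        \<comment> \<open>Since \<open>(a, 0)\<close> is excluded, \<open>n - 1\<close> is a true
          predecessor when \<open>b = a\<close>.\<close>
        define m where "m = (if b = a then n - 1 else n)"
        have adv: "advance a (b, m) = (b, n)" using False bn by (auto simp: advance_def m_def)
        have "epoch (shift a \<omega>) (b, m) \<le> t - \<omega> a 0"
          using bn(3) by (simp add: epoch_shift[OF a(2) bn(2)] adv)
        then have "(b, m) \<in> ?Q" using bn(2) by blast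
        then have "advance a (b, m) \<in> advance a ` ?Q" by (rule imageI)
        then show ?thesis unfolding adv bn(1) by (rule insertI2)
      qed simp
    next
      fix q assume q: "q \<in> insert (a, 0) (advance a ` ?Q)"
      show "q \<in> ?P"
      proof (cases "q = (a, 0)")
        case True
        then show ?thesis using a t by (simp add: epoch_def)
      next
        case False
        then have "q \<in> advance a ` ?Q" using q by blast
        then obtain q' where q': "q = advance a q'" "q' \<in> ?Q" by (rule imageE)
        then obtain b n where bn: "q' = (b, n)" "b \<in> A" "epoch (shift a \<omega>) (b, n) \<le> t - \<omega> a 0" by blast
        then have "epoch \<omega> (advance a (b, n)) \<le> t" using epoch_shift[OF a(2) bn(2), of \<omega> n] by linarith
        then show ?thesis unfolding q'(1) bn(1) using bn(2) by (simp add: advance_def)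
      qed
    qed
    then have P: "set ((a, 0) # map (advance a) ?l) = ?P" unfolding list.set set_map setl by (rule sym)
    have "sorted_key_list_of_set (epoch \<omega>) (set ((a, 0) # map (advance a) ?l)) = (a, 0) # map (advance a) ?l"
    proof (rule sorted_key_list_of_set_eqI)
      show "inj_on (epoch \<omega>) (set ((a, 0) # map (advance a) ?l))"
        unfolding P by (rule inj_on_subset[OF injP finP(2)])
      show "sorted (map (epoch \<omega>) ((a, 0) # map (advance a) ?l))" "distinct ((a, 0) # map (advance a) ?l)"
        using sorted unfolding strict_sorted_iff distinct_map by blast+
    qed
    then show ?thesis unfolding P .
  qed
  then have "state_at F x t \<omega> = fold (\<lambda>(a, n). F a) (map (advance a) ?l) (F a x)"
    unfolding state_at_def by (simp only: fold_simps prod.case)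
  also have "\<dots> = fold (\<lambda>(a, n). F a) ?l (F a x)"
  proof -
    have "(\<lambda>(a, n). F a) \<circ> advance a = (\<lambda>(a, n). F a)" by (auto simp: advance_def fun_eq_iff)
    then show ?thesis by (simp only: fold_map)
  qed
  finally show ?thesis by (simp add: state_at_def)
qed

end

section \<open>Comparison of elapsed time with the number of events\<close>

context poisson_clocks
begin

definition "pick a = rate a / total_rate"

lemma pick_pos: "0 < pick a"
  using rate[of a] total_rate_pos by (simp add: pick_def)

lemma letters_pick: "letters A pick"
  using pick_pos total_rate_pos finite_A
  by unfold_locales (auto simp: less_imp_le pick_def total_rate_def simp flip: sum_divide_distrib)

text \<open>The time until the chain enters B, cut off after n events, where each event counts as k more
  units of time. With k = 1 it tends to infinity if B is never reached.\<close>

primrec delay :: "real \<Rightarrow> ('v clock \<Rightarrow> 's \<Rightarrow> 's) \<Rightarrow> 's set \<Rightarrow> nat \<Rightarrow> 's \<Rightarrow> ('v clock \<Rightarrow> nat \<Rightarrow> real) \<Rightarrow> ennreal" where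
  "delay k F B 0 x \<omega> = 0"
| "delay k F B (Suc n) x \<omega> = (if x \<in> B then 0 else
     (\<Sum>a\<in>A. indicator {\<omega>. is_first a \<omega>} \<omega> * (ennreal (k + \<omega> a 0) + delay k F B n (F a x) (shift a \<omega>))))"

lemma measurable_delay: "delay k F B n x \<in> borel_measurable M"
proof (induction n arbitrary: x)
  case 0
  have "delay k F B 0 x = (\<lambda>\<omega>. 0)" by (simp add: fun_eq_iff)
  then show ?case by simp
next
  case (Suc n)
  show ?case
  proof (cases "x \<in> B")
    case True
    then have "delay k F B (Suc n) x = (\<lambda>\<omega>. 0)" by (simp add: fun_eq_iff)
    then show ?thesis by simp
  next
    case False
    have "(\<lambda>\<omega>. \<Sum>a\<in>A. indicator {\<omega>. is_first a \<omega>} \<omega> * (ennreal (k + \<omega> a 0) + delay k F B n (F a x) (shift a \<omega>)))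
        \<in> borel_measurable M"
    proof (intro borel_measurable_sum borel_measurable_times_ennreal borel_measurable_add)
      fix a assume a: "a \<in> A"
      show "(indicator {\<omega>. is_first a \<omega>} :: _ \<Rightarrow> ennreal) \<in> borel_measurable M"
        by (rule measurable_indicator_first[OF a])
      show "(\<lambda>\<omega>. ennreal (k + \<omega> a 0)) \<in> borel_measurable M"
        by (intro measurable_compose[OF _ measurable_ennreal] borel_measurable_add borel_measurable_const measurable_gap a)
      show "(\<lambda>\<omega>. delay k F B n (F a x) (shift a \<omega>)) \<in> borel_measurable M"
        by (rule measurable_compose[OF measurable_shift[OF a] Suc.IH])
    qed
    moreover have "delay k F B (Suc n) x = (\<lambda>\<omega>. \<Sum>a\<in>A. indicator {\<omega>. is_first a \<omega>} \<omega> * (ennreal (k + \<omega> a 0) + delay k F B n (F a x) (shift a \<omega>)))"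
      using False by (simp add: fun_eq_iff)
    ultimately show ?thesis by (simp only:)
  qed
qed

definition event_delay :: "real \<Rightarrow> ennreal" where
  "event_delay k = (\<Sum>a\<in>A. \<integral>\<^sup>+\<omega>. indicator {\<omega>. is_first a \<omega>} \<omega> * ennreal (k + \<omega> a 0) \<partial>M)"

text \<open>A form of Wald's identity: the clocks restart at every event, so each event before
  \<open>B\<close> costs the same mean time whatever the state of the chain.\<close>

lemma nn_integral_delay:
  "(\<integral>\<^sup>+\<omega>. delay k F B n x \<omega> \<partial>M) = event_delay k * ennreal (letter_chain.hit A pick F B n x)"
proof -
  interpret letters A pick by (rule letters_pick)
  interpret letter_chain A pick F by unfold_locales
  show ?thesis
  proof (induction n arbitrary: x)
    case (Suc n)
    show ?case
    proof (cases "x \<in> B")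
      case False
      have "(\<integral>\<^sup>+\<omega>. delay k F B (Suc n) x \<omega> \<partial>M)
          = (\<integral>\<^sup>+\<omega>. (\<Sum>a\<in>A. indicator {\<omega>. is_first a \<omega>} \<omega> * ennreal (k + \<omega> a 0)
              + indicator {\<omega>. is_first a \<omega>} \<omega> * delay k F B n (F a x) (shift a \<omega>)) \<partial>M)"
        using False by (simp add: distrib_left)
      also have "\<dots> = (\<Sum>a\<in>A. \<integral>\<^sup>+\<omega>. indicator {\<omega>. is_first a \<omega>} \<omega> * ennreal (k + \<omega> a 0)
              + indicator {\<omega>. is_first a \<omega>} \<omega> * delay k F B n (F a x) (shift a \<omega>) \<partial>M)"
        by (intro nn_integral_sum borel_measurable_add borel_measurable_times_ennreal measurable_indicator_first
            measurable_compose[OF _ measurable_ennreal] borel_measurable_const measurable_gap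
            measurable_compose[OF measurable_shift measurable_delay])
      also have "\<dots> = (\<Sum>a\<in>A. (\<integral>\<^sup>+\<omega>. indicator {\<omega>. is_first a \<omega>} \<omega> * ennreal (k + \<omega> a 0) \<partial>M)
              + ennreal (pick a) * (event_delay k * ennreal (hit B n (F a x))))"
      proof (intro sum.cong refl)
        fix a assume a: "a \<in> A"
        have "(\<integral>\<^sup>+\<omega>. indicator {\<omega>. is_first a \<omega>} \<omega> * ennreal (k + \<omega> a 0)
              + indicator {\<omega>. is_first a \<omega>} \<omega> * delay k F B n (F a x) (shift a \<omega>) \<partial>M)
            = (\<integral>\<^sup>+\<omega>. indicator {\<omega>. is_first a \<omega>} \<omega> * ennreal (k + \<omega> a 0) \<partial>M)
              + (\<integral>\<^sup>+\<omega>. indicator {\<omega>. is_first a \<omega>} \<omega> * delay k F B n (F a x) (shift a \<omega>) \<partial>M)"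
          by (intro nn_integral_add borel_measurable_times_ennreal measurable_indicator_first[OF a] borel_measurable_add
            measurable_compose[OF _ measurable_ennreal] borel_measurable_const measurable_gap[OF a]
            measurable_compose[OF measurable_shift[OF a] measurable_delay])
        also have "(\<integral>\<^sup>+\<omega>. indicator {\<omega>. is_first a \<omega>} \<omega> * delay k F B n (F a x) (shift a \<omega>) \<partial>M)
            = ennreal (pick a) * (event_delay k * ennreal (hit B n (F a x)))"
          unfolding nn_integral_first_shift[OF a measurable_delay] Suc.IH pick_def ..
        finally show "(\<integral>\<^sup>+\<omega>. indicator {\<omega>. is_first a \<omega>} \<omega> * ennreal (k + \<omega> a 0)
              + indicator {\<omega>. is_first a \<omega>} \<omega> * delay k F B n (F a x) (shift a \<omega>) \<partial>M)
            = (\<integral>\<^sup>+\<omega>. indicator {\<omega>. is_first a \<omega>} \<omega> * ennreal (k + \<omega> a 0) \<partial>M)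
              + ennreal (pick a) * (event_delay k * ennreal (hit B n (F a x)))" .
      qed
      also have "\<dots> = event_delay k + event_delay k * (\<Sum>a\<in>A. ennreal (pick a) * ennreal (hit B n (F a x)))"
        by (simp only: sum.distrib event_delay_def[symmetric] sum_distrib_left mult.left_commute)
      also have "(\<Sum>a\<in>A. ennreal (pick a) * ennreal (hit B n (F a x))) = ennreal (\<Sum>a\<in>A. pick a * hit B n (F a x))"
        using hit_nonneg pick_pos by (subst sum_ennreal[symmetric]) (auto simp: ennreal_mult less_imp_le)
      also have "event_delay k + event_delay k * ennreal (\<Sum>a\<in>A. pick a * hit B n (F a x))
          = event_delay k * ennreal (1 + (\<Sum>a\<in>A. pick a * hit B n (F a x)))"
      proof -
        have "0 \<le> (\<Sum>a\<in>A. pick a * hit B n (F a x))"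
          using hit_nonneg pick_pos by (intro sum_nonneg mult_nonneg_nonneg) (auto simp: less_imp_le)
        then show ?thesis by (simp add: ennreal_plus distrib_left)
      qed
      finally show ?thesis using False by simp
    next
      case True
      then have "delay k F B (Suc n) x = (\<lambda>\<omega>. 0)" by (simp add: fun_eq_iff)
      then show ?thesis using True by simp
    qed
  next
    case 0
    have "delay k F B 0 x = (\<lambda>\<omega>. 0)" by (simp add: fun_eq_iff)
    then show ?case by simp
  qed
qed

lemma event_delay_finite:
  assumes "0 \<le> k"
  shows "event_delay k < \<infinity>"
proof -
  have "(\<integral>\<^sup>+\<omega>. indicator {\<omega>. is_first a \<omega>} \<omega> * ennreal (k + \<omega> a 0) \<partial>M) < \<infinity>" if a: "a \<in> A" for a
  proof -
    let ?E = "density lborel (exponential_density (rate a))"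
    have m: "(\<lambda>\<eta>. ennreal (k + \<eta> 0)) \<in> borel_measurable (\<Pi>\<^sub>M n\<in>(UNIV::nat set). (borel :: real measure))"
      by (intro measurable_compose[OF _ measurable_ennreal] borel_measurable_add borel_measurable_const measurable_component_singleton) simp
    have m': "(\<lambda>\<eta>. ennreal (k + \<eta> 0)) \<in> borel_measurable (poisson_gaps (rate a))"
      using m by (simp cong: measurable_cong_sets add: sets_poisson_gaps)
    have "(\<integral>\<^sup>+\<omega>. indicator {\<omega>. is_first a \<omega>} \<omega> * ennreal (k + \<omega> a 0) \<partial>M) \<le> (\<integral>\<^sup>+\<omega>. ennreal (k + \<omega> a 0) \<partial>M)"
      by (intro nn_integral_mono) (auto simp: indicator_def)
    also have "\<dots> = (\<integral>\<^sup>+\<eta>. ennreal (k + \<eta> 0) \<partial>distr M (poisson_gaps (rate a)) (\<lambda>\<omega>. \<omega> a))"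
      using m' by (subst nn_integral_distr[OF measurable_component_singleton[OF a]]) auto
    also have "\<dots> = (\<integral>\<^sup>+\<eta>. ennreal (k + \<eta> 0) \<partial>poisson_gaps (rate a))"
      by (simp only: PiM_component[OF a])
    also have "\<dots> = (\<integral>\<^sup>+s. ennreal (k + s) \<partial>?E)"
      unfolding nn_integral_poisson_gaps[OF rate m] nat.case nn_integral_const
        prob_space.emeasure_space_1[OF prob_space_poisson_gaps[OF rate]] mult_1_right ..
    also have "\<dots> = (\<integral>\<^sup>+s. ennreal (exponential_density (rate a) s) * ennreal (k + s) \<partial>lborel)"
      by (subst nn_integral_density) (auto simp: exponential_density_nonneg rate)
    \<comment> \<open>The exponential density is \<open>erlang_density 0\<close>; the integrand is
      split into moments of order 0 and 1, both finite.\<close>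
    also have "\<dots> \<le> (\<integral>\<^sup>+s. ennreal k * ennreal (erlang_density 0 (rate a) s * s ^ 0) + ennreal (erlang_density 0 (rate a) s * s ^ 1) \<partial>lborel)"
    proof (intro nn_integral_mono)
      fix s :: real
      show "ennreal (exponential_density (rate a) s) * ennreal (k + s)
          \<le> ennreal k * ennreal (erlang_density 0 (rate a) s * s ^ 0) + ennreal (erlang_density 0 (rate a) s * s ^ 1)"
      proof (cases "s < 0")
        case True
        then show ?thesis by (simp add: exponential_density_def)
      next
        case False
        define D where "D = exponential_density (rate a) s"
        have D: "0 \<le> D" unfolding D_def by (rule exponential_density_nonneg[OF rate])
        have "ennreal D * ennreal (k + s) = ennreal (k * D + D * s)"
          using False assms D by (subst ennreal_mult[symmetric]) (auto simp: algebra_simps)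
        also have "\<dots> = ennreal (k * D) + ennreal (D * s)"
          using False assms D by (intro ennreal_plus) auto
        also have "ennreal (k * D) = ennreal k * ennreal D"
          using assms D by (rule ennreal_mult)
        finally show ?thesis unfolding D_def[symmetric] power_0 power_one_right mult_1_right by (rule eq_refl)
      qed
    qed
    also have "\<dots> = ennreal k * (\<integral>\<^sup>+s. ennreal (erlang_density 0 (rate a) s * s ^ 0) \<partial>lborel)
        + (\<integral>\<^sup>+s. ennreal (erlang_density 0 (rate a) s * s ^ 1) \<partial>lborel)"
    proof -
      have m: "(\<lambda>s. ennreal (erlang_density 0 (rate a) s * s ^ i)) \<in> borel_measurable lborel" for i by measurable
      show ?thesis
        unfolding nn_integral_add[OF borel_measurable_times_ennreal[OF borel_measurable_const m] m] nn_integral_cmult[OF m] ..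
    qed
    also have "\<dots> < \<infinity>"
      by (simp only: nn_integral_erlang_ith_moment[OF rate]) (simp add: ennreal_mult_less_top)
    finally show ?thesis .
  qed
  then show ?thesis by (simp add: event_delay_def finite_A)
qed

lemma nn_integral_first: "a \<in> A \<Longrightarrow> (\<integral>\<^sup>+\<omega>. indicator {\<omega>. is_first a \<omega>} \<omega> \<partial>M) = ennreal (pick a)"
proof -
  assume a: "a \<in> A"
  have "(\<integral>\<^sup>+\<omega>. indicator {\<omega>. is_first a \<omega>} \<omega> * 1 \<partial>M) = ennreal (rate a / total_rate) * (\<integral>\<^sup>+\<omega>. 1 \<partial>M)"
    by (rule nn_integral_first_shift[OF a borel_measurable_const])
  then show "(\<integral>\<^sup>+\<omega>. indicator {\<omega>. is_first a \<omega>} \<omega> \<partial>M) = ennreal (pick a)"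
    unfolding mult_1_right nn_integral_const P.emeasure_space_1 pick_def .
qed

lemma not_AE_not_first: "a \<in> A \<Longrightarrow> \<not> (AE \<omega> in M. \<not> is_first a \<omega>)"
proof
  assume a: "a \<in> A" and ae: "AE \<omega> in M. \<not> is_first a \<omega>"
  have "(\<integral>\<^sup>+\<omega>. indicator {\<omega>. is_first a \<omega>} \<omega> \<partial>M) = (\<integral>\<^sup>+\<omega>. 0 \<partial>M)"
  proof (rule nn_integral_cong_AE)
    show "AE \<omega> in M. indicator {\<omega>. is_first a \<omega>} \<omega> = (0 :: ennreal)"
      using ae by eventually_elim simp
  qed
  also have "\<dots> = 0" by simp
  finally show False unfolding nn_integral_first[OF a] using pick_pos[of a] by simp
qed

lemma event_delay_pos: "0 < event_delay 0"
proof -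
  obtain a where a: "a \<in> A" using nonempty_A by blast
  have "(\<integral>\<^sup>+\<omega>. indicator {\<omega>. is_first a \<omega>} \<omega> * ennreal (0 + \<omega> a 0) \<partial>M) \<noteq> 0"
  proof
    assume "(\<integral>\<^sup>+\<omega>. indicator {\<omega>. is_first a \<omega>} \<omega> * ennreal (0 + \<omega> a 0) \<partial>M) = 0"
    moreover have "(\<lambda>\<omega>. indicator {\<omega>. is_first a \<omega>} \<omega> * ennreal (0 + \<omega> a 0)) \<in> borel_measurable M"
      by (intro borel_measurable_times_ennreal measurable_indicator_first[OF a]
          measurable_compose[OF _ measurable_ennreal] borel_measurable_add borel_measurable_const measurable_gap[OF a])
    ultimately have "AE \<omega> in M. indicator {\<omega>. is_first a \<omega>} \<omega> * ennreal (0 + \<omega> a 0) = 0"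
      using nn_integral_0_iff_AE by blast
    then have "AE \<omega> in M. \<not> is_first a \<omega>"
      using AE_regular
    proof eventually_elim
      case (elim \<omega>)
      then show ?case using regular_pos[OF elim(2) a, of 0] by (auto simp: indicator_def split: if_splits)
    qed
    then show False using not_AE_not_first[OF a] by simp
  qed
  then have "0 < (\<integral>\<^sup>+\<omega>. indicator {\<omega>. is_first a \<omega>} \<omega> * ennreal (0 + \<omega> a 0) \<partial>M)"
    unfolding zero_less_iff_neq_zero .
  also have "\<dots> \<le> event_delay 0"
    unfolding event_delay_def
    by (rule member_le_sum[OF a zero_le finite_A, of "\<lambda>a. \<integral>\<^sup>+\<omega>. indicator {\<omega>. is_first a \<omega>} \<omega> * ennreal (0 + \<omega> a 0) \<partial>M"])
  finally show ?thesis .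
qed

lemma delay_Suc:
  assumes "regular \<omega>" "a \<in> A" "is_first a \<omega>" "x \<notin> B"
  shows "delay k F B (Suc n) x \<omega> = ennreal (k + \<omega> a 0) + delay k F B n (F a x) (shift a \<omega>)"
proof -
  let ?g = "\<lambda>b. ennreal (k + \<omega> b 0) + delay k F B n (F b x) (shift b \<omega>)"
  have "\<not> is_first b \<omega>" if "b \<in> A - {a}" for b
    using ex_first[OF assms(1)] assms(2,3) that by blast
  then have "(\<Sum>b\<in>A. indicator {\<omega>. is_first b \<omega>} \<omega> * ?g b) = (\<Sum>b\<in>{a}. indicator {\<omega>. is_first b \<omega>} \<omega> * ?g b)"
    by (intro sum.mono_neutral_right finite_A) (simp_all add: assms(2) del: delay.simps)
  also have "\<dots> = ?g a" using assms(3) by (simp del: delay.simps)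
  finally show ?thesis using assms(4) unfolding delay.simps by (simp only: if_False)
qed

lemma delay_mono: "delay k F B n x \<omega> \<le> delay k F B (Suc n) x \<omega>"
proof (induction n arbitrary: x \<omega>)
  case (Suc n)
  show ?case
  proof (cases "x \<in> B")
    case False
    have "(\<Sum>a\<in>A. indicator {\<omega>. is_first a \<omega>} \<omega> * (ennreal (k + \<omega> a 0) + delay k F B n (F a x) (shift a \<omega>)))
        \<le> (\<Sum>a\<in>A. indicator {\<omega>. is_first a \<omega>} \<omega> * (ennreal (k + \<omega> a 0) + delay k F B (Suc n) (F a x) (shift a \<omega>)))"
      by (intro sum_mono mult_left_mono add_left_mono Suc.IH zero_le)
    then show ?thesis
      using False by (simp only: delay.simps(2)[of k F B n x] delay.simps(2)[of k F B "Suc n" x] if_False)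
  next
    case True
    then show ?thesis by (simp only: delay.simps(2)[of k F B n x] if_True zero_le)
  qed
qed simp

lemma state_at_0:
  assumes "regular \<omega>"
  shows "state_at F x 0 \<omega> = x"
proof -
  obtain a where a: "a \<in> A" "is_first a \<omega>" using ex_first[OF assms] by blast
  show ?thesis by (rule state_at_before[OF assms a(2,1) regular_pos[OF assms a(1)]])
qed

lemma state_at_absorbed:
  assumes \<omega>: "regular \<omega>" and abs: "\<And>a. a \<in> A \<Longrightarrow> F a x = x"
  shows "state_at F x t \<omega> = x"
proof -
  let ?P = "{(a, n). a \<in> A \<and> epoch \<omega> (a, n) \<le> t}"
  have "inj_on (epoch \<omega>) ?P" using epoch_inj[OF \<omega>] unfolding inj_on_def by blast
  then have set: "set (sorted_key_list_of_set (epoch \<omega>) ?P) = ?P"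
    by (rule sorted_key_list_of_set_props(1)) (rule finite_epochs[OF \<omega>])
  have "\<forall>(a, n)\<in>set (sorted_key_list_of_set (epoch \<omega>) ?P). a \<in> A" unfolding set by blast
  moreover have "\<forall>(a, n)\<in>set l. a \<in> A \<Longrightarrow> fold (\<lambda>(a, n). F a) l x = x" for l :: "('v clock \<times> nat) list"
  proof (induction l)
    case (Cons q l)
    obtain a n where "q = (a, n)" by (cases q)
    then show ?case using Cons abs by simp
  qed simp
  ultimately show ?thesis unfolding state_at_def by blast
qed

text \<open>Turns a return to \<open>z\<close> into hitting \<open>(z, True)\<close>: the flag
  records that some step has led outside \<open>z\<close>, so that steps from \<open>z\<close> to
  itself do not count as returns.\<close>

definition flagged :: "('v clock \<Rightarrow> 's \<Rightarrow> 's) \<Rightarrow> 's \<Rightarrow> 'v clock \<Rightarrow> 's \<times> bool \<Rightarrow> 's \<times> bool" where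
  "flagged F z a = (\<lambda>(y, b). (F a y, b \<or> F a y \<noteq> z))"

definition back_time :: "('v clock \<Rightarrow> 's \<Rightarrow> 's) \<Rightarrow> 's \<Rightarrow> 's \<times> bool \<Rightarrow> ('v clock \<Rightarrow> nat \<Rightarrow> real) \<Rightarrow> ennreal" where
  "back_time F z x \<omega> = (INF t\<in>{t. 0 \<le> t \<and> state_at F (fst x) t \<omega> = z \<and>
     (snd x \<or> (\<exists>s. 0 \<le> s \<and> s < t \<and> state_at F (fst x) s \<omega> \<noteq> z))}. ennreal t)"

text \<open>Each time at which the restarted process is back yields, after adding the first epoch,
  such a time for the original process. This direction suffices to bound return times from
  above.\<close>

lemma back_time_step:
  assumes \<omega>: "regular \<omega>" and a: "a \<in> A" "is_first a \<omega>"
  shows "back_time F z x \<omega> \<le> ennreal (\<omega> a 0) + back_time F z (flagged F z a x) (shift a \<omega>)"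
proof -
  obtain y b where x: "x = (y, b)" by (cases x)
  let ?T = "{t. 0 \<le> t \<and> state_at F (F a y) t (shift a \<omega>) = z \<and>
     ((b \<or> F a y \<noteq> z) \<or> (\<exists>s. 0 \<le> s \<and> s < t \<and> state_at F (F a y) s (shift a \<omega>) \<noteq> z))}"
  have t1: "0 < \<omega> a 0" by (rule regular_pos[OF \<omega> a(1)])
  have after: "state_at F y (t + \<omega> a 0) \<omega> = state_at F (F a y) t (shift a \<omega>)" if "0 \<le> t" for t
    using state_at_after[OF \<omega> a(2,1), of "t + \<omega> a 0" F y] that by simp
  have at_0: "state_at F (F a y) 0 (shift a \<omega>) = F a y"
    by (rule state_at_0[OF regular_shift[OF \<omega> a]])
  have le: "back_time F z x \<omega> \<le> ennreal (\<omega> a 0) + ennreal t" if "t \<in> ?T" for t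
  proof -
    have t: "0 \<le> t" "state_at F (F a y) t (shift a \<omega>) = z"
      and left: "b \<or> F a y \<noteq> z \<or> (\<exists>s. 0 \<le> s \<and> s < t \<and> state_at F (F a y) s (shift a \<omega>) \<noteq> z)"
      using that by blast+
    have "b \<or> (\<exists>s. 0 \<le> s \<and> s < t + \<omega> a 0 \<and> state_at F y s \<omega> \<noteq> z)"
      using left
    proof (elim disjE exE conjE)
      \<comment> \<open>The first epoch itself shows that \<open>z\<close> was left. It lies
        strictly before the return, since at \<open>t = 0\<close> the restarted process is in
        \<open>F a y\<close>.\<close>
      assume neq: "F a y \<noteq> z"
      have "state_at F y (0 + \<omega> a 0) \<omega> \<noteq> z" unfolding after[OF order_refl] at_0 by (rule neq)
      moreover have "t \<noteq> 0" using t(2) at_0 neq by metis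
      ultimately show ?thesis using t(1) t1 by (intro disjI2 exI[of _ "0 + \<omega> a 0"]) simp
    next
      fix s assume s: "0 \<le> s" "s < t" "state_at F (F a y) s (shift a \<omega>) \<noteq> z"
      then have "state_at F y (s + \<omega> a 0) \<omega> \<noteq> z" unfolding after[OF s(1)] by blast
      then show ?thesis using s(1,2) t1 by (intro disjI2 exI[of _ "s + \<omega> a 0"]) simp
    qed blast
    moreover have "state_at F y (t + \<omega> a 0) \<omega> = z" unfolding after[OF t(1)] by (rule t(2))
    ultimately have "back_time F z x \<omega> \<le> ennreal (t + \<omega> a 0)"
      unfolding back_time_def x fst_conv snd_conv using t(1) t1 by (intro INF_lower CollectI conjI) simp_all
    also have "\<dots> = ennreal (\<omega> a 0) + ennreal t"
      using t(1) t1 by (subst ennreal_plus) (simp_all add: add.commute)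
    finally show ?thesis .
  qed
  have "back_time F z (flagged F z a x) (shift a \<omega>) = (INF t\<in>?T. ennreal t)"
    by (simp only: back_time_def flagged_def x prod.case fst_conv snd_conv)
  moreover have "back_time F z x \<omega> \<le> ennreal (\<omega> a 0) + (INF t\<in>?T. ennreal t)"
  proof -
    have "back_time F z x \<omega> - ennreal (\<omega> a 0) \<le> (INF t\<in>?T. ennreal t)"
      using le by (intro INF_greatest) (simp only: ennreal_minus_le_iff ennreal_neq_top simp_thms)
    then show ?thesis by (simp only: ennreal_minus_le_iff ennreal_neq_top simp_thms)
  qed
  ultimately show ?thesis by (simp only:)
qed

text \<open>With \<open>k = 1\<close> each event adds 1, so a path that misses
  \<open>(z, True)\<close> during \<open>n\<close> events has delay at least \<open>n\<close>. On
  any other path the delay dominates the actual time of return.\<close>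

lemma back_time_le_delay:
  assumes "regular \<omega>"
  shows "of_nat n \<le> delay 1 (flagged F z) {(z, True)} n x \<omega> \<or> back_time F z x \<omega> \<le> delay 1 (flagged F z) {(z, True)} n x \<omega>"
  using assms
proof (induction n arbitrary: x \<omega>)
  case (Suc n)
  show ?case
  proof (cases "x = (z, True)")
    case True
    then have "back_time F z x \<omega> \<le> ennreal 0"
      unfolding back_time_def using state_at_0[OF Suc.prems] by (intro INF_lower) auto
    then show ?thesis by simp
  next
    case False
    obtain a where a: "a \<in> A" "is_first a \<omega>" using ex_first[OF Suc.prems] by blast
    let ?d = "delay 1 (flagged F z) {(z, True)} n (flagged F z a x) (shift a \<omega>)"
    have t1: "0 < \<omega> a 0" by (rule regular_pos[OF Suc.prems a(1)])
    have d: "delay 1 (flagged F z) {(z, True)} (Suc n) x \<omega> = 1 + ennreal (\<omega> a 0) + ?d"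
      using delay_Suc[OF Suc.prems a, of x "{(z, True)}" 1 "flagged F z" n] False t1 by (simp add: ennreal_plus)
    from Suc.IH[OF regular_shift[OF Suc.prems a], of "flagged F z a x"] show ?thesis
    proof
      assume "of_nat n \<le> ?d"
      then have "of_nat n \<le> ennreal (\<omega> a 0) + ?d" by (rule add_increasing[OF zero_le])
      then have "1 + of_nat n \<le> 1 + (ennreal (\<omega> a 0) + ?d)" by (rule add_left_mono)
      then have "of_nat (Suc n) \<le> 1 + ennreal (\<omega> a 0) + ?d" by (simp only: of_nat_Suc add.assoc)
      then show ?thesis unfolding d by blast
    next
      assume "back_time F z (flagged F z a x) (shift a \<omega>) \<le> ?d"
      then have "ennreal (\<omega> a 0) + back_time F z (flagged F z a x) (shift a \<omega>) \<le> ennreal (\<omega> a 0) + ?d"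
        by (rule add_left_mono)
      also have "\<dots> \<le> 1 + ennreal (\<omega> a 0) + ?d" by (simp add: add.assoc)
      finally show ?thesis unfolding d using back_time_step[OF Suc.prems a, of F z x] by (blast intro: order_trans)
    qed
  qed
qed simp

text \<open>If the first alternative of \<open>back_time_le_delay\<close> holds for every
  \<open>n\<close>, the supremum of the delays is infinite; so it dominates the return time on every
  regular path, and monotone convergence transfers the bound on \<open>hit\<close>.\<close>

lemma nn_integral_back_time:
  assumes bound: "\<And>n. letter_chain.hit A pick (flagged F z) {(z, True)} n x \<le> b"
  shows "(\<integral>\<^sup>+\<omega>. back_time F z x \<omega> \<partial>M) < \<infinity>"
proof -
  let ?d = "delay 1 (flagged F z) {(z, True)}"
  have "back_time F z x \<omega> \<le> (SUP n. ?d n x \<omega>)" if \<omega>: "regular \<omega>" for \<omega>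
  proof (cases "\<exists>n. back_time F z x \<omega> \<le> ?d n x \<omega>")
    case True
    then show ?thesis by (meson SUP_upper2 UNIV_I)
  next
    case False
    then have "of_nat n \<le> ?d n x \<omega>" for n
      using back_time_le_delay[OF \<omega>, of n F z x] by blast
    then have "(SUP n. of_nat n :: ennreal) \<le> (SUP n. ?d n x \<omega>)" by (intro SUP_mono) blast
    then have "(SUP n. ?d n x \<omega>) = top" unfolding ennreal_SUP_of_nat_eq_top by (simp only: top_unique)
    then show ?thesis by (simp only: top_greatest)
  qed
  then have "(\<integral>\<^sup>+\<omega>. back_time F z x \<omega> \<partial>M) \<le> (\<integral>\<^sup>+\<omega>. (SUP n. ?d n x \<omega>) \<partial>M)"
    using AE_regular by (intro nn_integral_mono_AE) (auto elim: eventually_mono)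
  also have "\<dots> = (SUP n. \<integral>\<^sup>+\<omega>. ?d n x \<omega> \<partial>M)"
    by (intro nn_integral_monotone_convergence_SUP measurable_delay incseq_SucI) (auto simp: le_fun_def delay_mono simp del: delay.simps)
  also have "\<dots> \<le> event_delay 1 * ennreal b"
    unfolding nn_integral_delay using bound by (intro SUP_least mult_left_mono ennreal_leI) auto
  also have "\<dots> < \<infinity>"
    using event_delay_finite[of 1] by (simp add: ennreal_mult_less_top)
  finally show ?thesis .
qed

text \<open>A coupling: chain and walk are driven by the same clocks and \<open>Q\<close> gains at
  least \<open>g a\<close> at each event, so it stays above the walk until the walk enters
  \<open>{..0}\<close>. With \<open>k = 0\<close> the delay is actual time.\<close>

lemma positive_before_delay:
  fixes g :: "'v clock \<Rightarrow> int" and Q :: "'s \<Rightarrow> int"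
  assumes step: "\<And>a y. a \<in> A \<Longrightarrow> Q y + g a \<le> Q (F a y)"
    and "regular \<omega>" "d \<le> Q y" "0 \<le> t" "ennreal t < delay 0 (\<lambda>a d. d + g a) {..0} n d \<omega>"
  shows "0 < Q (state_at F y t \<omega>)"
  using assms(2-)
proof (induction n arbitrary: d y t \<omega>)
  case (Suc n)
  have d: "0 < d" using Suc.prems(4) by (auto intro: ccontr)
  obtain a where a: "a \<in> A" "is_first a \<omega>" using ex_first[OF Suc.prems(1)] by blast
  have t1: "0 < \<omega> a 0" by (rule regular_pos[OF Suc.prems(1) a(1)])
  show ?case
  proof (cases "t < \<omega> a 0")
    case True
    then have "state_at F y t \<omega> = y" by (rule state_at_before[OF Suc.prems(1) a(2,1)])
    then show ?thesis using d Suc.prems(2) by simp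
  next
    case False
    have "ennreal t < ennreal (\<omega> a 0) + delay 0 (\<lambda>a d. d + g a) {..0} n (d + g a) (shift a \<omega>)"
      using Suc.prems(4) d delay_Suc[OF Suc.prems(1) a, of d "{..0}" 0 "\<lambda>a d. d + g a" n] by (simp del: delay.simps)
    moreover have "ennreal t = ennreal (\<omega> a 0) + ennreal (t - \<omega> a 0)"
      using False t1 by (subst ennreal_plus[symmetric]) auto
    ultimately have "ennreal (t - \<omega> a 0) < delay 0 (\<lambda>a d. d + g a) {..0} n (d + g a) (shift a \<omega>)"
      by (simp add: ennreal_add_left_cancel_less)
    then have "0 < Q (state_at F (F a y) (t - \<omega> a 0) (shift a \<omega>))"
      using step[OF a(1), of y] Suc.prems(2) False
      by (intro Suc.IH[OF regular_shift[OF Suc.prems(1) a]]) auto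
    then show ?thesis using state_at_after[OF Suc.prems(1) a(2,1), of t F y] False by simp
  qed
qed simp

end

section \<open>Recurrence\<close>

context network
begin

sublocale clk: poisson_clocks A rate
  by unfold_locales (auto simp: finite_clocks clocks_nonempty rate_pos)

lemma pick_eq: "clk.pick = p"
  by (simp add: fun_eq_iff clk.pick_def clk.total_rate_def p_def total_rate_def)

lemma clock_space_eq: "clock_space G arr c = clk.M"
  unfolding clock_space_def by (intro PiM_cong) (auto simp: rate_def)

lemma network_state_eq: "network_state G arr x t \<omega> = clk.state_at (transition G) x t \<omega>"
  by (simp add: network_state_def clk.state_at_def)

lemma return_time_eq: "return_time G arr x \<omega> = clk.back_time (transition G) x (x, False) \<omega>"
  unfolding return_time_def clk.back_time_def network_state_eq fst_conv snd_conv
  by (intro arg_cong[of _ _ Inf] image_cong refl) auto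

lemma absorbed_recurrent:
  assumes "\<And>a. a \<in> A \<Longrightarrow> transition G a x = x"
  shows "positive_recurrent G arr c x"
proof -
  have "AE \<omega> in clk.M. \<forall>t\<ge>0. clk.state_at (transition G) x t \<omega> = x"
    using clk.AE_regular by eventually_elim (simp add: clk.state_at_absorbed assms)
  then show ?thesis unfolding positive_recurrent_def clock_space_eq network_state_eq by (rule disjI1)
qed

lemma bounded_return_recurrent:
  assumes "\<And>n. letter_chain.hit A p (clk.flagged (transition G) x) {(x, True)} n (x, False) \<le> b"
  shows "positive_recurrent G arr c x"
proof -
  have "(\<integral>\<^sup>+\<omega>. clk.back_time (transition G) x (x, False) \<omega> \<partial>clk.M) < \<infinity>"
    by (rule clk.nn_integral_back_time[of _ _ _ b]) (use assms in \<open>simp only: pick_eq\<close>)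
  then show ?thesis unfolding positive_recurrent_def clock_space_eq return_time_eq by (rule disjI2)
qed

section \<open>Necessity of the cut condition: packets confined to an overloaded set\<close>

definition confined :: "'v set \<Rightarrow> 'v state \<Rightarrow> int" where
  "confined S y = int (length (filter (\<lambda>q. fst q \<in> S \<and> snd q \<subseteq> S) y))"

definition cut_change :: "'v set \<Rightarrow> 'v clock \<Rightarrow> int" where
  "cut_change S a = (case a of Arrival u \<Rightarrow> if u \<in> S then 1 else 0
     | Link e \<Rightarrow> if fst e \<in> S \<and> snd e \<notin> S then -1 else 0)"

text \<open>An epoch of a link out of \<open>S\<close> frees at most one packet and possibly none,
  hence the inequality. Departures are irrelevant, because a packet held at all nodes is not
  confined to the proper subset \<open>S\<close>.\<close>

lemma confined_transition:
  assumes "S \<subset> pverts G"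
  shows "confined S y + cut_change S a \<le> confined S (transition G a y)"
proof -
  have dep: "confined S (depart G z) = confined S z" for z
  proof -
    have "filter (\<lambda>q. fst q \<in> S \<and> snd q \<subseteq> S) (depart G z) = filter (\<lambda>q. fst q \<in> S \<and> snd q \<subseteq> S) z"
      unfolding depart_def filter_filter using assms by (intro filter_cong) auto
    then show ?thesis by (simp add: confined_def)
  qed
  have "confined S y + cut_change S a \<le> confined S (evolve a y)"
  proof (cases a)
    case (Arrival u)
    then show ?thesis by (simp add: confined_def cut_change_def)
  next
    case (Link e)
    have "confined S y + cut_change S (Link e) \<le> confined S (send_oldest_useful e y)"
      by (induction y) (auto simp: confined_def cut_change_def useful_def)
    then show ?thesis using Link by simp
  qed
  then show ?thesis by (simp add: transition_evolve dep)
qed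

lemma cut_change_drift:
  assumes S: "S \<subset> pverts G"
    and le: "(\<Sum>(u, v) | (u, v) \<in> parcs G \<and> u \<in> S \<and> v \<notin> S. c (u, v)) \<le> (\<Sum>u\<in>S. arr u)"
  shows "0 \<le> (\<Sum>a\<in>A. p a * real_of_int (cut_change S a))"
proof -
  interpret pair_fin_digraph G by (rule pair_fin)
  let ?g = "\<lambda>a. real_of_int (cut_change S a)"
  let ?C = "{(u, v). (u, v) \<in> parcs G \<and> u \<in> S \<and> v \<notin> S}"
  have finS: "finite S" using S by (meson finite_subset psubset_imp_subset pair_finite_verts)
  have "(\<Sum>a\<in>A. clock_rate arr c a * ?g a)
      = (\<Sum>a\<in>Arrival ` {u \<in> pverts G. arr u > 0}. clock_rate arr c a * ?g a) + (\<Sum>a\<in>Link ` parcs G. clock_rate arr c a * ?g a)"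
    unfolding clocks_def by (intro sum.union_disjoint) auto
  also have "(\<Sum>a\<in>Arrival ` {u \<in> pverts G. arr u > 0}. clock_rate arr c a * ?g a)
      = (\<Sum>u\<in>{u \<in> pverts G. arr u > 0}. if u \<in> S then arr u else 0)"
    by (subst sum.reindex) (auto simp: inj_on_def cut_change_def intro!: sum.cong)
  also have "\<dots> = (\<Sum>u\<in>{u \<in> pverts G. arr u > 0} \<inter> S. arr u)"
    by (simp add: sum.inter_restrict)
  also have "\<dots> = (\<Sum>u\<in>S. arr u)"
    using S finS arr_nonneg by (intro sum.mono_neutral_left) (auto simp: not_less intro!: antisym)
  also have "(\<Sum>a\<in>Link ` parcs G. clock_rate arr c a * ?g a) = (\<Sum>e\<in>parcs G. if e \<in> ?C then - c e else 0)"
    by (subst sum.reindex) (auto simp: inj_on_def cut_change_def intro!: sum.cong)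
  also have "\<dots> = (\<Sum>e\<in>parcs G \<inter> ?C. - c e)"
    by (simp add: sum.inter_restrict)
  also have "parcs G \<inter> ?C = ?C" by auto
  also have "(\<Sum>e\<in>?C. - c e) = - (\<Sum>(u, v)\<in>?C. c (u, v))"
    by (simp add: sum_negf case_prod_unfold)
  finally have "0 \<le> (\<Sum>a\<in>A. clock_rate arr c a * ?g a)" using le by simp
  moreover have "(\<Sum>a\<in>A. p a * ?g a) = (\<Sum>a\<in>A. clock_rate arr c a * ?g a) / total_rate"
    by (simp add: p_def rate_def sum_divide_distrib)
  ultimately show ?thesis using total_rate_pos by simp
qed

text \<open>While the number of packets that have not left S exceeds a walk without negative drift that
  is started in 1, the network does not return to the empty state.\<close>

lemma overloaded_not_recurrent:
  assumes S: "S \<subset> pverts G" "(\<Sum>u\<in>S. arr u) > 0"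
    and le: "(\<Sum>(u, v) | (u, v) \<in> parcs G \<and> u \<in> S \<and> v \<notin> S. c (u, v)) \<le> (\<Sum>u\<in>S. arr u)"
  shows "\<not> positive_recurrent G arr c []"
proof -
  interpret walk: biased_walk A p "cut_change S"
    using cut_change_drift[OF S(1) le] by unfold_locales (auto simp: cut_change_def split: clock.split)
  let ?F = "transition G" and ?W = "\<lambda>a d. d + cut_change S a"
  obtain u where u: "u \<in> S" "arr u > 0"
    using S(2) by (metis not_less sum_nonpos)
  define a where "a = Arrival u"
  have a: "a \<in> A" using u S by (auto simp: a_def clocks_def)
  have Qa: "1 \<le> confined S (?F a [])"
    using confined_transition[OF S(1), of "[]" a] u by (simp add: a_def cut_change_def confined_def)
  have Q0: "confined S [] = 0" by (simp add: confined_def)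
  have "\<not> (AE \<omega> in clk.M. \<forall>t\<ge>0. clk.state_at ?F [] t \<omega> = [])"
  proof
    assume "AE \<omega> in clk.M. \<forall>t\<ge>0. clk.state_at ?F [] t \<omega> = []"
    then have "AE \<omega> in clk.M. \<not> clk.is_first a \<omega>"
      using clk.AE_regular
    proof eventually_elim
      case (elim \<omega>)
      show ?case
      proof
        assume first: "clk.is_first a \<omega>"
        have "clk.state_at ?F [] (\<omega> a 0) \<omega> = clk.state_at ?F (?F a []) 0 (clk.shift a \<omega>)"
          using clk.state_at_after[OF elim(2) first a order_refl] by simp
        also have "\<dots> = ?F a []" by (rule clk.state_at_0[OF clk.regular_shift[OF elim(2) a first]])
        finally have "?F a [] = []" using elim(1) clk.regular_pos[OF elim(2) a, of 0] by simp
        then show False using Qa Q0 by simp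
      qed
    qed
    then show False using clk.not_AE_not_first[OF a] by simp
  qed
  moreover have "(\<integral>\<^sup>+\<omega>. clk.back_time ?F [] ([], False) \<omega> \<partial>clk.M) = \<infinity>"
  proof (rule ccontr)
    let ?I = "\<integral>\<^sup>+\<omega>. clk.back_time ?F [] ([], False) \<omega> \<partial>clk.M"
    assume "?I \<noteq> \<infinity>"
    then have fin: "?I < \<infinity>" by (simp add: less_top)
    \<comment> \<open>On paths whose first event is the arrival at \<open>u\<close>, the network is
      empty again no sooner than the walk restarted in 1 enters \<open>{..0}\<close>. By
      \<open>hit_unbounded\<close> these lower bounds are unbounded in \<open>n\<close>.\<close>
    have low: "ennreal (clk.pick a) * (clk.event_delay 0 * ennreal (walk.hit {..0} n 1)) \<le> ?I" for n
    proof -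
      have "ennreal (clk.pick a) * (clk.event_delay 0 * ennreal (walk.hit {..0} n 1))
          = (\<integral>\<^sup>+\<omega>. indicator {\<omega>. clk.is_first a \<omega>} \<omega> * clk.delay 0 ?W {..0} n 1 (clk.shift a \<omega>) \<partial>clk.M)"
        unfolding clk.nn_integral_first_shift[OF a clk.measurable_delay] clk.nn_integral_delay clk.pick_def[symmetric]
        by (simp only: pick_eq)
      also have "\<dots> \<le> ?I"
      proof (rule nn_integral_mono_AE)
        show "AE \<omega> in clk.M. indicator {\<omega>. clk.is_first a \<omega>} \<omega> * clk.delay 0 ?W {..0} n 1 (clk.shift a \<omega>)
            \<le> clk.back_time ?F [] ([], False) \<omega>"
          using clk.AE_regular
        proof eventually_elim
          case (elim \<omega>)
          show ?case
          proof (cases "clk.is_first a \<omega>")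
            case True
            have "clk.delay 0 ?W {..0} n 1 (clk.shift a \<omega>) \<le> clk.back_time ?F [] ([], False) \<omega>"
              unfolding clk.back_time_def fst_conv snd_conv
            proof (rule INF_greatest)
              fix t assume t: "t \<in> {t. 0 \<le> t \<and> clk.state_at ?F [] t \<omega> = [] \<and>
                (False \<or> (\<exists>s\<ge>0. s < t \<and> clk.state_at ?F [] s \<omega> \<noteq> []))}"
              then obtain s where s: "s < t" "clk.state_at ?F [] s \<omega> \<noteq> []" by blast
              have "\<omega> a 0 \<le> s" using s(2) clk.state_at_before[OF elim True a, of s ?F "[]"] by (meson not_less)
              then have t1: "\<omega> a 0 \<le> t" using s(1) by simp
              have "clk.state_at ?F (?F a []) (t - \<omega> a 0) (clk.shift a \<omega>) = []"
                using t clk.state_at_after[OF elim True a t1, of ?F "[]"] by simp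
              then have "\<not> ennreal (t - \<omega> a 0) < clk.delay 0 ?W {..0} n 1 (clk.shift a \<omega>)"
                using clk.positive_before_delay[of "confined S" "cut_change S" ?F "clk.shift a \<omega>" 1 "?F a []" "t - \<omega> a 0" n,
                    OF confined_transition[OF S(1)] clk.regular_shift[OF elim a True] Qa] t1 Q0
                by auto
              then have "clk.delay 0 ?W {..0} n 1 (clk.shift a \<omega>) \<le> ennreal (t - \<omega> a 0)" by (simp only: not_less)
              also have "\<dots> \<le> ennreal t"
                using clk.regular_pos[OF elim a, of 0] by (intro ennreal_leI) simp
              finally show "clk.delay 0 ?W {..0} n 1 (clk.shift a \<omega>) \<le> ennreal t" .
            qed
            then show ?thesis using True by simp
          qed simp
        qed
      qed
      finally show ?thesis .
    qed
    have k: "0 < ennreal (clk.pick a) * clk.event_delay 0" "ennreal (clk.pick a) * clk.event_delay 0 < \<infinity>"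
      using clk.event_delay_pos clk.event_delay_finite[of 0] clk.pick_pos[of a]
      by (auto simp: ennreal_zero_less_mult_iff ennreal_mult_less_top)
    then obtain k where k: "0 < k" "ennreal (clk.pick a) * clk.event_delay 0 = ennreal k"
      by (cases "ennreal (clk.pick a) * clk.event_delay 0" rule: ennreal_cases) auto
    obtain i where i: "0 \<le> i" "?I = ennreal i" using fin by (cases ?I rule: ennreal_cases) auto
    obtain n where n: "i / k < walk.hit {..0} n 1" using walk.hit_unbounded by blast
    have "ennreal (k * walk.hit {..0} n 1) \<le> ennreal i"
      using low[of n] k i walk.hit_nonneg[of "{..0}" n 1] by (simp add: ennreal_mult mult.assoc[symmetric] less_imp_le)
    then have "k * walk.hit {..0} n 1 \<le> i" using i by simp
    then show False using n k by (simp add: pos_divide_less_eq mult.commute)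
  qed
  ultimately show ?thesis
    unfolding positive_recurrent_def clock_space_eq network_state_eq return_time_eq by simp
qed

end

section \<open>Sufficiency: positive recurrence of every reachable state\<close>

context subcritical_network
begin

text \<open>The drift bounds the mean time to reach the finitely many states with at most
  \<open>k\<close> packets. From each of them some word leads to \<open>(x, True)\<close>, so
  \<open>hit_finite_bound\<close> bounds the mean number of events until the return.\<close>

lemma recurrent:
  assumes x: "x \<in> reachable G arr"
  shows "positive_recurrent G arr c x"
proof (cases "\<forall>a\<in>A. transition G a x = x")
  case True
  then show ?thesis by (intro absorbed_recurrent) blast
next
  case False
  let ?T = "transition G" and ?F = "clk.flagged (transition G) x"
  interpret F: letter_chain A p ?F by unfold_locales
  \<comment> \<open>The invariant that the flag is set whenever the state differs from
    \<open>x\<close>; any word that ends outside \<open>x\<close> therefore sets it.\<close>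
  define R where "R = {(y, b). y \<in> reachable G arr \<and> (y \<noteq> x \<longrightarrow> b)}"
  have closed: "?F a y \<in> R" if "a \<in> A" "y \<in> R" for a y
    using that by (auto simp: R_def clk.flagged_def intro: reachable.step)
  have fst_fold: "fst (fold ?F w y) = fold ?T w (fst y)" for w y
    by (induction w arbitrary: y) (auto simp: clk.flagged_def)
  have flag_fold: "snd y \<Longrightarrow> snd (fold ?F w y)" for w y
    by (induction w arbitrary: y) (auto simp: clk.flagged_def)
  obtain k C where C: "0 \<le> C" and drift: "\<And>y. y \<in> reachable G arr \<Longrightarrow> k < length y \<Longrightarrow>
    \<exists>N>0. real N \<le> C * real (length y) \<and> mean N (\<lambda>w. real (length (fold ?T w y))) \<le> real (length y) / 2"
    using drift by metis
  define B where "B = {y :: 'a state \<times> bool. length (fst y) \<le> k}"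
  have "\<forall>y\<in>R - B. \<exists>N>0. real N \<le> C * real (length (fst y)) \<and>
      mean N (\<lambda>w. real (length (fst (fold ?F w y)))) \<le> real (length (fst y)) / 2"
  proof
    fix y assume "y \<in> R - B"
    then have "fst y \<in> reachable G arr" "k < length (fst y)" by (auto simp: R_def B_def)
    from drift[OF this] show "\<exists>N>0. real N \<le> C * real (length (fst y)) \<and>
        mean N (\<lambda>w. real (length (fst (fold ?F w y)))) \<le> real (length (fst y)) / 2"
      by (simp only: fst_fold)
  qed
  then obtain N where N: "\<And>y. y \<in> R - B \<Longrightarrow> 0 < N y \<and> real (N y) \<le> C * real (length (fst y)) \<and>
      mean (N y) (\<lambda>w. real (length (fst (fold ?F w y)))) \<le> real (length (fst y)) / 2"
    by metis
  have "F.hit B n y \<le> 2 * C * real (length (fst y))" if "y \<in> R" for n y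
    by (rule F.hit_drift[where R = R and N = N and V = "\<lambda>y. real (length (fst y))"]) (use closed N C that in auto)
  then have B: "\<exists>b. \<forall>n. F.hit B n y \<le> b" if "y \<in> R" for y using that by blast
  have fin: "finite (B \<inter> R)"
  proof (rule finite_subset)
    show "B \<inter> R \<subseteq> {y \<in> reachable G arr. length y \<le> k} \<times> UNIV" by (auto simp: B_def R_def)
    show "finite ({y \<in> reachable G arr. length y \<le> k} \<times> (UNIV :: bool set))"
      using finite_short by (intro finite_cartesian_product) auto
  qed
  have to_x: "\<exists>w. set w \<subseteq> A \<and> fold ?F w y \<in> {(x, True)}" if y: "y \<in> R" for y
  proof -
    have drained: "\<exists>w. set w \<subseteq> A \<and> fst (fold ?F w y) = []" if "y \<in> R" for y
      using drain[of "fst y"] that by (auto simp: R_def fst_fold)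
    \<comment> \<open>To be certain to leave \<open>x\<close>: drain the network, rebuild
      \<open>x\<close> from the empty state, then apply a clock that changes it. Draining and
      rebuilding once more leads to \<open>(x, True)\<close>.\<close>
    obtain w where w: "set w \<subseteq> A" "fst (fold ?F w y) \<noteq> x"
    proof -
      obtain w0 where w0: "set w0 \<subseteq> A" "fst (fold ?F w0 y) = []" using drained[OF y] by blast
      obtain v where v: "set v \<subseteq> A" "fold ?T v [] = x" using reachable_from_empty[OF x] by blast
      obtain a where a: "a \<in> A" "?T a x \<noteq> x" using False by blast
      have "fst (fold ?F (w0 @ v @ [a]) y) = fold ?T (v @ [a]) (fold ?T w0 (fst y))"
        unfolding fst_fold by simp
      also have "fold ?T w0 (fst y) = []" using w0(2) unfolding fst_fold .
      also have "fold ?T (v @ [a]) [] = ?T a x" using v(2) by simp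
      finally have "fst (fold ?F (w0 @ v @ [a]) y) = ?T a x" .
      then show ?thesis using that[of "w0 @ v @ [a]"] w0(1) v(1) a by (simp del: fold_append)
    qed
    have z: "fold ?F w y \<in> R" by (rule F.fold_closed[OF closed w(1) y])
    then have flag: "snd (fold ?F w y)" using w(2) by (auto simp: R_def)
    obtain w' where w': "set w' \<subseteq> A" "fst (fold ?F w' (fold ?F w y)) = []" using drained[OF z] by blast
    obtain v where v: "set v \<subseteq> A" "fold ?T v [] = x" using reachable_from_empty[OF x] by blast
    have split: "fold ?F (w @ w' @ v) y = fold ?F v (fold ?F w' (fold ?F w y))" by simp
    have "fold ?F (w @ w' @ v) y = (x, True)"
    proof (rule prod_eqI)
      show "fst (fold ?F (w @ w' @ v) y) = fst (x, True)"
        unfolding split fst_fold[of v] w'(2) v(2) by simp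
      show "snd (fold ?F (w @ w' @ v) y) = snd (x, True)"
        unfolding split using flag_fold[OF flag_fold[OF flag]] by simp
    qed
    then show ?thesis using w(1) w'(1) v(1) by (intro exI[of _ "w @ w' @ v"]) auto
  qed
  have "(x, False) \<in> R" using x by (simp add: R_def)
  from F.hit_finite_bound[OF closed fin p_pos B to_x this]
  obtain b where "\<And>n. F.hit {(x, True)} n (x, False) \<le> b" by blast
  then show ?thesis by (rule bounded_return_recurrent)
qed

end

text \<open>This case lies outside \<open>network\<close>, where the rates are normalised to
  probabilities. The empty state is then the only reachable one and is never left.\<close>

lemma no_clocks_stable:
  assumes no_clocks: "clocks G arr = {}"
  shows "stable_network G arr c"
proof -
  have "x = []" if "x \<in> reachable G arr" for x
    using that by induction (auto simp: no_clocks)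
  moreover have "network_state G arr [] t \<omega> = []" for t \<omega>
    using sorted_key_list_of_set_eqI[of "epoch \<omega>" "[]"] by (simp add: network_state_def no_clocks)
  ultimately show ?thesis by (auto simp: stable_network_def positive_recurrent_def)
qed

theorem theorem5p2:
  fixes G :: "'v pair_pre_digraph" and arr :: "'v \<Rightarrow> real" and c :: "'v \<times> 'v \<Rightarrow> real"
  assumes "pair_fin_digraph G"
    and "unique_path G"
    and "\<And>e. e \<in> parcs G \<Longrightarrow> c e > 0"
    and "\<And>u. u \<in> pverts G \<Longrightarrow> arr u \<ge> 0"
  shows "stable_network G arr c \<longleftrightarrow>
    (\<forall>S. S \<subset> pverts G \<and> (\<Sum>u\<in>S. arr u) > 0 \<longrightarrow>
       (\<Sum>u\<in>S. arr u) < (\<Sum>(u, v) | (u, v) \<in> parcs G \<and> u \<in> S \<and> v \<notin> S. c (u, v)))"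
proof (cases "clocks G arr = {}")
  case True
  \<comment> \<open>Without clocks all arrival rates vanish, so the cut condition holds
    vacuously.\<close>
  have "\<not> (\<Sum>u\<in>S. arr u) > 0" if "S \<subset> pverts G" for S
    using True that by (auto simp: clocks_def not_less intro!: sum_nonpos)
  then show ?thesis using no_clocks_stable[OF True] by blast
next
  case False
  interpret network G arr c by (rule network.intro) (use assms False in auto)
  show ?thesis
  proof
    assume stable: "stable_network G arr c"
    show "\<forall>S. S \<subset> pverts G \<and> (\<Sum>u\<in>S. arr u) > 0 \<longrightarrow>
       (\<Sum>u\<in>S. arr u) < (\<Sum>(u, v) | (u, v) \<in> parcs G \<and> u \<in> S \<and> v \<notin> S. c (u, v))"
    proof (intro allI impI, elim conjE)
      fix S assume "S \<subset> pverts G" "(\<Sum>u\<in>S. arr u) > 0"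
      then show "(\<Sum>u\<in>S. arr u) < (\<Sum>(u, v) | (u, v) \<in> parcs G \<and> u \<in> S \<and> v \<notin> S. c (u, v))"
        using overloaded_not_recurrent[of S] stable reachable.empty[of G arr]
        unfolding stable_network_def by (meson not_less)
    qed
  next
    assume cut: "\<forall>S. S \<subset> pverts G \<and> (\<Sum>u\<in>S. arr u) > 0 \<longrightarrow>
       (\<Sum>u\<in>S. arr u) < (\<Sum>(u, v) | (u, v) \<in> parcs G \<and> u \<in> S \<and> v \<notin> S. c (u, v))"
    interpret subcritical_network G arr c
    proof unfold_locales
      show "(\<Sum>s\<in>feeders (parcs G) e. arr s) < c e" if "e \<in> parcs G" for e
        by (rule link_load[OF assms(1,2) that assms(3,4)]) (use cut in auto)
      show "(u, v) \<in> (parcs G)\<^sup>*" if "u \<in> pverts G" "arr u > 0" "v \<in> pverts G" for u v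
        by (rule sources_reach[where G = G and arr = arr and c = c, OF assms(1) assms(4) _ that]) (use cut in auto)
    qed
    show "stable_network G arr c" using recurrent by (simp add: stable_network_def)
  qed
qed

end
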